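(* Let $\alpha$ be a measurable function on the unit circle $\mathbb{T}$. Then $\alpha\,d\lambda=\mu_u$ for some $u\in\mathcal{E}_1$ if and only if $\alpha$ is lower semicontinuous, $\alpha(e^{i\theta})\ge c>0$ on $\mathbb{T}$ for some constant $c$, and $$\int_{\mathbb{T}}\alpha\,d\lambda=1.$$
   Context: $\mathbb{D}=\{z\in\mathbb{C}:|z|<1\}$ is the unit disk, $\mathbb{T}=\partial\mathbb{D}$ is the unit circle, and $\lambda$ is the normalized Lebesgue measure on $\mathbb{T}$ ($\lambda(\mathbb{T})=1$). An exhaustion function is a continuous subharmonic function $u:\mathbb{D}\to[-\infty,0)$ such that $u(z)\to0$ as $|z|\to1$; the class of such functions is denoted $\mathcal{E}$. $\Delta$ is the Laplace operator (so $\Delta u$ is a non-negative measure on $\mathbb{D}$ for subharmonic $u$). $\mathcal{E}_1$ is the set of all $u\in\mathcal{E}$ with $\int_{\mathbb{D}}\Delta u=1$. For $u\in\mathcal{E}$ and $r<0$ put $B_{u,r}=\{z\in\mathbb{D}:u(z)<r\}$, $S_{u,r}=\{z\in\mathbb{D}:u(z)=r\}$, $u_r=\max\{u,r\}$, and $$\mu_{u,r}=\Delta u_r-\chi_{\mathbb{D}\setminus B_{u,r}}\,\Delta u,$$ which is a non-negative measure supported by $S_{u,r}$. For $u\in\mathcal{E}_1$ it is known (Demailly) that the measures $\mu_{u,r}$ converge weak-$*$ in $C^*(\overline{\mathbb{D}})$, as $r\to0^-$, to a non-negative measure supported by $\mathbb{T}$; this limit is denoted $\mu_u$.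
   Formalization: α is taken up to a.e. equality: the conditions are required of some function, possibly with value +∞, equal to α a.e.; read pointwise, "only if" fails (α = 1 except α(1) = 2, u = log|z|/(2π)). *)

theory Defs
  imports "HOL-Analysis.Analysis"
begin

section \<open>The circle and extended integrals\<close>

text \<open>Normalized Lebesgue measure on the unit circle, on the Lebesgue (completed Borel)
  \<open>\<sigma>\<close>-algebra; its space is \<^term>\<open>sphere (0::complex) 1\<close>.\<close>

definition circle_measure :: "complex measure" where
  "circle_measure =
     completion (distr (uniform_measure lborel {0..<2 * pi}) (restrict_space borel (sphere 0 1)) cis)"

text \<open>Lebesgue integral of an extended real function. It is meaningful when the positive or the
  negative part has a finite integral; otherwise it is \<open>\<infinity> - \<infinity> = \<infinity>\<close> by the convention of the
  type \<^typ>\<open>ereal\<close>.\<close>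

definition ereal_integral :: "'a measure \<Rightarrow> ('a \<Rightarrow> ereal) \<Rightarrow> ereal" where
  "ereal_integral M f =
     enn2ereal (\<integral>\<^sup>+ x. e2ennreal (f x) \<partial>M) - enn2ereal (\<integral>\<^sup>+ x. e2ennreal (- f x) \<partial>M)"

definition lsc_on :: "'a::topological_space set \<Rightarrow> ('a \<Rightarrow> ereal) \<Rightarrow> bool" where
  "lsc_on S f \<longleftrightarrow> (\<forall>x\<in>S. f x \<le> Liminf (at x within S) f)"

definition usc_on :: "'a::topological_space set \<Rightarrow> ('a \<Rightarrow> ereal) \<Rightarrow> bool" where
  "usc_on S f \<longleftrightarrow> (\<forall>x\<in>S. Limsup (at x within S) f \<le> f x)"


section \<open>Subharmonic functions and exhaustion functions\<close>

definition subharmonic_on :: "complex set \<Rightarrow> (complex \<Rightarrow> ereal) \<Rightarrow> bool" where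
  "subharmonic_on S u \<longleftrightarrow> usc_on S u \<and> (\<forall>z\<in>S. u z < \<infinity>) \<and>
     (\<forall>a r. 0 < r \<longrightarrow> cball a r \<subseteq> S \<longrightarrow>
        u a \<le> ereal_integral circle_measure (\<lambda>\<zeta>. u (a + of_real r * \<zeta>)))"

text \<open>The class \<open>\<E>\<close>. Only the values of \<open>u\<close> on the open unit disk matter. The last condition
  says that \<open>u z \<rightarrow> 0\<close> as \<open>|z| \<rightarrow> 1-\<close>, uniformly in the argument of \<open>z\<close>.\<close>

definition exhaustion_functions :: "(complex \<Rightarrow> ereal) set" where
  "exhaustion_functions = {u. continuous_on (ball 0 1) u \<and> subharmonic_on (ball 0 1) u \<and>
     (\<forall>z\<in>ball 0 1. u z < 0) \<and> (u \<longlongrightarrow> 0) (filtercomap norm (at_left 1))}"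


section \<open>The distributional Laplacian\<close>

definition partial_deriv :: "complex \<Rightarrow> (complex \<Rightarrow> real) \<Rightarrow> complex \<Rightarrow> real" where
  "partial_deriv v f = (\<lambda>z. frechet_derivative f (at z) v)"

text \<open>The directions \<open>1\<close> and \<open>\<i>\<close> give the partial derivatives in \<open>x\<close> and \<open>y\<close>, where
  \<open>z = x + \<i> y\<close>. A function is \<open>C\<^sup>\<infinity>\<close> iff all its iterated partial derivatives
  exist and are differentiable.\<close>

definition smooth :: "(complex \<Rightarrow> real) \<Rightarrow> bool" where
  "smooth f \<longleftrightarrow> (\<forall>ds z. set ds \<subseteq> {1, \<i>} \<longrightarrow> foldr partial_deriv ds f differentiable (at z))"

definition laplacian :: "(complex \<Rightarrow> real) \<Rightarrow> complex \<Rightarrow> real" where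
  "laplacian f z = partial_deriv 1 (partial_deriv 1 f) z + partial_deriv \<i> (partial_deriv \<i> f) z"

definition test_function_on :: "complex set \<Rightarrow> (complex \<Rightarrow> real) \<Rightarrow> bool" where
  "test_function_on S \<phi> \<longleftrightarrow>
     smooth \<phi> \<and> compact (closure {z. \<phi> z \<noteq> 0}) \<and> closure {z. \<phi> z \<noteq> 0} \<subseteq> S"

text \<open>\<open>\<Delta>u = \<nu>\<close> on the open set \<open>S\<close> in the sense of distributions, where \<open>u\<close> is locally integrable
  and \<open>\<nu>\<close> is a non-negative Borel measure on \<open>S\<close> that is finite on compact sets. Such a \<open>\<nu>\<close> is
  unique. The ordinary Laplacian is used, without a factor \<open>1/(2\<pi>)\<close>. Since \<open>u\<close> is finite almost
  everywhere, the value of \<^const>\<open>real_of_ereal\<close> at \<open>-\<infinity>\<close> is irrelevant.\<close>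

definition has_laplacian_on :: "complex set \<Rightarrow> (complex \<Rightarrow> ereal) \<Rightarrow> complex measure \<Rightarrow> bool" where
  "has_laplacian_on S u \<nu> \<longleftrightarrow>
     sets \<nu> = sets (restrict_space borel S) \<and>
     (\<forall>K. compact K \<longrightarrow> K \<subseteq> S \<longrightarrow> emeasure \<nu> K < \<infinity>) \<and>
     (AE z in lborel. z \<in> S \<longrightarrow> \<bar>u z\<bar> \<noteq> \<infinity>) \<and>
     (\<forall>K. compact K \<longrightarrow> K \<subseteq> S \<longrightarrow> set_integrable lborel K (\<lambda>z. real_of_ereal (u z))) \<and>
     (\<forall>\<phi>. test_function_on S \<phi> \<longrightarrow>
        (LINT z|\<nu>. \<phi> z) = (LINT z:S|lborel. real_of_ereal (u z) * laplacian \<phi> z))"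

definition exhaustion_functions_1 :: "(complex \<Rightarrow> ereal) set" where
  "exhaustion_functions_1 =
     {u \<in> exhaustion_functions. \<exists>\<nu>. has_laplacian_on (ball 0 1) u \<nu> \<and> emeasure \<nu> (ball 0 1) = 1}"


section \<open>Demailly's measures\<close>

text \<open>\<open>\<mu>\<close> is the measure \<open>\<mu>\<^bsub>u,r\<^esub> = \<Delta>(max u r) - \<chi>\<^bsub>D - B(u,r)\<^esub> \<Delta>u\<close> on the disk \<open>D\<close>, where
  \<open>B(u,r) = {z \<in> D. u z < r}\<close>. The subtracted term is moved to the other side: both measures may
  be infinite, but they are finite on compact sets, so the equation determines \<open>\<mu>\<close>.\<close>

definition level_measure :: "(complex \<Rightarrow> ereal) \<Rightarrow> real \<Rightarrow> complex measure \<Rightarrow> bool" where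
  "level_measure u r \<mu> \<longleftrightarrow>
     sets \<mu> = sets (restrict_space borel (ball 0 1)) \<and>
     (\<exists>\<nu> \<nu>\<^sub>r. has_laplacian_on (ball 0 1) u \<nu> \<and>
        has_laplacian_on (ball 0 1) (\<lambda>z. max (u z) (ereal r)) \<nu>\<^sub>r \<and>
        (\<forall>A\<in>sets \<mu>. emeasure \<mu> A + emeasure \<nu> (A - {z \<in> ball 0 1. u z < ereal r}) = emeasure \<nu>\<^sub>r A))"

text \<open>\<open>\<mu>\<close> is \<open>\<mu>\<^sub>u\<close>, the weak-* limit of \<open>\<mu>\<^bsub>u,r\<^esub>\<close> as \<open>r \<rightarrow> 0-\<close>, as a measure on the closed disk.\<close>

definition boundary_measure :: "(complex \<Rightarrow> ereal) \<Rightarrow> complex measure \<Rightarrow> bool" where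
  "boundary_measure u \<mu> \<longleftrightarrow>
     sets \<mu> = sets (restrict_space borel (cball 0 1)) \<and> finite_measure \<mu> \<and>
     (\<exists>M. (\<forall>r<0. level_measure u r (M r)) \<and>
        (\<forall>f :: complex \<Rightarrow> real. continuous_on (cball 0 1) f \<longrightarrow>
           ((\<lambda>r. LINT z|M r. f z) \<longlongrightarrow> (LINT z|\<mu>. f z)) (at_left 0)))"

text \<open>\<open>\<alpha> d\<lambda> = \<mu>\<close>, as set functions on the \<open>\<sigma>\<close>-algebra of \<open>\<mu>\<close>; a priori \<open>\<alpha>\<close> may have any sign.\<close>

definition is_circle_density :: "(complex \<Rightarrow> ereal) \<Rightarrow> complex measure \<Rightarrow> bool" where
  "is_circle_density \<alpha> \<mu> \<longleftrightarrow>
     (\<forall>A\<in>sets \<mu>. ereal_integral circle_measure (\<lambda>\<zeta>. indicator A \<zeta> * \<alpha> \<zeta>) = enn2ereal (emeasure \<mu> A))"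

end

theory Submission
  imports Defs "HOL-Probability.Probability" "HOL-Complex_Analysis.Complex_Analysis"
begin

text \<open>
  Testing the level measures against harmonic polynomials \<open>f\<close> gives
  \<open>\<integral> f d\<mu>\<^bsub>u,r\<^esub> = \<integral>\<^bsub>u < r\<^esub> f \<Delta>u\<close>, because \<open>max u r - u\<close> has compact support. Letting
  \<open>r \<rightarrow> 0-\<close> and using that harmonic polynomials are dense in the continuous functions on the circle,
  \<open>\<mu>\<^sub>u\<close> is the balayage of \<open>\<nu> = \<Delta>u\<close>: its density is \<open>\<integral> P(w, \<zeta>) d\<nu>(w)\<close> with the Poisson kernel \<open>P\<close>. This
  is lower semicontinuous by Fatou's lemma, bounded below by \<open>\<integral> (1 - |w|) / (1 + |w|) d\<nu>(w) > 0\<close>, and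
  has integral \<open>\<nu>(D) = 1\<close>.

  Conversely, a lower semicontinuous \<open>\<beta> \<ge> c > 0\<close> is a sum of harmonic polynomials
  \<open>F\<^sub>n = Re P\<^sub>n > 0\<close> on the circle. For large \<open>m\<^sub>n\<close> the function \<open>F\<^sub>n(z) (|z|\<^bsup>2 m\<^sub>n\<^esup> - 1) / (4 \<pi> m\<^sub>n)\<close> is
  uniformly small, negative and subharmonic in the disk, vanishes on the circle, and its Laplacian
  has balayage \<open>F\<^sub>n\<close>; \<open>u\<close> is the sum of these functions. The level measures of \<open>u\<close> are obtained as
  weak limits of \<open>h\<^sub>k''(U\<^sub>k) |\<nabla>U\<^sub>k|\<^sup>2 dA\<close>, where \<open>U\<^sub>k\<close> are the partial sums and the convex functions \<open>h\<^sub>k\<close>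
  smooth out \<open>max s r\<close>.
\<close>

section \<open>Smooth functions\<close>

text \<open>The predicate \<open>boundary_measure\<close> asks for a level measure at every r < 0,
  so the Laplacian of \<open>max u r\<close> has to be a measure that dominates \<Delta>u on {u
  \<ge> r}. Domination comes from the identity \<Delta>(h(U)) = h''(U) |\<nabla>U|^2 + h'(U)
  \<Delta>U with h'' \<ge> 0: the last term tends to the part of \<Delta>u on {u \<ge> r}, and what
  remains is a limit of non-negative densities. The set {u = r} may carry mass of \<Delta>u and
  belongs to the complement of B. The partial sums decrease to u, and with the shifted smoothing
  this forces h'(U) to tend to 1 there as well. The constant 4 \<pi> m comes from the Fourier modes.
  On the mode of degree j the Laplacian of (|z|^(2m) - 1) F multiplies by 4 m (m + j) |z|^(2m-2),
  while integration over the disk against the same mode contributes \<pi> / (m + j). The product 4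
  \<pi> m is independent of j, so the balayage is F whatever m is, and m stays free to make the
  summand small and subharmonic.\<close>

lemma partial_deriv_eqI:
  assumes "(f has_derivative f') (at z)"
  shows "partial_deriv v f z = f' v"
  using frechet_derivative_at[OF assms] by (simp add: partial_deriv_def)

text \<open>Smoothness is a greatest fixed point: a class of differentiable functions that is closed
  under both partial derivatives contains all iterated derivatives of its members. This replaces
  inductions over lists of directions.\<close>

lemma smooth_coinduct:
  assumes "P f"
    and "\<And>g z. P g \<Longrightarrow> g differentiable (at z)"
    and "\<And>g v. P g \<Longrightarrow> v \<in> {1, \<i>} \<Longrightarrow> P (partial_deriv v g)"
  shows "smooth f"
proof -
  have "P (foldr partial_deriv ds f)" if "set ds \<subseteq> {1, \<i>}" for ds
    using that by (induction ds) (use assms in auto)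
  with assms(2) show ?thesis unfolding smooth_def by blast
qed

lemma smooth_differentiable: "smooth f \<Longrightarrow> f differentiable (at z)"
  unfolding smooth_def by (drule spec[of _ "[]"]) simp

lemma smooth_partial_deriv:
  assumes "smooth f" "v \<in> {1, \<i>}"
  shows "smooth (partial_deriv v f)"
  unfolding smooth_def
proof safe
  fix ds z assume "set ds \<subseteq> {1, \<i>}"
  then have "foldr partial_deriv (ds @ [v]) f differentiable (at z)"
    using assms(2) by (intro assms(1)[unfolded smooth_def, rule_format]) auto
  then show "foldr partial_deriv ds (partial_deriv v f) differentiable (at z)" by simp
qed

lemma smooth_continuous_on: "smooth f \<Longrightarrow> continuous_on S f"
  by (meson continuous_at_imp_continuous_on differentiable_imp_continuous_within smooth_differentiable)

lemma smooth_has_derivative: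
  assumes "smooth f"
  shows "(f has_derivative (\<lambda>v. partial_deriv v f z)) (at z)"
  using smooth_differentiable[OF assms, of z] frechet_derivative_works
  unfolding partial_deriv_def by blast

lemma smooth_const: "smooth (\<lambda>z. c)"
proof (rule smooth_coinduct[where P="\<lambda>f. \<exists>c. f = (\<lambda>z. c)"])
  fix g :: "complex \<Rightarrow> real" and v :: complex assume "\<exists>c. g = (\<lambda>z. c)"
  then obtain c where g: "g = (\<lambda>z. c)" by blast
  have "partial_deriv v g z = 0" for z
    unfolding g by (rule partial_deriv_eqI) auto
  then have "partial_deriv v g = (\<lambda>z. 0)" by auto
  then show "\<exists>c. partial_deriv v g = (\<lambda>z. c)" by blast
qed auto

lemma smooth_bounded_linear:
  assumes "bounded_linear f"
  shows "smooth f"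
proof (rule smooth_coinduct[where P="\<lambda>g. g = f \<or> smooth g"])
  have d: "(f has_derivative f) (at z)" for z
    using assms by (rule bounded_linear_imp_has_derivative)
  fix g :: "complex \<Rightarrow> real" assume g: "g = f \<or> smooth g"
  show "g differentiable (at z)" for z
    using g d smooth_differentiable unfolding differentiable_def by blast
  fix v :: complex assume v: "v \<in> {1, \<i>}"
  have "partial_deriv v f = (\<lambda>z. f v)"
    using partial_deriv_eqI[OF d] by blast
  then show "partial_deriv v g = f \<or> smooth (partial_deriv v g)"
    using g v smooth_partial_deriv smooth_const by metis
qed simp

lemma partial_deriv_add:
  assumes "smooth f" "smooth g"
  shows "partial_deriv v (\<lambda>z. f z + g z) = (\<lambda>z. partial_deriv v f z + partial_deriv v g z)"
  using has_derivative_add[OF smooth_has_derivative[OF assms(1)] smooth_has_derivative[OF assms(2)]]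
  by (intro ext partial_deriv_eqI) auto

lemma partial_deriv_mult:
  assumes "smooth f" "smooth g"
  shows "partial_deriv v (\<lambda>z. f z * g z) = (\<lambda>z. f z * partial_deriv v g z + partial_deriv v f z * g z)"
  using has_derivative_mult[OF smooth_has_derivative[OF assms(1)] smooth_has_derivative[OF assms(2)]]
  by (intro ext partial_deriv_eqI) auto

lemma smooth_add:
  assumes "smooth f" "smooth g"
  shows "smooth (\<lambda>z. f z + g z)"
proof (rule smooth_coinduct[where P="\<lambda>h. \<exists>f g. smooth f \<and> smooth g \<and> h = (\<lambda>z. f z + g z)"])
  fix h :: "complex \<Rightarrow> real"
  assume "\<exists>f g. smooth f \<and> smooth g \<and> h = (\<lambda>z. f z + g z)"
  then obtain f g where h: "smooth f" "smooth g" "h = (\<lambda>z. f z + g z)" by blast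
  show "h differentiable (at z)" for z
    unfolding h(3) using h(1,2) by (intro differentiable_add smooth_differentiable)
  fix v :: complex assume "v \<in> {1, \<i>}"
  then show "\<exists>f g. smooth f \<and> smooth g \<and> partial_deriv v h = (\<lambda>z. f z + g z)"
    unfolding h(3) partial_deriv_add[OF h(1,2)]
    by (intro exI[of _ "partial_deriv v f"] exI[of _ "partial_deriv v g"] conjI smooth_partial_deriv h refl)
qed (use assms in blast)

inductive smooth_hull :: "((complex \<Rightarrow> real) \<Rightarrow> bool) \<Rightarrow> (complex \<Rightarrow> real) \<Rightarrow> bool" for Q where
  mult: "Q f \<Longrightarrow> smooth g \<Longrightarrow> smooth_hull Q (\<lambda>z. f z * g z)"
| add: "smooth_hull Q f \<Longrightarrow> smooth_hull Q g \<Longrightarrow> smooth_hull Q (\<lambda>z. f z + g z)"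

text \<open>A smooth-module generated by functions whose partial derivatives stay in it consists of
  smooth functions; this absorbs the Leibniz and chain rules at all orders.\<close>

lemma smooth_hullI:
  assumes Q: "\<And>f z. Q f \<Longrightarrow> f differentiable (at z)"
    and pd: "\<And>f g v. Q f \<Longrightarrow> smooth g \<Longrightarrow> v \<in> {1, \<i>} \<Longrightarrow>
      smooth_hull Q (\<lambda>z. partial_deriv v f z * g z)"
    and f: "smooth_hull Q f"
  shows "smooth f"
proof -
  have *: "(\<forall>z. h differentiable (at z)) \<and> (\<forall>v\<in>{1, \<i>}. smooth_hull Q (partial_deriv v h))"
    if "smooth_hull Q h" for h
    using that
  proof induction
    case (mult f g)
    have df: "(f has_derivative (\<lambda>v. partial_deriv v f z)) (at z)" for z
      using Q[OF mult(1), of z] frechet_derivative_works unfolding partial_deriv_def by blast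
    note d = has_derivative_mult[OF df smooth_has_derivative[OF mult(2)]]
    have "partial_deriv v (\<lambda>z. f z * g z) = (\<lambda>z. f z * partial_deriv v g z + partial_deriv v f z * g z)" for v
      by (intro ext partial_deriv_eqI[OF d, THEN trans]) auto
    moreover have "smooth_hull Q (\<lambda>z. f z * partial_deriv v g z + partial_deriv v f z * g z)"
      if "v \<in> {1, \<i>}" for v
      by (intro smooth_hull.intros pd mult smooth_partial_deriv that)
    ultimately show ?case
      using d unfolding differentiable_def by auto
  next
    case (add f g)
    have df: "(f has_derivative (\<lambda>v. partial_deriv v f z)) (at z)"
        "(g has_derivative (\<lambda>v. partial_deriv v g z)) (at z)" for z
      using add.IH frechet_derivative_works unfolding partial_deriv_def by blast+
    note d = has_derivative_add[OF df]
    have "partial_deriv v (\<lambda>z. f z + g z) = (\<lambda>z. partial_deriv v f z + partial_deriv v g z)" for v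
      by (intro ext partial_deriv_eqI[OF d, THEN trans]) auto
    moreover have "smooth_hull Q (\<lambda>z. partial_deriv v f z + partial_deriv v g z)"
      if "v \<in> {1, \<i>}" for v
      using add.IH that by (intro smooth_hull.intros) auto
    ultimately show ?case
      using d unfolding differentiable_def by auto
  qed
  show ?thesis
    by (rule smooth_coinduct[where P="smooth_hull Q"]) (use * f in auto)
qed

lemma smooth_mult:
  assumes "smooth f" "smooth g"
  shows "smooth (\<lambda>z. f z * g z)"
proof (rule smooth_hullI[where Q=smooth])
  show "smooth_hull smooth (\<lambda>z. f z * g z)" using assms by (rule smooth_hull.mult)
  show "smooth_hull smooth (\<lambda>z. partial_deriv v f z * g z)"
    if "smooth f" "smooth g" "v \<in> {1, \<i>}" for f g v
    by (rule smooth_hull.mult[where Q=smooth and f="partial_deriv v f"])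
      (use that smooth_partial_deriv in auto)
qed (rule smooth_differentiable)

lemma smooth_cmult: "smooth f \<Longrightarrow> smooth (\<lambda>z. c * f z)"
  by (rule smooth_mult[OF smooth_const])

lemma smooth_uminus: "smooth f \<Longrightarrow> smooth (\<lambda>z. - f z)"
  using smooth_cmult[of f "-1"] by simp

lemma smooth_diff: "smooth f \<Longrightarrow> smooth g \<Longrightarrow> smooth (\<lambda>z. f z - g z)"
  using smooth_add[OF _ smooth_uminus, of f g] by simp

lemma smooth_Re: "smooth Re" and smooth_Im: "smooth Im"
  by (intro smooth_bounded_linear bounded_linear_Re bounded_linear_Im)+

lemma smooth_norm_square: "smooth (\<lambda>z. (norm z)\<^sup>2)"
proof -
  have "smooth (\<lambda>z. Re z * Re z + Im z * Im z)"
    by (intro smooth_add smooth_mult smooth_Re smooth_Im)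
  then show ?thesis by (simp only: cmod_power2) (simp add: power2_eq_square)
qed

lemma partial_deriv_comp:
  assumes "\<And>t. (G has_real_derivative G' t) (at t)"
    and "h differentiable (at z)"
  shows "partial_deriv v (\<lambda>z. G (h z)) z = G' (h z) * partial_deriv v h z"
    and "(\<lambda>z. G (h z)) differentiable (at z)"
proof -
  have dh: "(h has_derivative (\<lambda>v. partial_deriv v h z)) (at z)"
    using assms(2) frechet_derivative_works unfolding partial_deriv_def by blast
  have d: "((\<lambda>z. G (h z)) has_derivative (\<lambda>v. G' (h z) * partial_deriv v h z)) (at z)"
    using has_derivative_compose[OF dh, of G "\<lambda>x. G' (h z) * x"] assms(1)[of "h z"]
    by (simp add: has_field_derivative_def)
  show "partial_deriv v (\<lambda>z. G (h z)) z = G' (h z) * partial_deriv v h z"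
    using partial_deriv_eqI[OF d] by simp
  show "(\<lambda>z. G (h z)) differentiable (at z)"
    using d unfolding differentiable_def by blast
qed

text \<open>The chain rule turns the generator \<open>D n (h z)\<close> into
  \<open>D (Suc n) (h z)\<close> times the smooth factor \<open>partial_deriv v h z\<close>, so the
  smooth-module generated by all of these functions is closed under differentiation.\<close>

lemma smooth_comp:
  assumes D: "\<And>n t. (D n has_real_derivative D (Suc n) t) (at t)" and h: "smooth h"
  shows "smooth (\<lambda>z. D n (h z))"
proof -
  define Q where "Q f \<longleftrightarrow> (\<exists>n. f = (\<lambda>z. D n (h z)))" for f
  have "smooth (\<lambda>z. D n (h z) * 1)"
  proof (rule smooth_hullI[where Q=Q])
    show "smooth_hull Q (\<lambda>z. D n (h z) * 1)"
      by (rule smooth_hull.mult) (auto simp: Q_def intro: smooth_const)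
    fix f assume "Q f"
    then obtain n where f: "f = (\<lambda>z. D n (h z))" unfolding Q_def by blast
    note pd = partial_deriv_comp[OF D smooth_differentiable[OF h]]
    show "f differentiable (at z)" for z unfolding f by (rule pd(2))
    fix g v assume g: "smooth g" "v \<in> {1, \<i>}"
    have "smooth_hull Q (\<lambda>z. D (Suc n) (h z) * (partial_deriv v h z * g z))"
      by (intro smooth_hull.mult smooth_mult smooth_partial_deriv g h) (auto simp: Q_def)
    then show "smooth_hull Q (\<lambda>z. partial_deriv v f z * g z)"
      unfolding f pd(1) by (simp add: mult.assoc)
  qed
  then show ?thesis by simp
qed

text \<open>One differentiation leads back to smooth functions, since the derivative
  \<open>b (h z)\<close> is already known to be smooth. It serves for the primitive of a bump, whose
  higher derivatives then need no names.\<close>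

lemma smooth_comp_antiderivative:
  assumes G: "\<And>t. (G has_real_derivative b t) (at t)"
    and b: "smooth (\<lambda>z. b (h z))" and h: "smooth h"
  shows "smooth (\<lambda>z. G (h z))"
proof (rule smooth_coinduct[where P="\<lambda>f. f = (\<lambda>z. G (h z)) \<or> smooth f"])
  fix g assume g: "g = (\<lambda>z. G (h z)) \<or> smooth g"
  note pd = partial_deriv_comp[OF G smooth_differentiable[OF h]]
  show "g differentiable (at z)" for z
    using g pd(2) smooth_differentiable by blast
  fix v :: complex assume v: "v \<in> {1, \<i>}"
  have "partial_deriv v (\<lambda>z. G (h z)) = (\<lambda>z. b (h z) * partial_deriv v h z)"
    by (intro ext pd(1))
  then show "partial_deriv v g = (\<lambda>z. G (h z)) \<or> smooth (partial_deriv v g)"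
    using g v smooth_mult[OF b smooth_partial_deriv[OF h v]] smooth_partial_deriv[of g v] by metis
qed simp

section \<open>Flat functions, smooth steps and radial plateaus\<close>

definition flat_exp :: "real \<Rightarrow> real" where
  "flat_exp t = (if t > 0 then exp (- 1 / t) else 0)"

text \<open>For t > 0 the n-th derivative of exp (-1/t) is p(x) exp (-x) with x = 1/t and p =
  \<open>flat_poly n\<close>. The recursion is d/dt = -x^2 d/dx applied to this expression.\<close>

primrec flat_poly :: "nat \<Rightarrow> real poly" where
  "flat_poly 0 = 1"
| "flat_poly (Suc n) = [:0, 0, 1:] * (flat_poly n - pderiv (flat_poly n))"

lemma tendsto_poly_exp_0: "((\<lambda>x. poly p x * exp (- x)) \<longlongrightarrow> 0) (at_top :: real filter)"
proof -
  have "((\<lambda>x. coeff p i * (x ^ i / exp x)) \<longlongrightarrow> coeff p i * 0) at_top" for i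
    by (intro tendsto_mult tendsto_const tendsto_power_div_exp_0)
  then have "((\<lambda>x. \<Sum>i\<le>degree p. coeff p i * (x ^ i / exp x)) \<longlongrightarrow> 0) at_top"
    by (intro tendsto_null_sum) auto
  then show ?thesis
    by (simp add: poly_altdef sum_distrib_right exp_minus divide_inverse mult.assoc)
qed

lemma flat_poly_has_derivative:
  "((\<lambda>t. if t > 0 then poly (flat_poly n) (1 / t) * exp (- 1 / t) else 0) has_real_derivative
    (if t > 0 then poly (flat_poly (Suc n)) (1 / t) * exp (- 1 / t) else 0)) (at t)"
  (is "(?f has_real_derivative ?f' t) _")
proof (cases t "0 :: real" rule: linorder_cases)
  case less
  have "eventually (\<lambda>s. s < 0) (nhds t)"
    using less by (intro eventually_nhds_in_open[of "{..<0}", simplified]) auto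
  then have ev: "eventually (\<lambda>s. ?f s = 0) (nhds t)"
    by eventually_elim auto
  have "(?f has_real_derivative 0) (at t)"
    using DERIV_cong_ev[OF refl ev refl] by simp
  then show ?thesis using less by simp
next
  case greater
  have "eventually (\<lambda>s. s > 0) (nhds t)"
    using greater by (intro eventually_nhds_in_open[of "{0<..}", simplified]) auto
  then have ev: "eventually (\<lambda>s. ?f s = poly (flat_poly n) (1 / s) * exp (- 1 / s)) (nhds t)"
    by eventually_elim auto
  have "((\<lambda>s. poly (flat_poly n) (1 / s) * exp (- 1 / s)) has_real_derivative
      poly (pderiv (flat_poly n)) (1 / t) * (- 1 / t\<^sup>2) * exp (- 1 / t) +
      poly (flat_poly n) (1 / t) * (exp (- 1 / t) * (1 / t\<^sup>2))) (at t)"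
    using greater
    by (auto intro!: derivative_eq_intros DERIV_chain2[OF poly_DERIV] simp: power2_eq_square)
  also have "poly (pderiv (flat_poly n)) (1 / t) * (- 1 / t\<^sup>2) * exp (- 1 / t) +
      poly (flat_poly n) (1 / t) * (exp (- 1 / t) * (1 / t\<^sup>2)) = ?f' t"
    using greater by (simp add: field_simps power2_eq_square)
  finally show ?thesis
    using DERIV_cong_ev[OF refl ev refl] by blast
next
  case equal
  have inv: "filterlim (\<lambda>h::real. 1 / h) at_top (at_right 0)"
    using filterlim_inverse_at_top_right by (simp add: inverse_eq_divide)
  have "((\<lambda>h. (?f (0 + h) - ?f 0) / h) \<longlongrightarrow> 0) (at_right 0)"
  proof -
    \<comment> \<open>In terms of x = 1/h the difference quotient on the right is x p(x) exp (-x);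
      division by h is the extra factor \<open>[:0, 1:]\<close>.\<close>
    have "((\<lambda>h. poly ([:0, 1:] * flat_poly n) (1 / h) * exp (- (1 / h))) \<longlongrightarrow> 0) (at_right 0)"
      by (rule filterlim_compose[OF tendsto_poly_exp_0 inv])
    then show ?thesis
      by (rule tendsto_cong[THEN iffD1, rotated])
         (auto simp: eventually_at_filter)
  qed
  moreover have "((\<lambda>h. (?f (0 + h) - ?f 0) / h) \<longlongrightarrow> 0) (at_left 0)"
    by (rule tendsto_eventually) (auto simp: eventually_at_filter)
  ultimately show ?thesis
    unfolding DERIV_def equal by (subst filterlim_at_split) auto
qed

lemma smooth_flat_exp:
  assumes "smooth h"
  shows "smooth (\<lambda>z. flat_exp (h z))"
  using smooth_comp[of "\<lambda>n t. if t > 0 then poly (flat_poly n) (1 / t) * exp (- 1 / t) else 0", OF flat_poly_has_derivative assms, of 0]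
  by (simp add: flat_exp_def cong: if_cong)

lemma flat_exp_nonneg: "flat_exp t \<ge> 0"
  by (simp add: flat_exp_def)

lemma flat_exp_isCont: "isCont flat_exp t"
  using DERIV_isCont[OF flat_poly_has_derivative[of 0 t]] by (simp add: flat_exp_def[abs_def] cong: if_cong)

text \<open>The step is the normalized primitive of the bump
  \<open>flat_exp t * flat_exp (1 - t)\<close>, which is positive exactly on (0, 1).\<close>

lemma smooth_step_exists:
  obtains H :: "real \<Rightarrow> real" where
    "\<And>h. smooth h \<Longrightarrow> smooth (\<lambda>z. H (h z))" "\<And>t. t \<le> 0 \<Longrightarrow> H t = 0" "\<And>t. t \<ge> 1 \<Longrightarrow> H t = 1"
    "\<And>t. 0 \<le> H t" "\<And>t. H t \<le> 1"
proof -
  define b where "b t = flat_exp t * flat_exp (1 - t)" for t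
  have cb: "isCont b t" for t
  proof -
    have "isCont (\<lambda>t. flat_exp (1 - t)) t"
      by (rule isCont_o2[OF _ flat_exp_isCont]) auto
    then show ?thesis unfolding b_def[abs_def] by (intro isCont_mult flat_exp_isCont)
  qed
  obtain F where F: "\<And>x. (F has_vector_derivative b x) (at x)"
    using einterval_antiderivative[of "-\<infinity>" \<infinity> b] cb by auto
  then have F': "(F has_real_derivative b x) (at x)" for x
    by (simp add: has_real_derivative_iff_has_vector_derivative)
  have b0: "b x \<ge> 0" for x by (simp add: b_def flat_exp_nonneg)
  have mono: "F x \<le> F y" if "x \<le> y" for x y
    using DERIV_nonneg_imp_nondecreasing[OF that, of F] F' b0 by blast
  have "F 0 < F 1"
  proof (rule DERIV_pos_imp_increasing_open[of 0 1 F])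
    show "\<exists>y. (F has_real_derivative y) (at x) \<and> 0 < y" if "0 < x" "x < 1" for x
      using that by (intro exI[of _ "b x"] conjI F') (auto simp: b_def flat_exp_def)
    show "continuous_on {0..1} F"
      using F' DERIV_continuous_on[of "{0..1}" F b] by (meson has_field_derivative_at_within)
  qed simp
  have left: "F t = F 0" if "t \<le> 0" for t
  proof (cases "t = 0")
    case False
    then have t: "t < 0" using that by simp
    obtain z where "t < z" "z < 0" "F 0 - F t = (0 - t) * b z"
      using MVT2[OF t, of F b] F' by auto
    then show ?thesis by (auto simp: b_def flat_exp_def)
  qed simp
  have right: "F t = F 1" if "t \<ge> 1" for t
  proof (cases "t = 1")
    case False
    then have t: "1 < t" using that by simp
    obtain z where "1 < z" "z < t" "F t - F 1 = (t - 1) * b z"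
      using MVT2[OF t, of F b] F' by auto
    then show ?thesis by (auto simp: b_def flat_exp_def)
  qed simp
  define H where "H t = 1 / (F 1 - F 0) * (F t - F 0)" for t
  show thesis
  proof (rule that[of H])
    fix h assume h: "smooth h"
    have "smooth (\<lambda>z. b (h z))"
      unfolding b_def by (intro smooth_mult smooth_flat_exp h smooth_diff smooth_const)
    then have "smooth (\<lambda>z. F (h z))"
      using F' h by (intro smooth_comp_antiderivative[of F b])
    then show "smooth (\<lambda>z. H (h z))"
      unfolding H_def by (intro smooth_cmult smooth_diff smooth_const)
  next
    fix t :: real
    show "t \<le> 0 \<Longrightarrow> H t = 0" "t \<ge> 1 \<Longrightarrow> H t = 1"
      using left[of t] right[of t] \<open>F 0 < F 1\<close> by (auto simp: H_def)
    have "F 0 \<le> F t"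
      using mono[of 0 t] left[of t] by (cases "t \<le> 0") auto
    then show "0 \<le> H t" using \<open>F 0 < F 1\<close> by (auto simp: H_def)
    have "F t \<le> F 1"
      using mono[of t 1] right[of t] by (cases "t \<le> 1") auto
    then show "H t \<le> 1" using \<open>F 0 < F 1\<close> by (auto simp: H_def divide_simps)
  qed
qed

lemma plateau_exists:
  assumes "0 \<le> s" "s < s'"
  obtains X :: "complex \<Rightarrow> real" where "smooth X" "\<And>z. 0 \<le> X z" "\<And>z. X z \<le> 1"
    "\<And>z. norm z \<le> s \<Longrightarrow> X z = 1" "\<And>z. s' \<le> norm z \<Longrightarrow> X z = 0"
proof -
  obtain H :: "real \<Rightarrow> real" where H:
    "\<And>h. smooth h \<Longrightarrow> smooth (\<lambda>z. H (h z))" "\<And>t. t \<le> 0 \<Longrightarrow> H t = 0" "\<And>t. t \<ge> 1 \<Longrightarrow> H t = 1"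
    "\<And>t. 0 \<le> H t" "\<And>t. H t \<le> 1"
    using smooth_step_exists by blast
  have pos: "s'\<^sup>2 - s\<^sup>2 > 0"
    using assms by (simp add: power_strict_mono)
  \<comment> \<open>The step is applied to an affine function of |z|^2 rather than of |z|, because
    |z| is not smooth at the origin.\<close>
  define h where "h z = 1 / (s'\<^sup>2 - s\<^sup>2) * (s'\<^sup>2 - (norm z)\<^sup>2)" for z :: complex
  have "smooth h" unfolding h_def
    by (intro smooth_cmult smooth_diff smooth_const smooth_norm_square)
  show thesis
  proof (rule that[of "\<lambda>z. H (h z)"])
    show "smooth (\<lambda>z. H (h z))" by (rule H(1)[OF \<open>smooth h\<close>])
    show "H (h z) = 1" if "norm z \<le> s" for z
    proof -
      have "(norm z)\<^sup>2 \<le> s\<^sup>2" using that by (intro power_mono) auto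
      then show ?thesis using pos by (intro H) (auto simp: h_def field_simps)
    qed
    show "H (h z) = 0" if "s' \<le> norm z" for z
    proof -
      have "s'\<^sup>2 \<le> (norm z)\<^sup>2" using that assms by (intro power_mono) auto
      then show ?thesis using pos by (intro H) (auto simp: h_def divide_simps)
    qed
  qed (use H in auto)
qed

section \<open>Integration by parts\<close>

lemma integrable_continuous_compact_support:
  fixes g :: "complex \<Rightarrow> real"
  assumes "continuous_on UNIV g" "compact K" "\<And>z. z \<notin> K \<Longrightarrow> g z = 0"
  shows "integrable lborel g"
proof -
  have "integrable lborel (\<lambda>z. indicator K z *\<^sub>R g z)"
    using assms by (intro borel_integrable_compact continuous_on_subset[OF assms(1)]) auto
  also have "(\<lambda>z. indicator K z *\<^sub>R g z) = g"
    using assms(3) by (auto simp: fun_eq_iff split: split_indicator)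
  finally show ?thesis .
qed

text \<open>Integration by parts uses the derivative along one line only. This weak notion is stable
  under composition with a function of a real variable, so it applies to smoothed maxima without
  establishing that they are \<open>smooth\<close>.\<close>

definition dir_deriv :: "complex \<Rightarrow> (complex \<Rightarrow> real) \<Rightarrow> (complex \<Rightarrow> real) \<Rightarrow> bool" where
  "dir_deriv v f f' \<longleftrightarrow> (\<forall>z. ((\<lambda>t. f (z + of_real t * v)) has_real_derivative f' z) (at 0))"

lemma dir_deriv_at:
  assumes "dir_deriv v f f'"
  shows "((\<lambda>t. f (z + of_real t * v)) has_real_derivative f' (z + of_real t * v)) (at t)"
proof -
  have "((\<lambda>s. f (z + of_real t * v + of_real s * v)) has_real_derivative f' (z + of_real t * v)) (at 0)"
    using assms by (simp add: dir_deriv_def)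
  then have "((\<lambda>s. f (z + of_real (s + t) * v)) has_real_derivative f' (z + of_real t * v)) (at 0)"
    by (simp add: algebra_simps)
  then show ?thesis
    using DERIV_shift[of "\<lambda>s. f (z + of_real s * v)" "f' (z + of_real t * v)" 0 t] by simp
qed

lemma dir_deriv_smooth:
  assumes "smooth f"
  shows "dir_deriv v f (partial_deriv v f)"
  unfolding dir_deriv_def
proof
  fix z
  have "((\<lambda>t. z + of_real t * v) has_derivative (\<lambda>t. of_real t * v)) (at 0)"
    by (auto intro!: derivative_eq_intros)
  then have "((\<lambda>t. f (z + of_real t * v)) has_derivative (\<lambda>t. partial_deriv (of_real t * v) f z)) (at 0)"
    using has_derivative_compose[of _ _ 0 UNIV f] smooth_has_derivative[OF assms, of z] by fastforce
  moreover have "partial_deriv (of_real t * v) f z = partial_deriv v f z * t" for t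
    using linear_scale[OF has_derivative_linear[OF smooth_has_derivative[OF assms, of z]], of t v]
    by (simp add: scaleR_conv_of_real)
  ultimately show "((\<lambda>t. f (z + of_real t * v)) has_real_derivative partial_deriv v f z) (at 0)"
    by (simp add: has_field_derivative_def)
qed

lemma dir_deriv_diff:
  "dir_deriv v f f' \<Longrightarrow> dir_deriv v g g' \<Longrightarrow> dir_deriv v (\<lambda>z. f z - g z) (\<lambda>z. f' z - g' z)"
  by (auto simp: dir_deriv_def intro: DERIV_diff)

lemma dir_deriv_mult:
  assumes "dir_deriv v f f'" "dir_deriv v g g'"
  shows "dir_deriv v (\<lambda>z. f z * g z) (\<lambda>z. f' z * g z + f z * g' z)"
  unfolding dir_deriv_def
proof
  fix z
  show "((\<lambda>t. f (z + of_real t * v) * g (z + of_real t * v)) has_real_derivative f' z * g z + f z * g' z) (at 0)"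
    using DERIV_mult[OF assms[unfolded dir_deriv_def, rule_format, of z]] by (simp add: algebra_simps)
qed

lemma dir_deriv_comp:
  assumes "\<And>t. (h has_real_derivative h' t) (at t)" "dir_deriv v f f'"
  shows "dir_deriv v (\<lambda>z. h (f z)) (\<lambda>z. h' (f z) * f' z)"
  unfolding dir_deriv_def
proof
  fix z
  show "((\<lambda>t. h (f (z + of_real t * v))) has_real_derivative h' (f z) * f' z) (at 0)"
    using DERIV_chain2[OF assms(1) assms(2)[unfolded dir_deriv_def, rule_format, of z]] by simp
qed

lemma dir_deriv_eq_0:
  assumes "dir_deriv v f f'" "closed K" "\<And>z. z \<notin> K \<Longrightarrow> f z = 0" "z \<notin> K"
  shows "f' z = 0"
proof -
  have "open ((\<lambda>t. z + of_real t * v) -` (- K))"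
    using assms(2) by (intro open_vimage) (auto intro!: continuous_intros)
  then have "eventually (\<lambda>t. t \<in> (\<lambda>t. z + of_real t * v) -` (- K)) (nhds (0::real))"
    using assms(4) by (intro eventually_nhds_in_open) auto
  then have ev: "eventually (\<lambda>t. f (z + of_real t * v) = 0) (nhds (0::real))"
    by eventually_elim (auto intro: assms(3))
  have "((\<lambda>t::real. f (z + of_real t * v)) has_real_derivative 0) (at 0)"
    using DERIV_cong_ev[OF refl ev refl] by simp
  with assms(1) show ?thesis
    unfolding dir_deriv_def using DERIV_unique by blast
qed

lemma integral_translation:
  fixes f :: "complex \<Rightarrow> real"
  shows "integrable lborel f \<Longrightarrow> integrable lborel (\<lambda>z. f (z + w))"
    and "integrable lborel f \<Longrightarrow> (LINT z|lborel. f (z + w)) = (LINT z|lborel. f z)"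
proof -
  assume f: "integrable lborel f"
  then have [measurable]: "f \<in> borel_measurable borel"
    using borel_measurable_integrable by fastforce
  have "integrable (distr lborel borel ((+) w)) f" using f by (simp add: lborel_distr_plus)
  then show "integrable lborel (\<lambda>z. f (z + w))"
    by (subst (asm) integrable_distr_eq) (auto simp: add.commute)
  have "(LINT z|lborel. f (z + w)) = (LINT z|distr lborel borel ((+) w). f z)"
    by (subst integral_distr) (auto simp: add.commute)
  then show "(LINT z|lborel. f (z + w)) = (LINT z|lborel. f z)" by (simp add: lborel_distr_plus)
qed

text \<open>By translation invariance the difference quotients of \<open>G\<close> have vanishing integral.\<close>

lemma integral_dir_deriv:
  assumes D: "dir_deriv v G g" and cG: "continuous_on UNIV G" and cg: "continuous_on UNIV g"
    and K: "compact K" and G0: "\<And>z. z \<notin> K \<Longrightarrow> G z = 0"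
  shows "(LINT z|lborel. g z) = 0"
proof -
  have g0: "g z = 0" if "z \<notin> K" for z
    using dir_deriv_eq_0[OF D compact_imp_closed[OF K] G0 that] by auto
  obtain C where C: "\<And>z. z \<in> K \<Longrightarrow> \<bar>g z\<bar> \<le> C"
    using compact_imp_bounded[OF compact_continuous_image[OF continuous_on_subset[OF cg] K]]
    unfolding bounded_iff by auto
  define C' where "C' = max C 0"
  have C': "\<bar>g z\<bar> \<le> C'" for z
    using C[of z] g0[of z] by (cases "z \<in> K") (auto simp: C'_def)
  obtain B where B: "\<And>z. z \<in> K \<Longrightarrow> norm z \<le> B"
    using compact_imp_bounded[OF K] unfolding bounded_iff by blast
  have intG: "integrable lborel G"
    by (rule integrable_continuous_compact_support[OF cG K G0])
  define q where "q n z = (G (z + of_real (1 / real (Suc n)) * v) - G z) * real (Suc n)" for n z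
  have intq: "(LINT z|lborel. q n z) = 0" for n
    unfolding q_def
    using integral_translation[OF intG] intG by (simp add: Bochner_Integration.integral_diff)
  have [measurable]: "G \<in> borel_measurable borel" "g \<in> borel_measurable borel"
    using cG cg by (auto intro: borel_measurable_continuous_onI)
  have lim: "(\<lambda>n. q n z) \<longlonglongrightarrow> g z" for z
  proof -
    have "((\<lambda>h. (G (z + of_real h * v) - G z) / h) \<longlongrightarrow> g z) (at 0)"
      using D unfolding dir_deriv_def DERIV_def by (auto dest!: spec[of _ z])
    moreover have "filterlim (\<lambda>n. 1 / real (Suc n)) (at 0) sequentially"
      unfolding filterlim_at using LIMSEQ_inverse_real_of_nat by (auto simp: inverse_eq_divide)
    ultimately have "(\<lambda>n. (G (z + of_real (1 / real (Suc n)) * v) - G z) / (1 / real (Suc n))) \<longlonglongrightarrow> g z"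
      by (rule filterlim_compose)
    then show ?thesis unfolding q_def by simp
  qed
  \<comment> \<open>The step lengths are at most 1, so the difference quotients live in one ball of
    radius \<open>B + norm v\<close>, and the mean value theorem bounds them there by the supremum
    of |g|. This is the majorant for dominated convergence.\<close>
  have bound: "\<bar>q n z\<bar> \<le> C' * indicator (cball 0 (B + norm v)) z" for n z
  proof (cases "z \<in> cball 0 (B + norm v)")
    case True
    have "\<exists>\<xi>. 0 < \<xi> \<and> \<xi> < 1 / real (Suc n) \<and> G (z + of_real (1 / real (Suc n)) * v) - G (z + of_real 0 * v)
      = (1 / real (Suc n) - 0) * g (z + of_real \<xi> * v)"
      by (intro MVT2) (auto intro: dir_deriv_at[OF D])
    then obtain \<xi> where "q n z = g (z + of_real \<xi> * v)"
      unfolding q_def by auto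
    then show ?thesis using C' True by simp
  next
    case False
    have "B < norm z" using False norm_ge_zero[of v] unfolding mem_cball_0 by linarith
    then have "z \<notin> K" using B[of z] by (auto simp: not_le)
    moreover have "z + of_real (1 / real (Suc n)) * v \<notin> K"
    proof
      assume "z + of_real (1 / real (Suc n)) * v \<in> K"
      then have "norm (z + of_real (1 / real (Suc n)) * v) \<le> B" by (rule B)
      moreover have "norm (of_real (1 / real (Suc n)) * v) \<le> 1 * norm v"
        unfolding norm_mult by (intro mult_right_mono) (auto simp: norm_divide norm_of_nat simp flip: of_nat_Suc)
      moreover have "norm z \<le> norm (z + of_real (1 / real (Suc n)) * v) + norm (of_real (1 / real (Suc n)) * v)"
        using norm_triangle_ineq4[of "z + of_real (1 / real (Suc n)) * v" "of_real (1 / real (Suc n)) * v"]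
        by (simp only: add_diff_cancel_right')
      ultimately show False using False by (simp only: mem_cball_0)
    qed
    ultimately show ?thesis using False by (simp add: q_def G0)
  qed
  have "(\<lambda>n. LINT z|lborel. q n z) \<longlonglongrightarrow> (LINT z|lborel. g z)"
  proof (rule integral_dominated_convergence)
    show "integrable lborel (\<lambda>z. C' * indicator (cball (0::complex) (B + norm v)) z)"
      by (intro integrable_mult_right integrable_real_indicator) (auto intro!: emeasure_bounded_finite[OF bounded_cball, unfolded infinity_ennreal_def])
    show "AE z in lborel. norm (q n z) \<le> C' * indicator (cball 0 (B + norm v)) z" for n
      using bound by simp
    show "q n \<in> borel_measurable lborel" for n unfolding q_def[abs_def] by measurable
  qed (use lim in auto)
  then show ?thesis unfolding intq by (simp add: LIMSEQ_const_iff)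
qed

definition dir_C2 :: "complex \<Rightarrow> (complex \<Rightarrow> real) \<Rightarrow> (complex \<Rightarrow> real) \<Rightarrow> (complex \<Rightarrow> real) \<Rightarrow> bool" where
  "dir_C2 v f f1 f2 \<longleftrightarrow> dir_deriv v f f1 \<and> dir_deriv v f1 f2 \<and>
     continuous_on UNIV f \<and> continuous_on UNIV f1 \<and> continuous_on UNIV f2"

lemma dir_C2_smooth:
  assumes "smooth f" "v \<in> {1, \<i>}"
  shows "dir_C2 v f (partial_deriv v f) (partial_deriv v (partial_deriv v f))"
  unfolding dir_C2_def using assms
  by (intro conjI dir_deriv_smooth smooth_continuous_on smooth_partial_deriv)

text \<open>The derivative of f g' - f' g along v is f g'' - f'' g, since the mixed terms cancel,
  and the support of g already gives this function compact support.\<close>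

lemma dir_C2_integral:
  assumes f: "dir_C2 v f f1 f2" and g: "dir_C2 v g g1 g2"
    and K: "compact K" and g0: "\<And>z. z \<notin> K \<Longrightarrow> g z = 0"
  shows "(LINT z|lborel. f z * g2 z) = (LINT z|lborel. f2 z * g z)"
proof -
  note f = f[unfolded dir_C2_def] and g = g[unfolded dir_C2_def]
  have K': "closed K" using K by (rule compact_imp_closed)
  have g10: "g1 z = 0" if "z \<notin> K" for z using dir_deriv_eq_0[of v g g1, OF _ K' g0 that] g by blast
  have g20: "g2 z = 0" if "z \<notin> K" for z using dir_deriv_eq_0[of v g1 g2, OF _ K' g10 that] g by blast
  have "dir_deriv v (\<lambda>z. f z * g1 z - f1 z * g z)
      (\<lambda>z. (f1 z * g1 z + f z * g2 z) - (f2 z * g z + f1 z * g1 z))"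
    using f g by (intro dir_deriv_diff dir_deriv_mult) auto
  then have "dir_deriv v (\<lambda>z. f z * g1 z - f1 z * g z) (\<lambda>z. f z * g2 z - f2 z * g z)"
    by (simp add: algebra_simps)
  then have "(LINT z|lborel. f z * g2 z - f2 z * g z) = 0"
    by (rule integral_dir_deriv[OF _ _ _ K]) (use f g g0 g10 in \<open>auto intro!: continuous_intros\<close>)
  moreover have "integrable lborel (\<lambda>z. f z * g2 z)" "integrable lborel (\<lambda>z. f2 z * g z)"
    using f g g0 g20
    by (auto intro!: integrable_continuous_compact_support[OF _ K] continuous_intros)
  ultimately show ?thesis by simp
qed

lemma partial_deriv2_eq_0:
  assumes "smooth \<phi>" "closed K" "\<And>z. z \<notin> K \<Longrightarrow> \<phi> z = 0" "z \<notin> K" "v \<in> {1, \<i>}"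
  shows "partial_deriv v (partial_deriv v \<phi>) z = 0"
proof (rule dir_deriv_eq_0[OF _ assms(2) _ assms(4)])
  show "dir_deriv v (partial_deriv v \<phi>) (partial_deriv v (partial_deriv v \<phi>))"
    by (intro dir_deriv_smooth smooth_partial_deriv assms)
  show "partial_deriv v \<phi> z = 0" if "z \<notin> K" for z
    by (rule dir_deriv_eq_0[OF dir_deriv_smooth[OF assms(1)] assms(2,3) that])
qed

section \<open>Test functions and Green's identity\<close>

lemma test_function_onE:
  assumes "test_function_on S \<phi>"
  obtains K where "smooth \<phi>" "compact K" "K \<subseteq> S" "\<And>z. z \<notin> K \<Longrightarrow> \<phi> z = 0"
    "\<And>z. z \<notin> K \<Longrightarrow> laplacian \<phi> z = 0" "continuous_on UNIV \<phi>" "continuous_on UNIV (laplacian \<phi>)"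
proof -
  let ?K = "closure {z. \<phi> z \<noteq> 0}"
  have s: "smooth \<phi>" and K: "compact ?K" "?K \<subseteq> S" using assms by (auto simp: test_function_on_def)
  have 0: "\<phi> z = 0" if "z \<notin> ?K" for z using that closure_subset[of "{z. \<phi> z \<noteq> 0}"] by blast
  have "partial_deriv v (partial_deriv v \<phi>) z = 0" if "z \<notin> ?K" "v \<in> {1, \<i>}" for v z
    by (rule partial_deriv2_eq_0[OF s closed_closure 0 that])
  then have l0: "laplacian \<phi> z = 0" if "z \<notin> ?K" for z using that by (simp add: laplacian_def)
  have cl: "continuous_on UNIV (laplacian \<phi>)"
    unfolding laplacian_def[abs_def]
    by (intro continuous_intros smooth_continuous_on smooth_partial_deriv s) auto
  show thesis
    by (rule that[OF s K 0 l0 smooth_continuous_on[OF s] cl])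
qed

lemma test_function_onI:
  assumes "smooth \<phi>" "compact K" "K \<subseteq> S" "\<And>z. z \<notin> K \<Longrightarrow> \<phi> z = 0"
  shows "test_function_on S \<phi>"
proof -
  have sub: "closure {z. \<phi> z \<noteq> 0} \<subseteq> K"
    by (rule closure_minimal[OF _ compact_imp_closed[OF assms(2)]]) (use assms(4) in blast)
  have "K \<inter> closure {z. \<phi> z \<noteq> 0} = closure {z. \<phi> z \<noteq> 0}"
    using sub by blast
  then have "compact (closure {z. \<phi> z \<noteq> 0})"
    using compact_Int_closed[OF assms(2) closed_closure, of "{z. \<phi> z \<noteq> 0}"] by metis
  then show ?thesis
    unfolding test_function_on_def using assms(1) order_trans[OF sub assms(3)] by (intro conjI)
qed

lemma green_identity:
  assumes "dir_C2 1 f fx fxx" "dir_C2 \<i> f fy fyy" "test_function_on S \<phi>"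
  shows "(LINT z|lborel. f z * laplacian \<phi> z) = (LINT z|lborel. (fxx z + fyy z) * \<phi> z)"
proof -
  obtain K where K: "smooth \<phi>" "compact K" "K \<subseteq> S" "\<And>z. z \<notin> K \<Longrightarrow> \<phi> z = 0"
    by (rule test_function_onE[OF assms(3)]) (rule that; assumption)
  have *: "integrable lborel (\<lambda>z. f z * partial_deriv v (partial_deriv v \<phi>) z)"
    "integrable lborel (\<lambda>z. f2 z * \<phi> z)"
    if "dir_C2 v f f1 f2" "v \<in> {1, \<i>}" for v f1 f2
  proof -
    have 0: "partial_deriv v (partial_deriv v \<phi>) z = 0" if "z \<notin> K" for z
      by (rule partial_deriv2_eq_0[OF K(1) compact_imp_closed[OF K(2)] K(4) that \<open>v \<in> _\<close>])
    show "integrable lborel (\<lambda>z. f z * partial_deriv v (partial_deriv v \<phi>) z)"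
      "integrable lborel (\<lambda>z. f2 z * \<phi> z)"
      by (rule integrable_continuous_compact_support[OF _ K(2)];
          use that in \<open>simp add: 0 K dir_C2_def continuous_on_mult smooth_continuous_on smooth_partial_deriv\<close>)+
  qed
  have "(LINT z|lborel. f z * laplacian \<phi> z) =
    (LINT z|lborel. f z * partial_deriv 1 (partial_deriv 1 \<phi>) z) +
    (LINT z|lborel. f z * partial_deriv \<i> (partial_deriv \<i> \<phi>) z)"
    using *(1)[OF assms(1)] *(1)[OF assms(2)] by (simp add: laplacian_def ring_distribs)
  also have "\<dots> = (LINT z|lborel. fxx z * \<phi> z) + (LINT z|lborel. fyy z * \<phi> z)"
    using dir_C2_integral[OF assms(1) dir_C2_smooth[OF K(1)] K(2,4)]
      dir_C2_integral[OF assms(2) dir_C2_smooth[OF K(1)] K(2,4)] by simp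
  also have "\<dots> = (LINT z|lborel. (fxx z + fyy z) * \<phi> z)"
    using *(2)[OF assms(1)] *(2)[OF assms(2)] by (simp add: ring_distribs)
  finally show ?thesis .
qed

section \<open>Weak compactness of measures on the disk\<close>

text \<open>A clamped cosine: it is \<open>0\<close> on \<open>[0, 1/3]\<close> and \<open>1\<close> on \<open>[2/3, 1]\<close> modulo \<open>2\<close>, so it reads off
  a ternary digit in Schoenberg's space-filling curve.\<close>

definition digit_fun :: "real \<Rightarrow> real" where
  "digit_fun t = max 0 (min 1 (1 / 2 - cos (pi * t)))"

text \<open>Coordinate \<open>j\<close> reads the ternary digits in the positions 2n + j, counted
  from 0, as binary digits. The coordinates 0 and 1 use disjoint sets of digits and can therefore be
  prescribed independently.\<close>

definition schoenberg :: "nat \<Rightarrow> real \<Rightarrow> real" where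
  "schoenberg j t = (\<Sum>n. digit_fun (3 ^ (2 * n + j) * t) / 2 ^ Suc n)"

lemma digit_fun_bounds: "0 \<le> digit_fun t" "digit_fun t \<le> 1"
  by (auto simp: digit_fun_def)

lemma summable_half: "summable (\<lambda>n. 1 / 2 ^ Suc n :: real)"
  using power_half_series by (rule sums_summable[THEN summable_cong[THEN iffD1, rotated]]) (auto simp: power_divide)

lemma continuous_schoenberg: "continuous_on UNIV (schoenberg j)"
proof -
  have "uniform_limit UNIV (\<lambda>N t. \<Sum>n<N. digit_fun (3 ^ (2 * n + j) * t) / 2 ^ Suc n) (schoenberg j) sequentially"
    unfolding schoenberg_def[abs_def]
    by (rule Weierstrass_m_test[OF _ summable_half])
       (use digit_fun_bounds in \<open>auto simp: divide_simps\<close>)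
  then show ?thesis
    by (rule uniform_limit_theorem[rotated])
       (auto simp: digit_fun_def intro!: always_eventually continuous_intros)
qed

lemma binary_expansion:
  assumes "0 \<le> x" "x \<le> (1::real)"
  obtains a :: "nat \<Rightarrow> nat" where "\<And>n. a n \<le> 1" "(\<lambda>n. real (a n) / 2 ^ Suc n) sums x"
proof -
  \<comment> \<open>Greedy expansion: \<open>y n\<close> is the remainder after n digits, scaled by
    2^n. It stays in [0, 1], also for x = 1, where every digit is 1.\<close>
  define y where "y = rec_nat x (\<lambda>_ y. 2 * y - (if y \<ge> 1 / 2 then 1 else 0))"
  define a where "a n = (if y n \<ge> 1 / 2 then 1 else 0 :: nat)" for n
  have y0: "y 0 = x" and ySuc: "y (Suc n) = 2 * y n - real (a n)" for n
    by (auto simp: y_def a_def)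
  have yb: "0 \<le> y n \<and> y n \<le> 1" for n
    by (induction n) (use assms in \<open>auto simp: y0 ySuc a_def\<close>)
  have partial: "(\<Sum>i<n. real (a i) / 2 ^ Suc i) = x - y n / 2 ^ n" for n
    by (induction n) (auto simp: y0 ySuc field_simps)
  have "(\<lambda>n. y n / 2 ^ n) \<longlonglongrightarrow> 0"
  proof (rule tendsto_sandwich)
    show "(\<lambda>n. 0) \<longlonglongrightarrow> (0::real)" "(\<lambda>n. (1 / 2) ^ n) \<longlonglongrightarrow> (0::real)"
      by (auto intro: LIMSEQ_realpow_zero)
  qed (use yb in \<open>auto simp: power_divide divide_simps\<close>)
  then have "(\<lambda>n. real (a n) / 2 ^ Suc n) sums x"
    unfolding sums_def partial using tendsto_diff[OF tendsto_const] by fastforce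
  then show thesis by (intro that[of a]) (auto simp: a_def)
qed

lemma digit_fun_ternary:
  assumes a: "\<And>n. a n \<le> (1::nat)"
  defines "t \<equiv> (\<Sum>n. 2 * real (a n) / 3 ^ Suc n)"
  shows "0 \<le> t" "t \<le> 1" "digit_fun (3 ^ k * t) = real (a k)"
proof -
  define T where "T k = (\<Sum>n. 2 * real (a (n + k)) / 3 ^ Suc n)" for k
  have g: "(\<lambda>n. 2 / 3 ^ Suc n) sums (1::real)"
    using sums_mult[OF geometric_sums[of "1 / 3 :: real"], of "2 / 3"] by (simp add: power_divide)
  have le: "2 * real (a n) / 3 ^ Suc m \<le> 2 / 3 ^ Suc m" for n m
    using a[of n] by (auto simp: divide_simps)
  have sm: "summable (\<lambda>n. 2 * real (a (n + k)) / 3 ^ Suc n)" for k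
    by (rule summable_comparison_test_ev[OF _ sums_summable[OF g]]) (use le in auto)
  have T01: "0 \<le> T k \<and> T k \<le> 1" for k
    unfolding T_def using suminf_nonneg[OF sm] suminf_le[OF le sm sums_summable[OF g]] sums_unique[OF g]
    by auto
  have TSuc: "3 * T k = 2 * real (a k) + T (Suc k)" for k
  proof -
    have "T k = 2 * real (a k) / 3 + (\<Sum>n. 2 * real (a (Suc n + k)) / 3 ^ Suc (Suc n))"
      unfolding T_def using suminf_split_head[OF sm, of k] by simp
    also have "(\<Sum>n. 2 * real (a (Suc n + k)) / 3 ^ Suc (Suc n)) = T (Suc k) / 3"
      unfolding T_def using suminf_divide[OF sm[of "Suc k"], of 3] by simp
    finally show ?thesis by simp
  qed
  have t: "t = T 0" by (simp add: t_def T_def)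
  show "0 \<le> t" "t \<le> 1" using T01[of 0] t by auto
  \<comment> \<open>The digits of \<open>t\<close> are 0 or 2, so multiplication by 3^k shifts the
    expansion up to an even integer, and the clamped cosine has period 2. Only the tail
    \<open>T k\<close> matters; its first digit decides between the outer thirds of [0, 1].\<close>
  have "\<exists>m::nat. 3 ^ k * t = 2 * real m + T k"
  proof (induction k)
    case (Suc k)
    then obtain m :: nat where m: "3 ^ k * t = 2 * real m + T k" by blast
    have "3 ^ Suc k * t = 3 * (2 * real m + T k)" using m by simp
    also have "\<dots> = 2 * real (3 * m + a k) + T (Suc k)" using TSuc[of k] by simp
    finally show ?case by blast
  qed (auto simp: t)
  then obtain m :: nat where m: "3 ^ k * t = 2 * real m + T k" by blast
  have "cos (pi * (3 ^ k * t)) = cos (pi * T k + 2 * pi * real m)"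
    unfolding m by (simp add: algebra_simps)
  also have "\<dots> = cos (pi * T k)"
    using cos_2npi[of m] sin_2npi[of m] by (simp add: cos_add mult_ac)
  finally have c: "cos (pi * (3 ^ k * t)) = cos (pi * T k)" .
  show "digit_fun (3 ^ k * t) = real (a k)"
  proof (cases "a k = 0")
    case True
    then have "T k \<le> 1 / 3" using TSuc[of k] T01[of "Suc k"] by auto
    then have "cos (pi * T k) \<ge> cos (pi / 3)"
      using T01[of k] by (intro cos_monotone_0_pi_le) (auto simp: field_simps)
    then show ?thesis using True by (auto simp: digit_fun_def c cos_60)
  next
    case False
    then have 1: "a k = 1" using a[of k] by auto
    then have "T k \<ge> 2 / 3" using TSuc[of k] T01[of "Suc k"] by auto
    then have "cos (pi * T k) \<le> cos (pi * (2 / 3))"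
      using T01[of k] by (intro cos_monotone_0_pi_le) (auto simp: field_simps)
    also have "cos (pi * (2 / 3)) = - 1 / 2"
      using cos_120 by (simp add: mult.commute)
    finally show ?thesis using 1 by (auto simp: digit_fun_def c)
  qed
qed

lemma schoenberg_surj:
  assumes "0 \<le> x" "x \<le> 1" "0 \<le> y" "y \<le> 1"
  obtains t where "0 \<le> t" "t \<le> 1" "schoenberg 0 t = x" "schoenberg 1 t = y"
proof -
  obtain a where a: "\<And>n. a n \<le> (1::nat)" "(\<lambda>n. real (a n) / 2 ^ Suc n) sums x"
    using binary_expansion[OF assms(1,2)] by blast
  obtain b where b: "\<And>n. b n \<le> (1::nat)" "(\<lambda>n. real (b n) / 2 ^ Suc n) sums y"
    using binary_expansion[OF assms(3,4)] by blast
  define d where "d n = (if even n then a (n div 2) else b (n div 2))" for n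
  have d: "d n \<le> 1" for n using a b by (auto simp: d_def)
  define t where "t = (\<Sum>n. 2 * real (d n) / 3 ^ Suc n)"
  note dt = digit_fun_ternary[where a=d, OF d, folded t_def]
  have "schoenberg 0 t = x" "schoenberg 1 t = y"
    unfolding schoenberg_def dt(3) using sums_unique[OF a(2)] sums_unique[OF b(2)] by (simp_all add: d_def)
  with dt(1,2) show thesis by (rule that)
qed

text \<open>Choosing the smallest parameter of each point makes the section Borel: its sublevel sets
  are images of compact parameter sets under the curve, together with the complement of the curve,
  where the section is 0. The pair reduces weak compactness on the disk to weak compactness on
  [0, 1].\<close>

lemma filling_curve_section:
  obtains c :: "real \<Rightarrow> complex" and s :: "complex \<Rightarrow> real" where
    "continuous_on UNIV c" "bounded (range c)" "s \<in> borel_measurable borel"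
    "\<And>z. 0 \<le> s z" "\<And>z. s z \<le> 1" "\<And>z. norm z \<le> 1 \<Longrightarrow> c (s z) = z"
proof -
  define c where "c t = Complex (2 * schoenberg 0 t - 1) (2 * schoenberg 1 t - 1)" for t
  have Int01: "{0..1} \<inter> {..1} = {0..1::real}" by auto
  define s where "s z = (if z \<in> c ` {0..1} then Inf {t \<in> {0..1}. c t = z} else 0)" for z
  have cc: "continuous_on UNIV c"
    unfolding c_def[abs_def] by (intro continuous_intros continuous_schoenberg)
  have surj: "z \<in> c ` {0..1}" if "norm z \<le> 1" for z
  proof -
    have "\<bar>Re z\<bar> \<le> 1" "\<bar>Im z\<bar> \<le> 1"
      using abs_Re_le_cmod[of z] abs_Im_le_cmod[of z] that by linarith+
    then have "0 \<le> (Re z + 1) / 2" "(Re z + 1) / 2 \<le> 1" "0 \<le> (Im z + 1) / 2" "(Im z + 1) / 2 \<le> 1"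
      by auto
    then obtain t where "0 \<le> t" "t \<le> 1" "schoenberg 0 t = (Re z + 1) / 2" "schoenberg 1 t = (Im z + 1) / 2"
      by (rule schoenberg_surj)
    then show ?thesis by (intro image_eqI[of _ _ t]) (auto simp: c_def complex_eq_iff)
  qed
  have cl: "closed {t \<in> {0..1}. c t = z}" for z
  proof -
    have "closed ({0..1} \<inter> c -` {z})"
      by (intro closed_Int closed_vimage cc) auto
    then show ?thesis by (simp add: Int_def vimage_def)
  qed
  have mem: "s z \<in> {t \<in> {0..1}. c t = z}" if "z \<in> c ` {0..1}" for z
  proof -
    have "{t \<in> {0..1}. c t = z} \<noteq> {}" using that by auto
    moreover have "bdd_below {t \<in> {0..1}. c t = z}" by (rule bdd_belowI[of _ 0]) auto
    ultimately show ?thesis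
      using closed_contains_Inf[OF _ _ cl[of z]] that unfolding s_def by presburger
  qed
  have least: "s z \<le> t" if "c t = z" "0 \<le> t" "t \<le> 1" for z t
  proof -
    have "bdd_below {t \<in> {0..1}. c t = z}" by (rule bdd_belowI[of _ 0]) auto
    then have "Inf {t \<in> {0..1}. c t = z} \<le> t" using that by (intro cInf_lower) auto
    then show ?thesis using that(2) by (simp add: s_def)
  qed
  have s01: "0 \<le> s z \<and> s z \<le> 1" for z
    using mem[of z] by (cases "z \<in> c ` {0..1}") (simp, simp add: s_def)
  have cpt: "compact (c ` ({0..1} \<inter> {..y}))" for y
    by (intro compact_continuous_image continuous_on_subset[OF cc]) (auto intro: compact_Int_closed)
  have "s \<in> borel_measurable borel"
  proof (rule borel_measurableI_le)
    fix y
    have "{z. s z \<le> y} = c ` ({0..1} \<inter> {..y}) \<union> (if 0 \<le> y then - (c ` ({0..1} \<inter> {..1})) else {})"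
    proof (intro set_eqI iffI)
      fix z assume z: "z \<in> {z. s z \<le> y}"
      show "z \<in> c ` ({0..1} \<inter> {..y}) \<union> (if 0 \<le> y then - (c ` ({0..1} \<inter> {..1})) else {})"
      proof (cases "z \<in> c ` {0..1}")
        case True
        then have "z = c (s z)" "s z \<in> {0..1} \<inter> {..y}" using mem[of z] z by auto
        then show ?thesis by blast
      next
        case False
        then show ?thesis using z unfolding Int01 by (simp add: s_def)
      qed
    next
      fix z assume "z \<in> c ` ({0..1} \<inter> {..y}) \<union> (if 0 \<le> y then - (c ` ({0..1} \<inter> {..1})) else {})"
      then have "z \<in> c ` ({0..1} \<inter> {..y}) \<or> 0 \<le> y \<and> z \<notin> c ` {0..1}"
        unfolding Int01 by (auto split: if_splits)
      then show "z \<in> {z. s z \<le> y}"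
      proof
        assume "z \<in> c ` ({0..1} \<inter> {..y})"
        then obtain t where "c t = z" "0 \<le> t" "t \<le> 1" "t \<le> y" by auto
        then show ?thesis using least[of t z] by simp
      qed (simp add: s_def)
    qed
    moreover have "c ` ({0..1} \<inter> {..y}) \<in> sets borel" "- (c ` ({0..1} \<inter> {..1})) \<in> sets borel"
      using compact_imp_closed[OF cpt] by (blast intro: borel_closed borel_open)+
    then have "c ` ({0..1} \<inter> {..y}) \<union> (if 0 \<le> y then - (c ` ({0..1} \<inter> {..1})) else {}) \<in> sets borel"
      by (cases "0 \<le> y") (simp_all only: if_True if_False sets.Un Un_empty_right)
    ultimately show "{z \<in> space borel. s z \<le> y} \<in> sets borel" by simp
  qed
  moreover have "bounded (range c)"
  proof -
    have b: "0 \<le> schoenberg j t" "schoenberg j t \<le> 1" for j t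
    proof -
      have sm: "summable (\<lambda>n. digit_fun (3 ^ (2 * n + j) * t) / 2 ^ Suc n)"
        by (rule summable_comparison_test_ev[OF _ summable_half])
           (use digit_fun_bounds in \<open>auto simp: divide_simps\<close>)
      show "0 \<le> schoenberg j t"
        unfolding schoenberg_def by (rule suminf_nonneg[OF sm]) (use digit_fun_bounds in auto)
      have "schoenberg j t \<le> (\<Sum>n. 1 / 2 ^ Suc n)"
        unfolding schoenberg_def
        by (rule suminf_le[OF _ sm summable_half]) (use digit_fun_bounds in \<open>auto simp: divide_simps\<close>)
      also have "\<dots> = 1" using sums_unique[OF power_half_series] by (simp add: power_divide)
      finally show "schoenberg j t \<le> 1" .
    qed
    show ?thesis
      unfolding bounded_iff
    proof (intro exI[of _ 2] ballI)
      fix z assume "z \<in> range c"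
      then obtain t where "z = c t" by blast
      then show "norm z \<le> 2"
        using cmod_le[of z] b[of 0 t] b[of 1 t] by (simp add: c_def)
    qed
  qed
  ultimately show thesis
    using s01 mem surj cc by (intro that[of c s]) auto
qed

text \<open>After normalization the section \<open>s\<close> pushes the measures into [0, 1], where
  they are tight, and Helly's selection theorem gives a weak limit of a subsequence. The curve
  \<open>c\<close> carries the limit back: f \<circ> c is continuous and bounded, and c \<circ> s is
  the identity on the supports.\<close>

lemma weak_limit_exists:
  fixes N :: "nat \<Rightarrow> complex measure"
  assumes sets: "\<And>k. sets (N k) = sets borel" and fin: "\<And>k. finite_measure (N k)"
    and supp: "\<And>k. AE z in N k. norm z \<le> 1"
    and mass: "(\<lambda>k. measure (N k) UNIV) \<longlonglongrightarrow> m"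
  obtains M and r :: "nat \<Rightarrow> nat" where "strict_mono r" "sets M = sets borel" "finite_measure M"
    "\<And>f :: complex \<Rightarrow> real. continuous_on UNIV f \<Longrightarrow> (\<lambda>k. LINT z|N (r k). f z) \<longlonglongrightarrow> (LINT z|M. f z)"
proof (cases "m = 0")
  \<comment> \<open>Normalization is impossible when the limit mass is 0, but then all integrals of
    a continuous function tend to 0 along with the masses, and the null measure is the
    limit.\<close>
  case True
  have "(\<lambda>k. LINT z|N k. f z) \<longlonglongrightarrow> 0" if f: "continuous_on UNIV f" for f :: "complex \<Rightarrow> real"
  proof -
    have "bounded (f ` cball 0 1)"
      by (intro compact_imp_bounded compact_continuous_image continuous_on_subset[OF f]) auto
    then obtain C where C: "\<forall>z\<in>cball 0 1. \<bar>f z\<bar> \<le> C"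
      unfolding bounded_iff by auto
    have bd: "\<bar>LINT z|N k. f z\<bar> \<le> C * measure (N k) UNIV" for k
    proof -
      interpret finite_measure "N k" by (rule fin)
      have ae: "AE z in N k. \<bar>f z\<bar> \<le> C" using supp[of k] by eventually_elim (use C in auto)
      have "f \<in> borel_measurable (N k)"
        using borel_measurable_continuous_onI[OF f] by (simp add: measurable_cong_sets[OF sets[of k] refl])
      then have int: "integrable (N k) f"
        using ae by (intro integrable_const_bound[of f C]) auto
      have "\<bar>LINT z|N k. f z\<bar> \<le> (LINT z|N k. \<bar>f z\<bar>)" by (rule integral_abs_bound)
      also have "\<dots> \<le> (LINT z|N k. C)"
        by (rule integral_mono_AE[OF integrable_abs[OF int] _ ae]) simp
      finally have "\<bar>LINT z|N k. f z\<bar> \<le> (LINT z|N k. C)" .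
      then show ?thesis using sets_eq_imp_space_eq[OF sets[of k]] by (simp add: mult.commute)
    qed
    have "(\<lambda>k. C * measure (N k) UNIV) \<longlonglongrightarrow> 0"
      using tendsto_mult_left[OF mass, of C] True by simp
    then show ?thesis
      by (rule Lim_null_comparison[rotated]) (simp add: bd)
  qed
  then show thesis
    by (intro that[of id "null_measure borel"]) (simp_all add: strict_mono_def finite_measureI)
next
  case False
  obtain c :: "real \<Rightarrow> complex" and s :: "complex \<Rightarrow> real" where c: "continuous_on UNIV c" "bounded (range c)"
    and s[measurable]: "s \<in> borel_measurable borel"
    and s01: "\<And>z. 0 \<le> s z" "\<And>z. s z \<le> 1" and cs: "\<And>z. norm z \<le> 1 \<Longrightarrow> c (s z) = z"
    by (rule filling_curve_section) (rule that; assumption)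
  have cm[measurable]: "c \<in> borel_measurable borel" using c(1) by (rule borel_measurable_continuous_onI)
  define w where "w k = measure (N k) UNIV" for k
  have "0 \<le> m" by (rule LIMSEQ_le_const[OF mass]) (auto simp: w_def)
  then have "m > 0" using False by simp
  then have "eventually (\<lambda>k. w k > 0) sequentially"
    using order_tendstoD(1)[OF mass] by (simp add: w_def)
  then obtain k0 where k0: "\<And>k. k \<ge> k0 \<Longrightarrow> w k > 0" unfolding eventually_sequentially by blast
  define Q where "Q k = density (N (k + k0)) (\<lambda>_. ennreal (1 / w (k + k0)))" for k
  have sp: "space (N k) = UNIV" for k using sets_eq_imp_space_eq[OF sets[of k]] by simp
  have pQ: "prob_space (Q k)" for k
  proof
    interpret finite_measure "N (k + k0)" by (rule fin)
    have "emeasure (Q k) (space (Q k)) = ennreal (1 / w (k + k0)) * ennreal (w (k + k0))"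
      unfolding Q_def using sp[of "k + k0"]
      by (simp add: emeasure_density emeasure_eq_measure w_def sets)
    also have "\<dots> = 1" using k0[of "k + k0"] by (simp flip: ennreal_mult add: less_imp_le)
    finally show "emeasure (Q k) (space (Q k)) = 1" .
  qed
  have sQ: "sets (Q k) = sets borel" for k by (simp add: Q_def sets)
  have [measurable]: "s \<in> Q k \<rightarrow>\<^sub>M borel" for k
    using s by (simp add: measurable_cong_sets[OF sQ[of k] refl])
  have N_meas: "f \<in> borel_measurable (N k)" "f \<in> borel_measurable (Q k)" if "f \<in> borel_measurable borel" for f :: "complex \<Rightarrow> real" and k
    using that by (simp_all add: measurable_cong_sets[OF sets[of k] refl] measurable_cong_sets[OF sQ[of k] refl])
  have dist: "real_distribution (distr (Q k) borel s)" for k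
  proof -
    interpret prob_space "Q k" by (rule pQ)
    show ?thesis by (intro real_distribution.intro prob_space_distr real_distribution_axioms.intro) auto
  qed
  have "tight (\<lambda>k. distr (Q k) borel s)"
    unfolding tight_def
  proof (intro conjI allI impI dist)
    fix \<epsilon> :: real assume "0 < \<epsilon>"
    \<comment> \<open>Tightness is phrased with intervals that are open on the left, so the left end
      -1 is taken to include the parameter 0.\<close>
    have "measure (distr (Q k) borel s) {-1<..1} = 1" for k
    proof -
      interpret prob_space "Q k" by (rule pQ)
      have "s -` {-1<..1} \<inter> space (Q k) = space (Q k)"
        using less_le_trans[OF _ s01(1), of "-1"] s01(2) by auto
      then show ?thesis by (simp add: measure_distr prob_space)
    qed
    then show "\<exists>a b. a < b \<and> (\<forall>n. 1 - \<epsilon> < measure (distr (Q n) borel s) {a<..b})"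
      using \<open>0 < \<epsilon>\<close> by (intro exI[of _ "-1"] exI[of _ 1]) auto
  qed
  from tight_imp_convergent_subsubsequence[OF this, of id]
  obtain r P where r: "strict_mono (r :: nat \<Rightarrow> nat)" and P: "real_distribution P"
    and conv: "weak_conv_m ((\<lambda>k. distr (Q k) borel s) \<circ> id \<circ> r) P"
    by (auto simp: strict_mono_def)
  interpret P: real_distribution P by (rule P)
  define M where "M = density (distr P borel c) (\<lambda>_. ennreal m)"
  have "emeasure M (space M) \<noteq> \<infinity>"
    unfolding M_def using P.emeasure_space_1
    by (simp add: emeasure_density emeasure_distr ennreal_mult_eq_top_iff)
  then have finM: "finite_measure M" by (rule finite_measureI)
  define r' where "r' k = r k + k0" for k
  have r': "strict_mono r'" using r by (simp add: strict_mono_def r'_def)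
  have "(\<lambda>k. LINT z|N (r' k). f z) \<longlonglongrightarrow> (LINT z|M. f z)" if f: "continuous_on UNIV f" for f :: "complex \<Rightarrow> real"
  proof -
    have [measurable]: "f \<in> borel_measurable borel" using f by (rule borel_measurable_continuous_onI)
    have fc: "continuous_on UNIV (\<lambda>t. f (c t))"
      by (rule continuous_on_compose2[OF f c(1)]) auto
    have "bounded (f ` closure (range c))"
      using c(2) by (intro compact_imp_bounded compact_continuous_image continuous_on_subset[OF f]) auto
    then obtain C where C: "\<And>z. z \<in> closure (range c) \<Longrightarrow> \<bar>f z\<bar> \<le> C" unfolding bounded_iff by auto
    have "(\<lambda>k. integral\<^sup>L (((\<lambda>k. distr (Q k) borel s) \<circ> id \<circ> r) k) (\<lambda>t. f (c t))) \<longlonglongrightarrow> integral\<^sup>L P (\<lambda>t. f (c t))"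
    proof (rule weak_conv_imp_integral_bdd_continuous_conv[OF _ P conv])
      show "real_distribution (((\<lambda>k. distr (Q k) borel s) \<circ> id \<circ> r) n)" for n using dist by simp
      show "isCont (\<lambda>t. f (c t)) x" for x using fc by (simp add: continuous_on_eq_continuous_at)
      show "norm (f (c x)) \<le> C" for x using C[of "c x"] closure_subset[of "range c"] by auto
    qed
    then have "(\<lambda>k. w (r' k) * (LINT t|distr (Q (r k)) borel s. f (c t))) \<longlonglongrightarrow> m * integral\<^sup>L P (\<lambda>t. f (c t))"
      using LIMSEQ_subseq_LIMSEQ[OF mass r'] by (intro tendsto_mult) (auto simp: w_def o_def)
    moreover have "w (r' k) * (LINT t|distr (Q (r k)) borel s. f (c t)) = (LINT z|N (r' k). f z)" for k
    proof -
      have "(LINT t|distr (Q (r k)) borel s. f (c t)) = (LINT z|Q (r k). f (c (s z)))"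
        by (subst integral_distr) auto
      also have "\<dots> = (LINT z|N (r' k). (1 / w (r' k)) *\<^sub>R f (c (s z)))"
        unfolding Q_def using k0[of "r' k"]
        by (subst integral_density) (auto simp: r'_def less_imp_le intro!: N_meas)
      also have "\<dots> = (LINT z|N (r' k). (1 / w (r' k)) *\<^sub>R f z)"
      proof (rule integral_cong_AE)
        show "AE z in N (r' k). (1 / w (r' k)) *\<^sub>R f (c (s z)) = (1 / w (r' k)) *\<^sub>R f z"
          using supp[of "r' k"] by eventually_elim (simp add: cs)
        show "(\<lambda>z. (1 / w (r' k)) *\<^sub>R f (c (s z))) \<in> borel_measurable (N (r' k))"
          "(\<lambda>z. (1 / w (r' k)) *\<^sub>R f z) \<in> borel_measurable (N (r' k))"
          by (rule N_meas; measurable)+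
      qed
      finally show ?thesis using k0[of "r' k"] by (simp add: r'_def)
    qed
    moreover have "m * integral\<^sup>L P (\<lambda>t. f (c t)) = (LINT z|M. f z)"
      unfolding M_def using \<open>m > 0\<close>
      by (simp add: integral_density integral_distr)
    ultimately show ?thesis by simp
  qed
  then show thesis
    by (intro that[OF r' _ finM]) (auto simp: M_def)
qed

section \<open>Integration over the circle and over the disk\<close>

text \<open>This is \<open>circle_measure\<close> before completion. Fubini's theorem and the
  comparison of densities are carried out on the Borel \<sigma>-algebra, and the results pass to the
  completion at the end.\<close>

definition arc_measure :: "complex measure" where
  "arc_measure = distr (uniform_measure lborel {0..<2 * pi}) (restrict_space borel (sphere 0 1)) cis"

lemma circle_measure_eq: "circle_measure = completion arc_measure"
  by (simp add: circle_measure_def arc_measure_def)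

lemma sets_arc_measure: "sets arc_measure = sets (restrict_space borel (sphere 0 1))"
  and space_arc_measure: "space arc_measure = sphere 0 1"
  by (simp_all add: arc_measure_def space_restrict_space)

lemma measurable_cis_uniform:
  "cis \<in> uniform_measure lborel {0..<2 * pi} \<rightarrow>\<^sub>M restrict_space borel (sphere 0 1)"
proof -
  have "cis \<in> borel_measurable borel"
    by (rule borel_measurable_continuous_onI) (intro continuous_intros)
  then show ?thesis by (auto intro!: measurable_restrict_space2)
qed

lemma prob_space_arc_measure: "prob_space arc_measure"
proof -
  interpret U: prob_space "uniform_measure lborel {0..<2 * pi}"
    by (rule prob_space_uniform_measure) auto
  show ?thesis unfolding arc_measure_def by (rule U.prob_space_distr[OF measurable_cis_uniform])
qed

interpretation arc: prob_space arc_measure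
  by (rule prob_space_arc_measure)

lemma borel_measurable_arcI: "f \<in> borel_measurable borel \<Longrightarrow> f \<in> borel_measurable arc_measure"
  by (simp add: measurable_cong_sets[OF sets_arc_measure refl] measurable_restrict_space1)

lemma integrable_arc_continuous:
  fixes f :: "complex \<Rightarrow> 'a::{banach, second_countable_topology}"
  assumes "continuous_on (sphere 0 1) f"
  shows "integrable arc_measure f"
proof -
  have m: "f \<in> borel_measurable arc_measure"
    using borel_measurable_continuous_on_restrict[OF assms]
    by (simp add: measurable_cong_sets[OF sets_arc_measure refl])
  have "bounded (f ` sphere 0 1)"
    by (intro compact_imp_bounded compact_continuous_image assms) auto
  then obtain C where "\<forall>z\<in>sphere 0 1. norm (f z) \<le> C" unfolding bounded_iff by auto
  then show ?thesis
    by (intro arc.integrable_const_bound[OF _ m, of C] AE_I2) (auto simp: space_arc_measure)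
qed

lemma has_integral_arc:
  fixes f :: "complex \<Rightarrow> 'a::euclidean_space"
  assumes "continuous_on (sphere 0 1) f"
  shows "((\<lambda>t. f (cis t)) has_integral (2 * pi) *\<^sub>R (LINT \<zeta>|arc_measure. f \<zeta>)) {0..2 * pi}"
proof -
  have c: "continuous_on UNIV (\<lambda>t. f (cis t))"
    by (rule continuous_on_compose2[OF assms]) (auto intro!: continuous_intros)
  then have m[measurable]: "(\<lambda>t. f (cis t)) \<in> borel_measurable borel"
    by (rule borel_measurable_continuous_onI)
  have si: "set_integrable lborel {0..2 * pi} (\<lambda>t. f (cis t))"
    unfolding set_integrable_def
    by (rule borel_integrable_compact) (auto intro: continuous_on_subset[OF c])
  have fm: "f \<in> borel_measurable (restrict_space borel (sphere 0 1))"
    using assms by (rule borel_measurable_continuous_on_restrict)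
  have "(LINT \<zeta>|arc_measure. f \<zeta>) = (LINT t|uniform_measure lborel {0..<2 * pi}. f (cis t))"
    unfolding arc_measure_def by (rule integral_distr[OF measurable_cis_uniform fm])
  also have "uniform_measure lborel {0..<2 * pi} =
      density lborel (\<lambda>t. ennreal (indicator {0..<2 * pi} t / (2 * pi)))"
    unfolding uniform_measure_def
    by (intro density_cong) (auto simp: indicator_def divide_ennreal simp flip: ennreal_1)
  also have "(LINT t|density lborel (\<lambda>t. ennreal (indicator {0..<2 * pi} t / (2 * pi))). f (cis t)) =
      (LINT t|lborel. (indicator {0..<2 * pi} t / (2 * pi)) *\<^sub>R f (cis t))"
    by (rule integral_density) auto
  also have "\<dots> = (LINT t|lborel. (1 / (2 * pi)) *\<^sub>R (indicator {0..2 * pi} t *\<^sub>R f (cis t)))"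
  proof (rule integral_cong_AE)
    show "AE t in lborel. (indicator {0..<2 * pi} t / (2 * pi)) *\<^sub>R f (cis t) =
        (1 / (2 * pi)) *\<^sub>R (indicator {0..2 * pi} t *\<^sub>R f (cis t))"
      using AE_lborel_singleton[of "2 * pi"] by eventually_elim (auto simp: indicator_def)
  qed measurable
  also have "\<dots> = (1 / (2 * pi)) *\<^sub>R (LINT t:{0..2 * pi}|lborel. f (cis t))"
    unfolding set_lebesgue_integral_def
    by (rule integral_scaleR_right)
  finally have *: "(LINT \<zeta>|arc_measure. f \<zeta>) = (1 / (2 * pi)) *\<^sub>R (LINT t:{0..2 * pi}|lborel. f (cis t))" .
  show ?thesis
    using integrable_integral[OF set_borel_integral_eq_integral(1)[OF si]]
    unfolding * set_borel_integral_eq_integral(2)[OF si] by simp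
qed

lemma arc_mean_value:
  assumes "g holomorphic_on cball 0 1"
  shows "(LINT \<zeta>|arc_measure. g \<zeta>) = g 0"
proof -
  have c: "continuous_on (sphere 0 1) g"
    using holomorphic_on_imp_continuous_on[OF assms] by (rule continuous_on_subset) auto
  \<comment> \<open>Along the unit circle du/u is i dt, so Cauchy's formula at the centre is the
    mean value property.\<close>
  have "((\<lambda>u. g u / (u - 0)) has_contour_integral 2 * of_real pi * \<i> * g 0) (part_circlepath 0 1 0 (2 * pi))"
    using Cauchy_integral_circlepath_simple[OF assms, of 0] unfolding circlepath_def by simp
  then have "((\<lambda>t. g (0 + of_real 1 * cis t) / (0 + of_real 1 * cis t - 0) * of_real 1 * \<i> * cis t) has_integral
      2 * of_real pi * \<i> * g 0) {0..2 * pi}"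
    by (subst (asm) has_contour_integral_part_circlepath_iff) simp_all
  then have "((\<lambda>t. \<i> * g (cis t)) has_integral 2 * of_real pi * \<i> * g 0) {0..2 * pi}"
    by (simp add: field_simps)
  moreover have "((\<lambda>t. \<i> * g (cis t)) has_integral \<i> * ((2 * pi) *\<^sub>R (LINT \<zeta>|arc_measure. g \<zeta>))) {0..2 * pi}"
    by (intro has_integral_mult_right has_integral_arc c)
  ultimately have "2 * of_real pi * \<i> * g 0 = \<i> * ((2 * pi) *\<^sub>R (LINT \<zeta>|arc_measure. g \<zeta>))"
    by (rule has_integral_unique)
  then show ?thesis by (simp add: scaleR_conv_of_real)
qed

lemma arc_mean_value_Re:
  assumes "g holomorphic_on cball 0 1"
  shows "(LINT \<zeta>|arc_measure. Re (g \<zeta>)) = Re (g 0)"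
  using arc_mean_value[OF assms] integrable_arc_continuous[of g]
    holomorphic_on_imp_continuous_on[OF assms, THEN continuous_on_subset, of "sphere 0 1"]
  by (simp add: integral_Re sphere_cball)

text \<open>These are the orthogonality relations of Re (a \<zeta>^j) and Re (b \<zeta>^k) on the
  circle. Degree 0 is separate because the product of two constants has no oscillating part whose
  average would halve it.\<close>

definition mode_pair :: "complex \<Rightarrow> complex \<Rightarrow> nat \<Rightarrow> nat \<Rightarrow> real" where
  "mode_pair a b j k = (if j \<noteq> k then 0 else if k = 0 then Re a * Re b else Re (a * cnj b) / 2)"

text \<open>On the circle the conjugate of \<zeta> is its inverse, so a product of real parts of
  monomials is again the real part of a polynomial. This serves twice: for the orthogonality
  relations, and to see that traces of harmonic polynomials form an algebra.\<close>

lemma mode_product_circle: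
  assumes \<zeta>: "norm \<zeta> = 1" and jk: "j \<le> k"
  shows "Re (a * \<zeta> ^ j) * Re (b * \<zeta> ^ k) = Re (a * b / 2 * \<zeta> ^ (j + k) + b * cnj a / 2 * \<zeta> ^ (k - j))"
proof -
  have n: "\<zeta> * cnj \<zeta> = 1" using \<zeta> by (simp add: complex_norm_square[symmetric])
  have "\<zeta> ^ k = \<zeta> ^ (k - j) * \<zeta> ^ j" using jk by (simp flip: power_add)
  then have "\<zeta> ^ k * cnj (\<zeta> ^ j) = \<zeta> ^ (k - j) * (\<zeta> * cnj \<zeta>) ^ j"
    by (simp add: power_mult_distrib)
  then have "\<zeta> ^ (k - j) = \<zeta> ^ k * cnj (\<zeta> ^ j)" by (simp add: n)
  moreover have "Re x * Re y = Re (x * y / 2 + y * cnj x / 2)" for x y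
    by (simp add: field_simps)
  ultimately show ?thesis
    by (simp only: power_add complex_cnj_mult) (simp only: mult_ac times_divide_eq_left times_divide_eq_right)
qed

lemma arc_mode_pair:
  "(LINT \<zeta>|arc_measure. Re (a * \<zeta> ^ j) * Re (b * \<zeta> ^ k)) = mode_pair a b j k"
proof -
  have *: "(LINT \<zeta>|arc_measure. Re (a * \<zeta> ^ j) * Re (b * \<zeta> ^ k)) = mode_pair a b j k"
    if "j \<le> k" for a b j k
  proof -
    have "(LINT \<zeta>|arc_measure. Re (a * \<zeta> ^ j) * Re (b * \<zeta> ^ k)) =
      (LINT \<zeta>|arc_measure. Re (a * b / 2 * \<zeta> ^ (j + k) + b * cnj a / 2 * \<zeta> ^ (k - j)))"
      using that by (intro Bochner_Integration.integral_cong refl mode_product_circle) (auto simp: space_arc_measure)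
    also have "\<dots> = Re (a * b / 2 * 0 ^ (j + k) + b * cnj a / 2 * 0 ^ (k - j))"
      by (rule arc_mean_value_Re) (intro holomorphic_intros)
    also have "\<dots> = mode_pair a b j k"
      using that by (auto simp: mode_pair_def power_0_left field_simps)
    finally show ?thesis .
  qed
  show ?thesis
  proof (cases "j \<le> k")
    case False
    have "mode_pair b a k j = mode_pair a b j k" by (auto simp: mode_pair_def)
    with *[of k j b a] False show ?thesis by (simp add: mult.commute)
  qed (rule *)
qed

subsection \<open>Rotation invariance of the area\<close>

text \<open>The bridge that transports invariance under orthogonal maps from \<open>real^2\<close>
  to the complex plane.\<close>

lemma lborel_complex_vec:
  "distr lborel borel (\<lambda>v::real^2. Complex (v $ 1) (v $ 2)) = lborel" (is "distr _ _ ?T = _")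
proof (rule lborel_eqI[symmetric])
  have cT: "continuous_on UNIV ?T" by (intro continuous_intros)
  then have [measurable]: "?T \<in> borel_measurable borel" by (rule borel_measurable_continuous_onI)
  fix l u :: complex assume le: "\<And>b. b \<in> Basis \<Longrightarrow> l \<bullet> b \<le> u \<bullet> b"
  then have le': "Re l \<le> Re u" "Im l \<le> Im u" using le[of 1] le[of \<i>] by (simp_all add: Basis_complex_def)
  define l' u' :: "real^2" where "l' = vector [Re l, Im l]" and "u' = vector [Re u, Im u]"
  have "?T -` box l u = box l' u'"
    by (auto simp: box_def Basis_complex_def Basis_vec_def l'_def u'_def inner_axis forall_2)
  then have "emeasure (distr lborel borel ?T) (box l u) = emeasure lborel (box l' u')"
    by (subst emeasure_distr) auto
  also have "\<dots> = emeasure lborel (cbox l' u')"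
    by (simp add: emeasure_lborel_box_eq emeasure_lborel_cbox_eq)
  also have "\<dots> = ennreal (measure lborel (cbox l' u'))"
    by (rule emeasure_eq_ennreal_measure) (use emeasure_lborel_cbox_finite[of l' u'] in auto)
  also have "measure lborel (cbox l' u') = (\<Prod>i\<in>UNIV. u' $ i - l' $ i)"
  proof (rule content_cbox_cart)
    have "l' \<in> cbox l' u'"
      using le' by (auto simp: mem_box_cart forall_2 l'_def u'_def)
    then show "cbox l' u' \<noteq> {}" by blast
  qed
  also have "\<dots> = (\<Prod>b\<in>Basis. (u - l) \<bullet> b)"
    by (simp add: UNIV_2 l'_def u'_def Basis_complex_def)
  finally show "emeasure (distr lborel borel ?T) (box l u) = (\<Prod>b\<in>Basis. (u - l) \<bullet> b)" .
qed simp

lemma lborel_rotation: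
  assumes w: "norm w = 1"
  shows "distr lborel borel ((*) w) = (lborel :: complex measure)"
proof (rule lborel_eqI[symmetric])
  let ?T = "\<lambda>v::real^2. Complex (v $ 1) (v $ 2)"
  have [measurable]: "?T \<in> borel_measurable borel" "(*) w \<in> borel_measurable borel"
    by (intro borel_measurable_continuous_onI continuous_intros)+
  fix l u :: complex assume le: "\<And>b. b \<in> Basis \<Longrightarrow> l \<bullet> b \<le> u \<bullet> b"
  \<comment> \<open>In coordinates \<open>R\<close> is multiplication by \<open>cnj w\<close>, the
    inverse of multiplication by \<open>w\<close>. Preimages under the rotation thus become images
    under the orthogonal map \<open>R\<close>, whose measure is known.\<close>
  define R :: "real^2 \<Rightarrow> real^2" where "R v = vector [Re w * v $ 1 + Im w * v $ 2, Re w * v $ 2 - Im w * v $ 1]" for v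
  have TR: "?T (R v) = cnj w * ?T v" for v by (simp add: R_def complex_eq_iff)
  have nT: "norm (?T v) = norm v" for v
    by (simp add: cmod_def norm_vec_def L2_set_def UNIV_2)
  have injT: "?T v = ?T v' \<Longrightarrow> v = v'" for v v' by (simp add: vec_eq_iff forall_2)
  have ww: "w * cnj w = 1" using w by (simp add: complex_norm_square[symmetric])
  have "linear R" unfolding R_def by (rule linearI) (auto simp: vec_eq_iff forall_2 algebra_simps)
  moreover have "norm (R v) = norm v" for v using w unfolding nT[symmetric] TR norm_mult by simp
  ultimately have orth: "orthogonal_transformation R" by (simp add: orthogonal_transformation)
  have im: "?T -` ((*) w -` B) = R ` (?T -` B)" for B
  proof (intro set_eqI iffI)
    fix v assume "v \<in> ?T -` ((*) w -` B)"
    define v' :: "real^2" where "v' = vector [Re (w * ?T v), Im (w * ?T v)]"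
    have v': "?T v' = w * ?T v" by (simp add: v'_def complex_eq_iff)
    have "?T (R v') = (w * cnj w) * ?T v" unfolding TR v' by (simp only: mult_ac)
    then have "R v' = v" unfolding ww by (intro injT) simp
    moreover have "v' \<in> ?T -` B" using \<open>v \<in> _\<close> v' by simp
    ultimately show "v \<in> R ` (?T -` B)" by blast
  next
    fix v assume "v \<in> R ` (?T -` B)"
    then obtain v' where v': "v = R v'" "?T v' \<in> B" by blast
    have "w * ?T (R v') = (w * cnj w) * ?T v'" unfolding TR by (simp only: mult_ac)
    then show "v \<in> ?T -` ((*) w -` B)" using v' ww by simp
  qed
  have bdd: "bounded (?T -` box l u)"
  proof -
    obtain B where "\<And>z. z \<in> box l u \<Longrightarrow> norm z \<le> B" using bounded_box[of l u] unfolding bounded_iff by blast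
    then show ?thesis unfolding bounded_iff by (intro exI[of _ B] ballI) (metis nT vimage_eq)
  qed
  have borelT: "?T -` box l u \<in> sets borel"
    using measurable_sets_borel[of ?T borel "box l u"] by simp
  have lm: "?T -` box l u \<in> lmeasurable"
    by (rule bounded_set_imp_lmeasurable[OF bdd]) (use borelT in simp)
  have "emeasure (distr lborel borel ((*) w)) (box l u) = emeasure (distr lborel borel ?T) ((*) w -` box l u)"
    by (subst emeasure_distr) (auto simp: lborel_complex_vec)
  also have "\<dots> = emeasure lborel (R ` (?T -` box l u))"
    using measurable_sets_borel[of "(*) w" borel "box l u"]
    by (subst emeasure_distr) (auto simp flip: im)
  also have "\<dots> = emeasure lebesgue (R ` (?T -` box l u))"
    using measurable_sets_borel[of ?T borel "(*) w -` box l u"] measurable_sets_borel[of "(*) w" borel "box l u"]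
    unfolding im[symmetric] by simp
  also have "\<dots> = ennreal (measure lebesgue (R ` (?T -` box l u)))"
    using measurable_orthogonal_image[OF orth lm] by (simp add: emeasure_eq_measure2)
  also have "\<dots> = ennreal (measure lebesgue (?T -` box l u))"
    by (simp only: measure_orthogonal_image[OF orth lm])
  also have "\<dots> = emeasure lborel (?T -` box l u)"
    using emeasure_eq_measure2[OF lm] borelT by simp
  also have "\<dots> = emeasure (distr lborel borel ?T) (box l u)"
    by (subst emeasure_distr) auto
  also have "\<dots> = (\<Prod>b\<in>Basis. (u - l) \<bullet> b)"
    unfolding lborel_complex_vec using le by (rule emeasure_lborel_box)
  finally show "emeasure (distr lborel borel ((*) w)) (box l u) = (\<Prod>b\<in>Basis. (u - l) \<bullet> b)" .
qed simp


text \<open>A disk of radius \<rho> has area \<pi> \<rho>^2, so with s = |z|^2 the radial part of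
  the area is \<pi> ds. Comparison of the two measures on half-lines suffices.\<close>

lemma distr_norm_square_disk:
  "distr (restrict_space lborel (ball 0 1)) borel (\<lambda>z::complex. (norm z)\<^sup>2) =
    density lborel (\<lambda>s. ennreal pi * indicator {0<..<1} s)" (is "?M = ?N")
proof (rule measure_eqI_lessThan)
  have emeasure_disk: "emeasure lborel (ball (0::complex) \<rho>) = ennreal (pi * \<rho>\<^sup>2)"
    "emeasure lborel (cball (0::complex) \<rho>) = ennreal (pi * \<rho>\<^sup>2)" if "\<rho> \<ge> 0" for \<rho>
    using that by (simp_all add: emeasure_ball emeasure_cball unit_ball_vol_2)
  have m[measurable]: "(\<lambda>z::complex. (norm z)\<^sup>2) \<in> borel_measurable (restrict_space lborel (ball 0 1))"
    by (rule measurable_restrict_space1) measurable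
  have M: "emeasure ?M {x<..} = emeasure lborel ({z::complex. x < (norm z)\<^sup>2} \<inter> ball 0 1)" for x
  proof -
    have "(\<lambda>z::complex. (norm z)\<^sup>2) -` {x<..} \<inter> ball 0 1 = {z. x < (norm z)\<^sup>2} \<inter> ball 0 1" by auto
    then show ?thesis
      by (subst emeasure_distr[OF m]) (auto simp: space_restrict_space emeasure_restrict_space)
  qed
  have N: "emeasure ?N {x<..} = ennreal pi * emeasure lborel ({max 0 x<..<1::real})" for x
  proof -
    have "emeasure ?N {x<..} = (\<integral>\<^sup>+s. ennreal pi * indicator {max 0 x<..<1} s \<partial>lborel)"
      by (subst emeasure_density) (auto intro!: nn_integral_cong simp: indicator_def)
    then show ?thesis by (simp add: nn_integral_cmult_indicator)
  qed
  show eq: "emeasure ?M {x<..} = emeasure ?N {x<..}" for x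
  proof -
    consider "x < 0" | "0 \<le> x" "x < 1" | "1 \<le> x" by linarith
    then show ?thesis
    proof cases
      case 1
      have "x < (norm z)\<^sup>2" for z :: complex
        using 1 zero_le_power2[of "norm z"] by linarith
      then have "{z::complex. x < (norm z)\<^sup>2} \<inter> ball 0 1 = ball 0 1" by auto
      then show ?thesis using 1 emeasure_disk(1)[of 1] unfolding M N by simp
    next
      case 2
      have "{z. x < (norm z)\<^sup>2} \<inter> ball 0 1 = ball (0::complex) 1 - cball 0 (sqrt x)"
        using 2 real_le_rsqrt[of _ x] by (auto simp: not_le real_less_lsqrt real_sqrt_less_iff dest: sqrt_le_D)
          (metis not_le real_sqrt_le_iff real_sqrt_abs abs_norm_cancel)+
      then have "emeasure ?M {x<..} = emeasure lborel (ball (0::complex) 1) - emeasure lborel (cball (0::complex) (sqrt x))"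
        unfolding M using 2 emeasure_disk(2)[of "sqrt x"]
        by (simp add: emeasure_Diff cball_subset_ball_iff)
      also have "\<dots> = ennreal (pi * (1 - x))"
        using 2 emeasure_disk(1)[of 1] emeasure_disk(2)[of "sqrt x"] by (simp add: ennreal_minus algebra_simps)
      finally show ?thesis using 2 unfolding N by (simp add: ennreal_mult)
    next
      case 3
      have "{z. x < (norm z)\<^sup>2} \<inter> ball (0::complex) 1 = {}"
      proof -
        have "\<not> x < (norm z)\<^sup>2" if "norm z < 1" for z :: complex
          using 3 power_le_one[of "norm z" 2] that by auto
        then show ?thesis by auto
      qed
      then show ?thesis using 3 unfolding M N by simp
    qed
  qed
  show "emeasure ?M {x<..} < \<infinity>" for x
    unfolding eq unfolding N by (cases "max 0 x \<le> 1") (auto simp: ennreal_mult_less_top)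
qed simp_all

lemma disk_norm_power:
  "(LINT z:ball (0::complex) 1|lborel. norm z ^ (2 * n)) = pi / real (n + 1)"
proof -
  have m: "(\<lambda>z::complex. (norm z)\<^sup>2) \<in> borel_measurable (restrict_space lborel (ball 0 1))"
    by (rule measurable_restrict_space1) measurable
  have "(LINT z:ball (0::complex) 1|lborel. norm z ^ (2 * n)) =
      (LINT z|restrict_space lborel (ball (0::complex) 1). ((norm z)\<^sup>2) ^ n)"
    by (simp add: set_lebesgue_integral_def integral_restrict_space power_mult)
  also have "\<dots> = (LINT s|density lborel (\<lambda>s. ennreal pi * indicator {0<..<1} s). s ^ n)"
    unfolding distr_norm_square_disk[symmetric] by (rule integral_distr[OF m, symmetric]) simp
  also have "density lborel (\<lambda>s. ennreal pi * indicator {0<..<1} s) =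
      density lborel (\<lambda>s. ennreal (pi * indicator {0<..<1::real} s))"
    by (intro density_cong) (auto simp: indicator_def)
  also have "(LINT s|density lborel (\<lambda>s. ennreal (pi * indicator {0<..<1} s)). s ^ n) =
      (LINT s|lborel. pi * (s ^ n * indicator {0..1::real} s))"
  proof (subst integral_density)
    show "(LINT s|lborel. (pi * indicator {0<..<1} s) *\<^sub>R s ^ n) = (LINT s|lborel. pi * (s ^ n * indicator {0..1::real} s))"
    proof (rule integral_cong_AE)
      show "AE s in lborel. (pi * indicator {0<..<1} s) *\<^sub>R s ^ n = pi * (s ^ n * indicator {0..1::real} s)"
        using AE_lborel_singleton[of 0] AE_lborel_singleton[of 1]
        by eventually_elim (auto simp: indicator_def)
    qed measurable
  qed (auto simp: indicator_def)
  also have "\<dots> = pi * (LINT s|lborel. s ^ n * indicator {0..1::real} s)" by simp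
  also have "(LINT s|lborel. s ^ n * indicator {0..1::real} s) = 1 / real (n + 1)"
    using integral_power[of 0 1 n] by simp
  finally show ?thesis by simp
qed

text \<open>Each rotation preserves the area integral, hence so does the average over all rotations,
  and Fubini's theorem moves this average inside. Together with \<open>disk_norm_power\<close> it
  takes the place of polar coordinates.\<close>

lemma disk_average:
  fixes g :: "complex \<Rightarrow> real"
  assumes g: "continuous_on UNIV g"
  shows "(LINT z:ball 0 1|lborel. g z) = (LINT z:ball 0 1|lborel. (LINT \<zeta>|arc_measure. g (\<zeta> * z)))"
proof -
  define D where "D = restrict_space lborel (ball (0::complex) 1)"
  have gm[measurable]: "g \<in> borel_measurable borel" using g by (rule borel_measurable_continuous_onI)
  have spD: "space D = ball 0 1" by (simp add: D_def space_restrict_space)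
  have finD: "finite_measure D"
  proof
    have "emeasure lborel (ball (0::complex) 1) < \<infinity>" by (rule emeasure_bounded_finite) simp
    then show "emeasure D (space D) \<noteq> \<infinity>"
      unfolding spD by (simp add: D_def emeasure_restrict_space)
  qed
  interpret D: finite_measure D by (rule finD)
  interpret P: pair_sigma_finite arc_measure D ..
  interpret PF: finite_measure "arc_measure \<Otimes>\<^sub>M D"
    by (rule finite_measure_pair_measure) (rule finD, unfold_locales)
  have rot: "(LINT z|D. g (w * z)) = (LINT z|D. g z)" if w: "w \<in> sphere 0 1" for w
  proof -
    have [measurable]: "(*) w \<in> borel_measurable borel"
      by (intro borel_measurable_continuous_onI continuous_intros)
    have "(LINT z|D. g z) = (LINT z|distr lborel borel ((*) w). indicator (ball 0 1) z *\<^sub>R g z)"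
      using w by (subst lborel_rotation) (auto simp: D_def integral_restrict_space)
    also have "\<dots> = (LINT z|lborel. indicator (ball 0 1) (w * z) *\<^sub>R g (w * z))"
      by (rule integral_distr)
         (simp, intro borel_measurable_scaleR borel_measurable_indicator gm, simp)
    also have "\<dots> = (LINT z|lborel. indicator (ball 0 1) z *\<^sub>R g (w * z))"
      using w by (intro Bochner_Integration.integral_cong) (auto simp: indicator_def norm_mult)
    finally show ?thesis by (simp add: D_def integral_restrict_space)
  qed
  have "bounded (g ` cball 0 1)"
    by (intro compact_imp_bounded compact_continuous_image continuous_on_subset[OF g]) auto
  then obtain C where C: "\<forall>z\<in>cball 0 1. \<bar>g z\<bar> \<le> C" unfolding bounded_iff by auto
  have bdd: "\<bar>g (\<zeta> * z)\<bar> \<le> C" if "\<zeta> \<in> space arc_measure" "z \<in> space D" for \<zeta> z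
    using C that by (auto simp: space_arc_measure spD norm_mult)
  have id1: "(\<lambda>z. z) \<in> borel_measurable arc_measure" by (rule borel_measurable_arcI) simp
  have id2: "(\<lambda>z. z) \<in> borel_measurable D" unfolding D_def by (rule measurable_restrict_space1) simp
  have meas: "(\<lambda>p. g (fst p * snd p)) \<in> borel_measurable (arc_measure \<Otimes>\<^sub>M D)"
  proof -
    have "(\<lambda>p. fst p) \<in> borel_measurable (arc_measure \<Otimes>\<^sub>M D)" "(\<lambda>p. snd p) \<in> borel_measurable (arc_measure \<Otimes>\<^sub>M D)"
      using measurable_compose[OF measurable_fst id1] measurable_compose[OF measurable_snd id2] by auto
    then have "(\<lambda>p. fst p * snd p) \<in> borel_measurable (arc_measure \<Otimes>\<^sub>M D)" by (rule borel_measurable_times)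
    from measurable_compose[OF this gm] show ?thesis .
  qed
  have "integrable (arc_measure \<Otimes>\<^sub>M D) (\<lambda>p. g (fst p * snd p))"
    by (rule PF.integrable_const_bound[of _ C, OF AE_I2 meas])
       (auto simp: space_pair_measure intro!: bdd)
  then have int: "integrable (arc_measure \<Otimes>\<^sub>M D) (case_prod (\<lambda>\<zeta> z. g (\<zeta> * z)))"
    by (simp add: case_prod_beta')
  have "(LINT z|D. LINT \<zeta>|arc_measure. g (\<zeta> * z)) = (LINT \<zeta>|arc_measure. LINT z|D. g (\<zeta> * z))"
    by (rule P.Fubini_integral[OF int])
  also have "\<dots> = (LINT \<zeta>|arc_measure. LINT z|D. g z)"
    by (intro Bochner_Integration.integral_cong rot) (auto simp: space_arc_measure)
  also have "\<dots> = (LINT z|D. g z)"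
    using arc.prob_space by simp
  finally show ?thesis
    unfolding D_def by (simp add: integral_restrict_space set_lebesgue_integral_def)
qed

text \<open>Averaging over circles leaves only the diagonal j = k, where the integrand becomes a
  multiple of |z|^(2 (c + k)).\<close>

lemma disk_mode_pair:
  "(LINT z:ball 0 1|lborel. norm z ^ (2 * c) * (Re (a * z ^ j) * Re (b * z ^ k))) =
    mode_pair a b j k * pi / real (c + k + 1)"
proof -
  have "(LINT z:ball 0 1|lborel. norm z ^ (2 * c) * (Re (a * z ^ j) * Re (b * z ^ k))) =
    (LINT z:ball 0 1|lborel. (LINT \<zeta>|arc_measure.
      norm (\<zeta> * z) ^ (2 * c) * (Re (a * (\<zeta> * z) ^ j) * Re (b * (\<zeta> * z) ^ k))))"
    by (rule disk_average) (intro continuous_intros)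
  also have "\<dots> = (LINT z:ball (0::complex) 1|lborel. mode_pair a b j k * norm z ^ (2 * (c + k)))"
  proof (intro set_lebesgue_integral_cong allI impI)
    fix z :: complex
    have "(LINT \<zeta>|arc_measure. norm (\<zeta> * z) ^ (2 * c) * (Re (a * (\<zeta> * z) ^ j) * Re (b * (\<zeta> * z) ^ k))) =
      (LINT \<zeta>|arc_measure. norm z ^ (2 * c) * (Re ((a * z ^ j) * \<zeta> ^ j) * Re ((b * z ^ k) * \<zeta> ^ k)))"
      by (intro Bochner_Integration.integral_cong refl)
         (auto simp: space_arc_measure norm_mult power_mult_distrib mult_ac)
    also have "\<dots> = norm z ^ (2 * c) * mode_pair (a * z ^ j) (b * z ^ k) j k"
      by (simp only: integral_mult_right_zero arc_mode_pair)
    also have "mode_pair (a * z ^ j) (b * z ^ k) j k = mode_pair a b j k * norm z ^ (2 * k)"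
    proof (cases "j = k")
      case True
      have "(a * z ^ k) * cnj (b * z ^ k) = (a * cnj b) * (z ^ k * cnj (z ^ k))"
        by simp
      also have "z ^ k * cnj (z ^ k) = of_real (norm z ^ (2 * k))"
        using complex_norm_square[of "z ^ k"] by (simp add: norm_power power_even_eq)
      finally have "(a * z ^ k) * cnj (b * z ^ k) = (a * cnj b) * of_real (norm z ^ (2 * k))" .
      then have "Re ((a * z ^ k) * cnj (b * z ^ k)) = Re (a * cnj b) * norm z ^ (2 * k)"
        by (simp only: times_complex.sel Re_complex_of_real Im_complex_of_real)
      then show ?thesis using True by (cases "k = 0") (simp_all only: mode_pair_def, simp_all)
    qed (simp add: mode_pair_def)
    finally show "(LINT \<zeta>|arc_measure. norm (\<zeta> * z) ^ (2 * c) * (Re (a * (\<zeta> * z) ^ j) * Re (b * (\<zeta> * z) ^ k))) =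
      mode_pair a b j k * norm z ^ (2 * (c + k))"
      by (simp add: power_add distrib_left)
  qed simp
  also have "\<dots> = mode_pair a b j k * pi / real (c + k + 1)"
    using disk_norm_power[of "c + k"] by (simp add: distrib_left)
  finally show ?thesis .
qed

section \<open>Uniqueness of measures and approximation on the circle\<close>

lemma borel_measurable_cong_borel:
  assumes "sets M = sets borel" "f \<in> borel_measurable borel"
  shows "f \<in> borel_measurable M"
  using assms(2) by (simp add: measurable_cong_sets[OF assms(1) refl])

lemma integrable_continuous_finite_measure:
  fixes f :: "complex \<Rightarrow> real"
  assumes "finite_measure M" "sets M = sets borel" "compact K" "AE z in M. z \<in> K" "continuous_on UNIV f"
  shows "integrable M f"
proof -
  interpret finite_measure M by fact
  have "bounded (f ` K)"
    by (intro compact_imp_bounded compact_continuous_image continuous_on_subset[OF assms(5)] assms) auto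
  then obtain C where C: "\<forall>z\<in>K. \<bar>f z\<bar> \<le> C" unfolding bounded_iff by auto
  have "f \<in> borel_measurable M"
    using assms borel_measurable_cong_borel borel_measurable_continuous_onI by blast
  moreover have "AE z in M. norm (f z) \<le> C" using assms(4) by eventually_elim (use C in auto)
  ultimately show ?thesis by (intro integrable_const_bound[of f C])
qed

lemma finite_measures_eqI_continuous:
  fixes M N :: "complex measure"
  assumes fin: "finite_measure M" "finite_measure N" and sets: "sets M = sets borel" "sets N = sets borel"
    and eq: "\<And>f :: complex \<Rightarrow> real. continuous_on UNIV f \<Longrightarrow> (\<And>z. 0 \<le> f z \<and> f z \<le> 1) \<Longrightarrow>
      (LINT z|M. f z) = (LINT z|N. f z)"
  shows "M = N"
proof (rule measure_eqI_generator_eq[where E="Collect closed" and \<Omega>=UNIV and A="\<lambda>_. UNIV"])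
  interpret M: finite_measure M by fact
  interpret N: finite_measure N by fact
  fix A :: "complex set" assume "A \<in> Collect closed"
  then have A: "closed A" by simp
  show "emeasure M A = emeasure N A"
  proof (cases "A = {}")
    case False
    \<comment> \<open>Lipschitz functions that decrease to the indicator of the closed set
      A.\<close>
    define g where "g n z = max 0 (1 - real n * infdist z A)" for n z
    have g01: "0 \<le> g n z \<and> g n z \<le> 1" for n z
      using infdist_nonneg[of z A] by (auto simp: g_def)
    have gc: "continuous_on UNIV (g n)" for n
      unfolding g_def by (intro continuous_intros continuous_on_infdist)
    have lim: "(\<lambda>n. g n z) \<longlonglongrightarrow> indicator A z" for z
    proof (cases "z \<in> A")
      case True
      then show ?thesis by (simp add: g_def)
    next
      case z: False
      then have pos: "infdist z A > 0" using infdist_pos_not_in_closed[OF A False] by blast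
      obtain n0 where "1 / infdist z A < real n0" using reals_Archimedean2 by blast
      then have "g n z = 0" if "n \<ge> n0" for n
      proof -
        have "1 < real n0 * infdist z A" using \<open>1 / _ < _\<close> pos by (simp add: field_simps)
        also have "\<dots> \<le> real n * infdist z A" using that pos by (intro mult_right_mono) auto
        finally show ?thesis by (simp add: g_def)
      qed
      then have "eventually (\<lambda>n. g n z = indicator A z) sequentially"
        using z unfolding eventually_sequentially by auto
      then show ?thesis by (rule tendsto_eventually)
    qed
    have L: "(\<lambda>n. LINT z|L. g n z) \<longlonglongrightarrow> (LINT z|L. indicator A z)"
      if L: "finite_measure L" "sets L = sets borel" for L
    proof (rule integral_dominated_convergence[where w="\<lambda>_. 1"])
      interpret finite_measure L by fact
      show "integrable L (\<lambda>_. 1::real)" by simp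
      show "g n \<in> borel_measurable L" for n
        by (rule borel_measurable_cong_borel[OF L(2) borel_measurable_continuous_onI[OF gc]])
      show "(indicator A :: complex \<Rightarrow> real) \<in> borel_measurable L"
        by (rule borel_measurable_cong_borel[OF L(2)]) (use A in simp)
    qed (use lim g01 in auto)
    have "(LINT z|M. indicator A z) = (LINT z|N. indicator A z :: real)"
      using L[OF fin(1) sets(1)] L[OF fin(2) sets(2)] unfolding eq[OF gc g01] by (rule LIMSEQ_unique)
    moreover have "A \<in> sets M" "A \<in> sets N" using A sets by auto
    ultimately show ?thesis
      by (simp add: M.emeasure_eq_measure N.emeasure_eq_measure sets.Int_space_eq2)
  qed simp
next
  show "emeasure M UNIV \<noteq> \<infinity>" using finite_measure.emeasure_finite[OF fin(1)] by simp
qed (use sets in \<open>auto simp: borel_eq_closed Int_stable_def\<close>)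

lemma finite_measures_eqI:
  fixes M N :: "complex measure"
  assumes fin: "finite_measure M" "finite_measure N" and sets: "sets M = sets borel" "sets N = sets borel"
    and K: "compact K" "AE z in M. z \<in> K" "AE z in N. z \<in> K"
    and approx: "\<And>f e. continuous_on UNIV f \<Longrightarrow> 0 < e \<Longrightarrow> \<exists>g :: complex \<Rightarrow> real. continuous_on UNIV g \<and>
      (\<forall>z\<in>K. \<bar>f z - g z\<bar> \<le> e) \<and> (LINT z|M. g z) = (LINT z|N. g z)"
  shows "M = N"
proof (rule finite_measures_eqI_continuous[OF fin sets])
  fix f :: "complex \<Rightarrow> real" assume f: "continuous_on UNIV f"
  interpret M: finite_measure M by fact
  interpret N: finite_measure N by fact
  \<comment> \<open>The summand 1 keeps the divisor positive even if both measures vanish.\<close>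
  define m where "m = measure M (space M) + measure N (space N) + 1"
  have m: "m > 0" unfolding m_def using measure_nonneg[of M "space M"] measure_nonneg[of N "space N"] by linarith
  have "\<bar>(LINT z|M. f z) - (LINT z|N. f z)\<bar> \<le> e" if "e > 0" for e :: real
  proof -
    obtain g :: "complex \<Rightarrow> real" where g: "continuous_on UNIV g" "\<forall>z\<in>K. \<bar>f z - g z\<bar> \<le> e / m"
      "(LINT z|M. g z) = (LINT z|N. g z)"
      using approx[OF f, of "e / m"] \<open>e > 0\<close> m by auto
    have *: "\<bar>(LINT z|L. f z) - (LINT z|L. g z)\<bar> \<le> e / m * measure L (space L)"
      if L: "finite_measure L" "sets L = sets borel" "AE z in L. z \<in> K" for L
    proof -
      interpret finite_measure L by fact
      note int = integrable_continuous_finite_measure[OF L(1,2) K(1) L(3)]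
      have "(LINT z|L. f z) - (LINT z|L. g z) = (LINT z|L. f z - g z)"
        using int[OF f] int[OF g(1)] by simp
      also have "\<bar>\<dots>\<bar> \<le> (LINT z|L. \<bar>f z - g z\<bar>)" by (rule integral_abs_bound)
      also have "\<dots> \<le> (LINT z|L. e / m)"
      proof (rule integral_mono_AE)
        show "AE z in L. \<bar>f z - g z\<bar> \<le> e / m" using L(3) by eventually_elim (use g in auto)
      qed (use int[OF f] int[OF g(1)] in auto)
      finally show ?thesis by (simp add: mult.commute)
    qed
    have "\<bar>(LINT z|M. f z) - (LINT z|N. f z)\<bar> \<le> e / m * measure M (space M) + e / m * measure N (space N)"
      using *[OF fin(1) sets(1) K(2)] *[OF fin(2) sets(2) K(3)] g(3) by linarith
    also have "\<dots> \<le> e / m * m"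
      unfolding distrib_left[symmetric] using m that by (intro mult_left_mono) (auto simp: m_def)
    also have "\<dots> = e" using m by simp
    finally show ?thesis .
  qed
  then have "\<bar>(LINT z|M. f z) - (LINT z|N. f z)\<bar> \<le> 0" by (rule field_le_epsilon[of _ 0, simplified])
  then show "(LINT z|M. f z) = (LINT z|N. f z)" by simp
qed

text \<open>Traces of harmonic polynomials. Only the values on the circle are constrained, which
  lets a product of two harmonic polynomials belong to the class although it is not harmonic in the
  plane.\<close>

definition circle_harmonic :: "(complex \<Rightarrow> real) set" where
  "circle_harmonic = {f. \<exists>q. \<forall>\<zeta>\<in>sphere 0 1. f \<zeta> = Re (poly q \<zeta>)}"

lemma circle_harmonic_add:
  assumes "f \<in> circle_harmonic" "g \<in> circle_harmonic"
  shows "(\<lambda>z. f z + g z) \<in> circle_harmonic"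
proof -
  obtain p q where "\<forall>\<zeta>\<in>sphere 0 1. f \<zeta> = Re (poly p \<zeta>)" "\<forall>\<zeta>\<in>sphere 0 1. g \<zeta> = Re (poly q \<zeta>)"
    using assms unfolding circle_harmonic_def by blast
  then show ?thesis unfolding circle_harmonic_def by (intro CollectI exI[of _ "p + q"]) simp
qed

lemma circle_harmonic_sum:
  assumes "finite I" "\<And>i. i \<in> I \<Longrightarrow> f i \<in> circle_harmonic"
  shows "(\<lambda>z. \<Sum>i\<in>I. f i z) \<in> circle_harmonic"
  using assms
proof (induction I rule: finite_induct)
  case empty
  then show ?case unfolding circle_harmonic_def by (intro CollectI exI[of _ 0]) simp
next
  case (insert i I)
  then show ?case by (simp add: circle_harmonic_add)
qed

lemma circle_harmonic_mode: "(\<lambda>\<zeta>. Re (a * \<zeta> ^ j) * Re (b * \<zeta> ^ k)) \<in> circle_harmonic"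
proof -
  have *: "(\<lambda>\<zeta>. Re (a * \<zeta> ^ j) * Re (b * \<zeta> ^ k)) \<in> circle_harmonic" if "j \<le> k" for a b j k
  proof -
    let ?q = "monom (a * b / 2) (j + k) + monom (b * cnj a / 2) (k - j)"
    have "Re (a * \<zeta> ^ j) * Re (b * \<zeta> ^ k) = Re (poly ?q \<zeta>)" if \<zeta>: "\<zeta> \<in> sphere 0 1" for \<zeta>
      using mode_product_circle[of \<zeta> j k a b] \<zeta> \<open>j \<le> k\<close> by (simp only: mem_sphere_0 poly_add poly_monom)
    then show ?thesis unfolding circle_harmonic_def by blast
  qed
  show ?thesis
  proof (cases "j \<le> k")
    case False
    then have "(\<lambda>\<zeta>. Re (b * \<zeta> ^ k) * Re (a * \<zeta> ^ j)) \<in> circle_harmonic" by (intro *) simp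
    then show ?thesis by (simp only: mult.commute)
  qed (rule *)
qed

lemma circle_harmonic_mult:
  assumes "f \<in> circle_harmonic" "g \<in> circle_harmonic"
  shows "(\<lambda>z. f z * g z) \<in> circle_harmonic"
proof -
  obtain p q where pq: "\<forall>\<zeta>\<in>sphere 0 1. f \<zeta> = Re (poly p \<zeta>)" "\<forall>\<zeta>\<in>sphere 0 1. g \<zeta> = Re (poly q \<zeta>)"
    using assms unfolding circle_harmonic_def by blast
  have "(\<lambda>z. \<Sum>j\<le>degree p. \<Sum>k\<le>degree q. Re (coeff p j * z ^ j) * Re (coeff q k * z ^ k)) \<in> circle_harmonic"
    by (intro circle_harmonic_sum circle_harmonic_mode finite_atMost)
  then obtain s where "\<forall>z\<in>sphere 0 1. (\<Sum>j\<le>degree p. \<Sum>k\<le>degree q. Re (coeff p j * z ^ j) * Re (coeff q k * z ^ k)) = Re (poly s z)"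
    unfolding circle_harmonic_def by blast
  moreover have "Re (poly p z) * Re (poly q z) =
      (\<Sum>j\<le>degree p. \<Sum>k\<le>degree q. Re (coeff p j * z ^ j) * Re (coeff q k * z ^ k))" for z
    unfolding poly_altdef Re_sum sum_product ..
  ultimately have "\<forall>z\<in>sphere 0 1. f z * g z = Re (poly s z)" using pq by simp
  then show ?thesis unfolding circle_harmonic_def by blast
qed

text \<open>Stone-Weierstrass: the traces form an algebra by the product formula for modes, and the
  coordinates \<open>Re\<close> and \<open>Im\<close> separate the points of the circle.\<close>

lemma circle_approximation:
  fixes f :: "complex \<Rightarrow> real"
  assumes "continuous_on (sphere 0 1) f" "0 < e"
  obtains q where "\<And>\<zeta>. norm \<zeta> = 1 \<Longrightarrow> \<bar>f \<zeta> - Re (poly q \<zeta>)\<bar> < e"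
proof -
  interpret function_ring_on circle_harmonic "sphere 0 1"
  proof
    show "compact (sphere (0::complex) 1)" by simp
    show "continuous_on (sphere 0 1) f" if "f \<in> circle_harmonic" for f
    proof -
      obtain q where q: "\<forall>\<zeta>\<in>sphere 0 1. f \<zeta> = Re (poly q \<zeta>)"
        using \<open>f \<in> circle_harmonic\<close> unfolding circle_harmonic_def by blast
      have "continuous_on (sphere 0 1) (\<lambda>\<zeta>. Re (poly q \<zeta>))" by (intro continuous_intros)
      moreover have "continuous_on (sphere 0 1) f \<longleftrightarrow> continuous_on (sphere 0 1) (\<lambda>\<zeta>. Re (poly q \<zeta>))"
        by (rule continuous_on_cong[OF refl]) (use q in blast)
      ultimately show ?thesis by simp
    qed
    show "(\<lambda>_. c) \<in> circle_harmonic" for c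
      unfolding circle_harmonic_def by (intro CollectI exI[of _ "[:of_real c:]"]) simp
    show "\<exists>f\<in>circle_harmonic. f x \<noteq> f y" if "x \<noteq> y" for x y
    proof (cases "Re x = Re y")
      case False
      have "Re \<in> circle_harmonic" unfolding circle_harmonic_def by (intro CollectI exI[of _ "[:0, 1:]"]) simp
      then show ?thesis using False by blast
    next
      case True
      have "Im \<in> circle_harmonic" unfolding circle_harmonic_def by (intro CollectI exI[of _ "[:0, -\<i>:]"]) simp
      then show ?thesis using True that by (auto simp: complex_eq_iff)
    qed
  qed (auto intro: circle_harmonic_add circle_harmonic_mult)
  obtain g where g: "g \<in> circle_harmonic" "\<And>x. x \<in> sphere 0 1 \<Longrightarrow> \<bar>f x - g x\<bar> < e"
    using Stone_Weierstrass_basic[OF assms] by blast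
  then obtain q where "\<forall>\<zeta>\<in>sphere 0 1. g \<zeta> = Re (poly q \<zeta>)" unfolding circle_harmonic_def by blast
  with g(2) show thesis by (intro that[of q]) auto
qed

section \<open>Harmonic polynomials\<close>

lemma has_derivative_Re_poly:
  "((\<lambda>z. Re (poly p z)) has_derivative (\<lambda>v. Re (poly (pderiv p) z * v))) (at z)"
  using poly_DERIV[of p z] unfolding has_field_derivative_def by (rule has_derivative_Re)

lemma partial_deriv_Re_poly:
  "partial_deriv v (\<lambda>z. Re (poly p z)) = (\<lambda>z. Re (poly (smult v (pderiv p)) z))"
  by (intro ext partial_deriv_eqI[OF has_derivative_Re_poly, THEN trans]) (simp add: mult.commute)

lemma smooth_Re_poly: "smooth (\<lambda>z. Re (poly p z))"
proof (rule smooth_coinduct[where P="\<lambda>f. \<exists>p. f = (\<lambda>z. Re (poly p z))"])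
  fix g z assume "\<exists>p. g = (\<lambda>z. Re (poly p z))"
  then show "g differentiable (at z)"
    using has_derivative_Re_poly unfolding differentiable_def by blast
next
  fix g v assume "\<exists>p. g = (\<lambda>z. Re (poly p z))"
  then show "\<exists>p. partial_deriv v g = (\<lambda>z. Re (poly p z))"
    using partial_deriv_Re_poly by blast
qed blast

text \<open>The second derivatives in the directions 1 and \<i> carry the factors 1 and \<i>^2 =
  -1.\<close>

lemma laplacian_Re_poly: "laplacian (\<lambda>z. Re (poly p z)) z = 0"
  unfolding laplacian_def partial_deriv_Re_poly by (simp add: pderiv_smult)

lemma partial_deriv_cong_open:
  assumes "smooth f" "open S" "\<And>w. w \<in> S \<Longrightarrow> f w = g w" "z \<in> S"
  shows "partial_deriv v f z = partial_deriv v g z"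
  using partial_deriv_eqI[OF has_derivative_transform_within_open[OF smooth_has_derivative[OF assms(1)] assms(2,4,3)]]
  by simp

lemma laplacian_cong_open:
  assumes f: "smooth f" and S: "open S" and eq: "\<And>w. w \<in> S \<Longrightarrow> f w = g w" and z: "z \<in> S"
  shows "laplacian f z = laplacian g z"
proof -
  have "partial_deriv v (partial_deriv v f) z = partial_deriv v (partial_deriv v g) z" if "v \<in> {1, \<i>}" for v
    by (rule partial_deriv_cong_open[OF smooth_partial_deriv[OF f that] S partial_deriv_cong_open[OF f S eq] z])
  then show ?thesis by (simp add: laplacian_def)
qed

lemma smooth_real_polynomial_function:
  assumes "real_polynomial_function f"
  shows "smooth f"
  using assms
  by induction (auto intro: smooth_bounded_linear smooth_const smooth_add smooth_mult)

text \<open>The definition of a level measure is an equation between set functions. This carries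
  such an equation over to integrals, by the usual induction from indicators to measurable
  functions.\<close>

lemma emeasure_plus_nn_integral:
  assumes sets: "sets M = sets N" "sets L = sets N"
    and eq: "\<And>A. A \<in> sets N \<Longrightarrow> emeasure N A = emeasure M A + emeasure L A"
    and f: "f \<in> borel_measurable N"
  shows "(\<integral>\<^sup>+z. f z \<partial>N) = (\<integral>\<^sup>+z. f z \<partial>M) + (\<integral>\<^sup>+z. f z \<partial>L)"
  using f
proof (induction rule: borel_measurable_induct)
  case (cong f g)
  have sp: "space M = space N" "space L = space N" using sets sets_eq_imp_space_eq by blast+
  have eqs: "(\<integral>\<^sup>+z. f z \<partial>M) = (\<integral>\<^sup>+z. g z \<partial>M)" "(\<integral>\<^sup>+z. f z \<partial>L) = (\<integral>\<^sup>+z. g z \<partial>L)"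
    by (intro nn_integral_cong; simp add: sp cong(3))+
  have eqN: "(\<integral>\<^sup>+z. f z \<partial>N) = (\<integral>\<^sup>+z. g z \<partial>N)"
    by (intro nn_integral_cong) (rule cong(3))
  show ?case unfolding eqs eqN by (rule cong)
next
  case (set A)
  then show ?case using sets eq by simp
next
  case (mult u c)
  then have "u \<in> borel_measurable M" "u \<in> borel_measurable L"
    by (simp_all add: measurable_cong_sets[OF sets(1) refl] measurable_cong_sets[OF sets(2) refl])
  then show ?case using mult by (simp add: nn_integral_cmult distrib_left)
next
  case (add u v)
  then have "u \<in> borel_measurable M" "u \<in> borel_measurable L" "v \<in> borel_measurable M" "v \<in> borel_measurable L"
    by (simp_all add: measurable_cong_sets[OF sets(1) refl] measurable_cong_sets[OF sets(2) refl])
  then show ?case using add by (simp add: nn_integral_add ac_simps)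
next
  case (seq U)
  then have m: "U i \<in> borel_measurable M" "U i \<in> borel_measurable L" for i
    by (simp_all add: measurable_cong_sets[OF sets(1) refl] measurable_cong_sets[OF sets(2) refl])
  have "(\<integral>\<^sup>+z. (SUP i. U i) z \<partial>N) = (SUP i. \<integral>\<^sup>+z. U i z \<partial>N)"
    using seq by (simp add: image_comp nn_integral_monotone_convergence_SUP)
  also have "\<dots> = (SUP i. (\<integral>\<^sup>+z. U i z \<partial>M) + (\<integral>\<^sup>+z. U i z \<partial>L))"
    using seq by simp
  also have "\<dots> = (SUP i. \<integral>\<^sup>+z. U i z \<partial>M) + (SUP i. \<integral>\<^sup>+z. U i z \<partial>L)"
  proof (intro ennreal_SUP_add)
    have "incseq U" using seq by blast
    then show "incseq (\<lambda>i. \<integral>\<^sup>+z. U i z \<partial>M)" "incseq (\<lambda>i. \<integral>\<^sup>+z. U i z \<partial>L)"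
      by (auto simp: incseq_def le_fun_def intro!: nn_integral_mono)
  qed
  also have "\<dots> = (\<integral>\<^sup>+z. (SUP i. U i) z \<partial>M) + (\<integral>\<^sup>+z. (SUP i. U i) z \<partial>L)"
    using seq m by (simp add: image_comp nn_integral_monotone_convergence_SUP)
  finally show ?case by (simp add: image_comp)
qed

lemma emeasure_plus_integral:
  fixes f :: "'a \<Rightarrow> real"
  assumes sets: "sets M = sets N" "sets L = sets N"
    and eq: "\<And>A. A \<in> sets N \<Longrightarrow> emeasure N A = emeasure M A + emeasure L A"
    and f: "integrable M f" "integrable L f"
  shows "integrable N f" "(LINT z|N. f z) = (LINT z|M. f z) + (LINT z|L. f z)"
proof -
  have m: "f \<in> borel_measurable N"
    using borel_measurable_integrable[OF f(1)] by (simp add: measurable_cong_sets[OF sets(1) refl])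
  note plus = emeasure_plus_nn_integral[OF sets eq]
  have ft: "(\<integral>\<^sup>+z. ennreal (g z) \<partial>M) \<noteq> \<top>" if "integrable M g" for M and g :: "'a \<Rightarrow> real"
    using that unfolding real_integrable_def by auto
  have e: "enn2real (\<integral>\<^sup>+z. ennreal (g z) \<partial>N) = enn2real (\<integral>\<^sup>+z. ennreal (g z) \<partial>M) + enn2real (\<integral>\<^sup>+z. ennreal (g z) \<partial>L)"
    "(\<integral>\<^sup>+z. ennreal (g z) \<partial>N) \<noteq> \<top>"
    if "integrable M g" "integrable L g" "g \<in> borel_measurable N" for g
    using ft[OF that(1)] ft[OF that(2)] that(3)
    by (subst plus; auto simp: enn2real_plus less_top)+
  have f': "integrable M (\<lambda>z. - f z)" "integrable L (\<lambda>z. - f z)" "(\<lambda>z. - f z) \<in> borel_measurable N"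
    using f m by auto
  show i: "integrable N f"
    unfolding real_integrable_def using m e(2)[OF f m] e(2)[OF f'] by simp
  show "(LINT z|N. f z) = (LINT z|M. f z) + (LINT z|L. f z)"
    using i f e(1)[OF f m] e(1)[OF f'] by (simp add: real_lebesgue_integral_def)
qed

section \<open>Distributional Laplacians and level measures\<close>

abbreviation disk :: "complex set" where "disk \<equiv> ball 0 1"

lemma has_laplacian_on_space:
  assumes "has_laplacian_on disk u \<nu>"
  shows "space \<nu> = disk" "sets \<nu> = sets (restrict_space borel disk)"
  using assms sets_eq_imp_space_eq[of \<nu> "restrict_space borel disk"]
  by (auto simp: has_laplacian_on_def space_restrict_space)

lemma borel_measurable_disk:
  assumes "sets \<nu> = sets (restrict_space borel disk)" "f \<in> borel_measurable borel"
  shows "f \<in> borel_measurable \<nu>"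
  using assms(2) by (simp add: measurable_cong_sets[OF assms(1) refl] measurable_restrict_space1)

lemma integrable_disk_compact_support:
  fixes f :: "complex \<Rightarrow> real"
  assumes sets: "sets \<nu> = sets (restrict_space borel disk)"
    and fin: "\<And>K. compact K \<Longrightarrow> K \<subseteq> disk \<Longrightarrow> emeasure \<nu> K < \<infinity>"
    and f: "continuous_on UNIV f" and K: "compact K" "K \<subseteq> disk" "\<And>z. z \<notin> K \<Longrightarrow> f z = 0"
  shows "integrable \<nu> f"
proof -
  have "bounded (f ` K)"
    by (intro compact_imp_bounded compact_continuous_image continuous_on_subset[OF f] K) auto
  then obtain C where C: "\<forall>z\<in>K. \<bar>f z\<bar> \<le> C" unfolding bounded_iff by auto
  have Ks: "K \<in> sets \<nu>"
    unfolding sets using K(1,2) by (auto simp: sets_restrict_space_iff intro: borel_compact)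
  have m: "f \<in> borel_measurable \<nu>"
    by (rule borel_measurable_disk[OF sets borel_measurable_continuous_onI[OF f]])
  show ?thesis
  proof (rule Bochner_Integration.integrable_bound[OF _ m])
    show "integrable \<nu> (\<lambda>z. C * indicator K z)"
      using fin[OF K(1,2)] Ks by (intro integrable_mult_right integrable_real_indicator) auto
    show "AE z in \<nu>. norm (f z) \<le> norm (C * indicator K z)"
      using C K(3) by (intro AE_I2) (auto simp: indicator_def abs_if split: if_splits)
  qed
qed

lemma test_function_plateau:
  assumes f: "smooth f" and X: "smooth X" "\<And>z. t' \<le> norm z \<Longrightarrow> X z = 0" and t: "t' < 1"
  shows "test_function_on disk (\<lambda>z. f z * X z)"
  using t X(2) by (intro test_function_onI[of _ "cball 0 t'"] smooth_mult f X(1)) auto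

section \<open>Exhausting plateaus and uniqueness of the distributional Laplacian\<close>

definition radius :: "nat \<Rightarrow> real" where "radius n = 1 - 1 / (real n + 2)"

lemma radius_bounds: "0 \<le> radius n" "0 < radius n" "radius n < 1" "radius n < radius (Suc n)"
  by (auto simp: radius_def field_simps)

lemma radius_tendsto: "radius \<longlonglongrightarrow> 1"
  unfolding radius_def[abs_def] by real_asymp

lemma radius_mono: "m \<le> n \<Longrightarrow> radius m \<le> radius n"
  by (rule lift_Suc_mono_le) (auto intro: less_imp_le radius_bounds)

lemma eventually_radius:
  assumes "s < 1"
  shows "eventually (\<lambda>n. s < radius n) sequentially"
  using order_tendstoD(1)[OF radius_tendsto assms] .

definition is_plateau :: "nat \<Rightarrow> (complex \<Rightarrow> real) \<Rightarrow> bool" where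
  "is_plateau n X \<longleftrightarrow> smooth X \<and> (\<forall>z. 0 \<le> X z \<and> X z \<le> 1) \<and>
     (\<forall>z. norm z \<le> radius n \<longrightarrow> X z = 1) \<and> (\<forall>z. radius (Suc n) \<le> norm z \<longrightarrow> X z = 0)"

definition plateau :: "nat \<Rightarrow> complex \<Rightarrow> real" where
  "plateau n = (SOME X. is_plateau n X)"

lemma is_plateau_plateau: "is_plateau n (plateau n)"
proof -
  obtain X :: "complex \<Rightarrow> real" where "smooth X" "\<And>z. 0 \<le> X z" "\<And>z. X z \<le> 1"
    "\<And>z. norm z \<le> radius n \<Longrightarrow> X z = 1" "\<And>z. radius (Suc n) \<le> norm z \<Longrightarrow> X z = 0"
    by (rule plateau_exists[OF radius_bounds(1,4)]) (rule that; assumption)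
  then have "is_plateau n X" by (simp add: is_plateau_def)
  then show ?thesis unfolding plateau_def by (rule someI[of "is_plateau n"])
qed

lemma smooth_plateau: "smooth (plateau n)"
  and plateau_nonneg: "0 \<le> plateau n z" and plateau_le_1: "plateau n z \<le> 1"
  and plateau_eq_1: "norm z \<le> radius n \<Longrightarrow> plateau n z = 1"
  and plateau_eq_0: "radius (Suc n) \<le> norm z \<Longrightarrow> plateau n z = 0"
  using is_plateau_plateau[of n] by (auto simp: is_plateau_def)

lemma plateau_tendsto:
  assumes "z \<in> disk"
  shows "(\<lambda>n. plateau n z) \<longlonglongrightarrow> 1"
proof (rule tendsto_eventually)
  show "eventually (\<lambda>n. plateau n z = 1) sequentially"
    using eventually_radius[of "norm z"] assms by (auto elim!: eventually_mono intro: plateau_eq_1)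
qed

lemma test_function_mult_plateau:
  assumes "smooth f"
  shows "test_function_on disk (\<lambda>z. f z * plateau n z)"
  by (rule test_function_plateau[OF assms smooth_plateau plateau_eq_0 radius_bounds(3)])

lemma test_function_plateau': "test_function_on disk (plateau n)"
  using test_function_mult_plateau[OF smooth_const[of 1], of n] by simp

lemma integrable_plateau:
  assumes sets: "sets \<nu> = sets (restrict_space borel disk)"
    and fin: "\<And>K. compact K \<Longrightarrow> K \<subseteq> disk \<Longrightarrow> emeasure \<nu> K < \<infinity>"
    and f: "continuous_on UNIV f"
  shows "integrable \<nu> (\<lambda>z. f z * plateau n z)"
proof (rule integrable_disk_compact_support[OF sets fin, where K="cball 0 (radius (Suc n))"])
  show "continuous_on UNIV (\<lambda>z. f z * plateau n z)"
    by (rule continuous_on_mult[OF f smooth_continuous_on[OF smooth_plateau]])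
  show "cball 0 (radius (Suc n)) \<subseteq> disk" using radius_bounds(3)[of "Suc n"] by auto
qed (auto intro!: plateau_eq_0)

text \<open>A polynomial times a plateau is a test function, so the two measures, cut off by a
  plateau, have the same integrals of polynomials. Polynomials are uniformly dense on the closed
  disk, which makes the cut-off measures equal. They coincide with the original measures on smaller
  disks, and these exhaust the open disk.\<close>

lemma has_laplacian_on_unique:
  assumes \<nu>: "has_laplacian_on disk u \<nu>" and \<nu>': "has_laplacian_on disk u \<nu>'"
  shows "\<nu> = \<nu>'"
proof -
  have sets: "sets \<nu> = sets (restrict_space borel disk)" "sets \<nu>' = sets (restrict_space borel disk)"
    using \<nu> \<nu>' by (auto simp: has_laplacian_on_def)
  have fin: "emeasure \<nu> K < \<infinity>" "emeasure \<nu>' K < \<infinity>" if "compact K" "K \<subseteq> disk" for K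
    using \<nu> \<nu>' that by (auto simp: has_laplacian_on_def)
  \<comment> \<open>The cut-off makes the measure finite and places it on the Borel sets of the
    plane, as the uniqueness criterion for finite measures expects.\<close>
  define C where "C n L = distr (density L (\<lambda>z. ennreal (plateau n z))) borel (\<lambda>z::complex. z)" for n L
  have pm: "plateau n \<in> borel_measurable borel" for n
    by (intro borel_measurable_continuous_onI smooth_continuous_on smooth_plateau)
  have CL: "finite_measure (C n L)" "sets (C n L) = sets borel" "AE z in C n L. z \<in> cball 0 1"
      "\<And>f. f \<in> borel_measurable borel \<Longrightarrow> (LINT z|C n L. f z) = (LINT z|L. f z * plateau n z)"
      "\<And>A. A \<in> sets borel \<Longrightarrow> A \<subseteq> cball 0 (radius n) \<Longrightarrow> emeasure (C n L) A = emeasure L A"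
    if L: "sets L = sets (restrict_space borel disk)"
      "\<And>K. compact K \<Longrightarrow> K \<subseteq> disk \<Longrightarrow> emeasure L K < \<infinity>" for n and L :: "complex measure"
  proof -
    have spL: "space L = disk" using sets_eq_imp_space_eq[OF L(1)] by (simp add: space_restrict_space)
    have pmL: "plateau n \<in> borel_measurable L" by (rule borel_measurable_disk[OF L(1) pm])
    have id: "(\<lambda>z. z) \<in> borel_measurable (density L (\<lambda>z. ennreal (plateau n z)))"
      using borel_measurable_disk[OF L(1), of "\<lambda>z. z"] by simp
    have int: "integrable L (plateau n)"
      using integrable_plateau[OF L, of "\<lambda>_. 1" n] by simp
    show "finite_measure (C n L)"
    proof
      have "emeasure (C n L) (space (C n L)) = (\<integral>\<^sup>+z. ennreal (plateau n z) \<partial>L)"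
      proof -
        have d: "disk \<in> sets L" using sets.top[of L] spL by simp
        have "emeasure (C n L) (space (C n L)) = (\<integral>\<^sup>+z. ennreal (plateau n z) * indicator disk z \<partial>L)"
          unfolding C_def using pmL d
          by (simp add: emeasure_distr[OF id] spL emeasure_density)
        also have "\<dots> = (\<integral>\<^sup>+z. ennreal (plateau n z) \<partial>L)"
          by (intro nn_integral_cong) (simp add: spL)
        finally show ?thesis .
      qed
      also have "\<dots> = ennreal (LINT z|L. plateau n z)"
        by (rule nn_integral_eq_integral[OF int]) (simp add: plateau_nonneg)
      finally show "emeasure (C n L) (space (C n L)) \<noteq> \<infinity>" by simp
    qed
    show "sets (C n L) = sets borel" by (simp add: C_def)
    show "AE z in C n L. z \<in> cball 0 1"
      unfolding C_def by (subst AE_distr_iff[OF id]) (auto simp: spL intro!: AE_I2)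
    show "(LINT z|C n L. f z) = (LINT z|L. f z * plateau n z)" if f: "f \<in> borel_measurable borel" for f
      unfolding C_def
      by (subst integral_distr[OF id f], subst integral_density)
         (auto simp: plateau_nonneg pmL mult.commute intro: borel_measurable_disk[OF L(1) f])
    show "emeasure (C n L) A = emeasure L A" if A: "A \<in> sets borel" "A \<subseteq> cball 0 (radius n)" for A
    proof -
      have Ad: "A \<subseteq> disk" using A(2) radius_bounds(3)[of n] by auto
      then have AL: "A \<in> sets L" unfolding L(1) using A by (simp add: sets_restrict_space_iff)
      have "emeasure (C n L) A = (\<integral>\<^sup>+z. ennreal (plateau n z) * indicator A z \<partial>L)"
        unfolding C_def using pmL AL A Ad
        by (simp add: emeasure_distr[OF id] spL emeasure_density Int_absorb2)
      also have "\<dots> = (\<integral>\<^sup>+z. indicator A z \<partial>L)"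
        using A(2) by (intro nn_integral_cong) (auto simp: indicator_def plateau_eq_1)
      finally show ?thesis using AL by simp
    qed
  qed
  have Ceq: "C n \<nu> = C n \<nu>'" for n
  proof (rule finite_measures_eqI[where K="cball 0 1"])
    show "\<exists>g. continuous_on UNIV g \<and> (\<forall>z\<in>cball 0 1. \<bar>f z - g z\<bar> \<le> e) \<and> (LINT z|C n \<nu>. g z) = (LINT z|C n \<nu>'. g z)"
      if f: "continuous_on UNIV f" and e: "0 < e" for f :: "complex \<Rightarrow> real" and e :: real
    proof -
      obtain g where g: "real_polynomial_function g" "\<And>x. x \<in> cball 0 1 \<Longrightarrow> \<bar>f x - g x\<bar> < e"
        using Stone_Weierstrass_real_polynomial_function[OF compact_cball continuous_on_subset[OF f] e] by blast
      have sg: "smooth g" by (rule smooth_real_polynomial_function[OF g(1)])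
      then have gm: "g \<in> borel_measurable borel" by (intro borel_measurable_continuous_onI smooth_continuous_on)
      have t: "test_function_on disk (\<lambda>z. g z * plateau n z)" by (rule test_function_mult_plateau[OF sg])
      have "(LINT z|\<nu>. g z * plateau n z) = (LINT z|\<nu>'. g z * plateau n z)"
        using \<nu> \<nu>' t unfolding has_laplacian_on_def by simp
      then have "(LINT z|C n \<nu>. g z) = (LINT z|C n \<nu>'. g z)"
        using CL(4)[OF sets(1) fin(1) gm] CL(4)[OF sets(2) fin(2) gm] by simp
      then show ?thesis
        using g(2) smooth_continuous_on[OF sg] by (intro exI[of _ g] conjI ballI less_imp_le)
    qed
    show "AE z in C n \<nu>. z \<in> cball 0 1" "finite_measure (C n \<nu>)" "sets (C n \<nu>) = sets borel"
      by (rule CL[OF sets(1)], rule fin(1); assumption)+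
    show "AE z in C n \<nu>'. z \<in> cball 0 1" "finite_measure (C n \<nu>')" "sets (C n \<nu>') = sets borel"
      by (rule CL[OF sets(2)], rule fin(2); assumption)+
  qed simp
  show ?thesis
  proof (rule measure_eqI)
    show "sets \<nu> = sets \<nu>'" using sets by simp
    fix A assume A: "A \<in> sets \<nu>"
    then have Ab: "A \<in> sets borel" "A \<subseteq> disk" unfolding sets by (auto simp: sets_restrict_space_iff)
    have lim: "(\<lambda>n. emeasure L (A \<inter> cball 0 (radius n))) \<longlonglongrightarrow> emeasure L A"
      if L: "sets L = sets (restrict_space borel disk)" for L
    proof -
      have "(\<lambda>n. emeasure L (A \<inter> cball 0 (radius n))) \<longlonglongrightarrow> emeasure L (\<Union>n. A \<inter> cball 0 (radius n))"
      proof (rule Lim_emeasure_incseq)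
        show "range (\<lambda>n. A \<inter> cball 0 (radius n)) \<subseteq> sets L"
          unfolding L using Ab by (auto simp: sets_restrict_space_iff)
        show "incseq (\<lambda>n. A \<inter> cball 0 (radius n))"
          using radius_mono by (fastforce simp: incseq_def)
      qed
      also have "(\<Union>n. A \<inter> cball 0 (radius n)) = A"
      proof -
        have "\<exists>n. norm z \<le> radius n" if "z \<in> A" for z
        proof -
          have "norm z < 1" using that Ab(2) by auto
          from eventually_radius[OF this] obtain n where "norm z < radius n"
            unfolding eventually_sequentially by auto
          then show ?thesis by (intro exI[of _ n]) simp
        qed
        then show ?thesis by auto
      qed
      finally show ?thesis .
    qed
    have "emeasure \<nu> (A \<inter> cball 0 (radius n)) = emeasure \<nu>' (A \<inter> cball 0 (radius n))" for n
      using CL(5)[OF sets(1) fin(1), of "A \<inter> cball 0 (radius n)" n]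
        CL(5)[OF sets(2) fin(2), of "A \<inter> cball 0 (radius n)" n] Ab unfolding Ceq by simp
    then show "emeasure \<nu> A = emeasure \<nu>' A"
      using LIMSEQ_unique[OF lim[OF sets(1)]] lim[OF sets(2)] by simp
  qed
qed

lemma sublevel_radius:
  assumes lim: "(u \<longlongrightarrow> (0::ereal)) (filtercomap norm (at_left 1))" and r: "r < 0"
  obtains s where "0 \<le> s" "s < 1" "\<And>z::complex. s < norm z \<Longrightarrow> norm z < 1 \<Longrightarrow> ereal r < u z"
proof -
  have "eventually (\<lambda>z. ereal r < u z) (filtercomap norm (at_left 1))"
    using order_tendstoD(1)[OF lim] r by simp
  then obtain P where P: "eventually P (at_left (1::real))" "\<And>z. P (norm z) \<Longrightarrow> ereal r < u z"
    unfolding eventually_filtercomap by blast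
  then obtain b where b: "b < 1" "\<And>y. b < y \<Longrightarrow> y < 1 \<Longrightarrow> P y"
    unfolding eventually_at_left_field by blast
  show thesis by (rule that[of "max b 0"]) (use b P in auto)
qed

lemma open_sublevel:
  assumes "continuous_on disk (u :: complex \<Rightarrow> ereal)"
  shows "open {z \<in> disk. u z < ereal r}"
proof -
  have "open (u -` {..<ereal r} \<inter> disk)"
    using continuous_on_open_vimage[of disk u] assms by auto
  moreover have "u -` {..<ereal r} \<inter> disk = {z \<in> disk. u z < ereal r}" by auto
  ultimately show ?thesis by simp
qed

lemma finite_measure_disk_tendsto:
  assumes fin: "finite_measure L" and sets: "sets L = sets (restrict_space borel disk)"
    and f: "continuous_on UNIV f"
  shows "(\<lambda>n. LINT z|L. f z * plateau n z) \<longlonglongrightarrow> (LINT z|L. f z)" and "integrable L f"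
proof -
  interpret finite_measure L by fact
  have sp: "space L = disk" using sets_eq_imp_space_eq[OF sets] by (simp add: space_restrict_space)
  have "bounded (f ` cball 0 1)"
    by (intro compact_imp_bounded compact_continuous_image continuous_on_subset[OF f]) auto
  then obtain C where C: "\<forall>z\<in>cball 0 1. \<bar>f z\<bar> \<le> C" unfolding bounded_iff by auto
  have fm: "f \<in> borel_measurable L"
    by (rule borel_measurable_disk[OF sets borel_measurable_continuous_onI[OF f]])
  show int: "integrable L f"
    by (rule integrable_const_bound[of f C, OF AE_I2 fm]) (use C sp in auto)
  show "(\<lambda>n. LINT z|L. f z * plateau n z) \<longlonglongrightarrow> (LINT z|L. f z)"
  proof (rule integral_dominated_convergence[where w="\<lambda>z. \<bar>f z\<bar>"])
    show "(\<lambda>z. f z * plateau n z) \<in> borel_measurable L" for n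
      by (intro borel_measurable_times fm borel_measurable_disk[OF sets]
          borel_measurable_continuous_onI smooth_continuous_on smooth_plateau)
    show "AE z in L. (\<lambda>n. f z * plateau n z) \<longlonglongrightarrow> f z"
    proof (rule AE_I2)
      fix z assume "z \<in> space L"
      then have "(\<lambda>n. plateau n z) \<longlonglongrightarrow> 1" using plateau_tendsto sp by simp
      from tendsto_mult_left[OF this, of "f z"] show "(\<lambda>n. f z * plateau n z) \<longlonglongrightarrow> f z" by simp
    qed
    show "AE z in L. norm (f z * plateau n z) \<le> \<bar>f z\<bar>" for n
      using plateau_nonneg plateau_le_1 by (intro AE_I2) (auto simp: abs_mult intro: mult_left_le)
  qed (use int fm in auto)
qed

text \<open>The measures \<Delta>u and \<Delta>(max u r) have the same harmonic moments. Subtracting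
  the part of \<Delta>u on {u \<ge> r} from both leaves the level measure on one side and the part
  of \<Delta>u on {u < r} on the other.\<close>

lemma level_measure_harmonic:
  assumes u: "continuous_on disk u" and lim: "(u \<longlongrightarrow> 0) (filtercomap norm (at_left 1))"
    and \<nu>: "has_laplacian_on disk u \<nu>" and fin: "finite_measure \<nu>" and r: "r < 0"
    and M: "level_measure u r M"
  shows "finite_measure M"
    and "(LINT z|M. Re (poly q z)) = (LINT z|\<nu>. Re (poly q z) * indicator {z \<in> disk. u z < ereal r} z)"
proof -
  interpret \<nu>: finite_measure \<nu> by fact
  define B where "B = {z \<in> disk. u z < ereal r}"
  have oB: "open B" "B \<subseteq> disk" unfolding B_def using open_sublevel[OF u] by auto
  obtain \<nu>' \<nu>r where "has_laplacian_on disk u \<nu>'" and \<nu>r: "has_laplacian_on disk (\<lambda>z. max (u z) (ereal r)) \<nu>r"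
    and eq': "\<And>A. A \<in> sets M \<Longrightarrow> emeasure M A + emeasure \<nu>' (A - B) = emeasure \<nu>r A"
    and sM: "sets M = sets (restrict_space borel disk)"
    using M unfolding level_measure_def B_def by blast
  \<comment> \<open>The definition of \<open>level_measure\<close> hides its own copy of the
    Laplacian of u under an existential; uniqueness identifies it with \<nu>.\<close>
  then have eq: "emeasure M A + emeasure \<nu> (A - B) = emeasure \<nu>r A" if "A \<in> sets M" for A
    using has_laplacian_on_unique[OF _ \<nu>] that by blast
  have s\<nu>: "sets \<nu> = sets (restrict_space borel disk)" and s\<nu>r: "sets \<nu>r = sets (restrict_space borel disk)"
    using has_laplacian_on_space \<nu> \<nu>r by auto
  have finr: "emeasure \<nu>r K < \<infinity>" if "compact K" "K \<subseteq> disk" for K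
    using \<nu>r that by (auto simp: has_laplacian_on_def)
  have spM: "space M = disk" using sets_eq_imp_space_eq[OF sM] by (simp add: space_restrict_space)
  have finM: "emeasure M K < \<infinity>" if "compact K" "K \<subseteq> disk" for K
  proof -
    have "K \<in> sets M" unfolding sM using that by (auto simp: sets_restrict_space_iff intro: borel_compact)
    from eq[OF this] have "emeasure M K \<le> emeasure \<nu>r K"
      by (metis le_iff_add)
    then show ?thesis using finr[OF that] by (rule le_less_trans)
  qed
  have Bs: "B \<in> sets \<nu>" "disk - B \<in> sets \<nu>"
    unfolding s\<nu> using oB by (auto simp: sets_restrict_space_iff)
  define L where "L = density \<nu> (indicator (disk - B))"
  have sL: "sets L = sets \<nu>" by (simp add: L_def)
  have spn: "space \<nu> = disk" using has_laplacian_on_space[OF \<nu>] by simp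
  have eL: "emeasure L A = emeasure \<nu> (A - B)" if "A \<in> sets \<nu>" for A
  proof -
    have "emeasure L A = (\<integral>\<^sup>+z. indicator (disk - B) z * indicator A z \<partial>\<nu>)"
      unfolding L_def using that Bs by (subst emeasure_density) auto
    also have "\<dots> = (\<integral>\<^sup>+z. indicator (A - B) z \<partial>\<nu>)"
      by (intro nn_integral_cong) (auto simp: spn indicator_def)
    finally show ?thesis using that Bs by auto
  qed
  have finL: "finite_measure L"
  proof
    show "emeasure L (space L) \<noteq> \<infinity>"
      using eL[of "space \<nu>"] by (simp add: L_def)
  qed
  have plus: "(\<integral>\<^sup>+z. f z \<partial>\<nu>r) = (\<integral>\<^sup>+z. f z \<partial>M) + (\<integral>\<^sup>+z. f z \<partial>L)" if "f \<in> borel_measurable \<nu>r" for f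
    by (rule emeasure_plus_nn_integral[OF _ _ _ that]) (use sM s\<nu> s\<nu>r sL eq eL in auto)
  obtain s where s: "0 \<le> s" "s < 1" "\<And>z::complex. s < norm z \<Longrightarrow> norm z < 1 \<Longrightarrow> ereal r < u z"
    by (rule sublevel_radius[OF lim r]) (rule that; assumption)
  \<comment> \<open>Where the plateau equals 1 the test function is harmonic, and outside the radius
    \<open>s\<close> the maximum equals u. As \<open>s < radius n\<close>, the two regions cover the
    disk, so replacing u by the maximum does not change the tested integral.\<close>
  have test: "(LINT z|\<nu>r. Re (poly q z) * plateau n z) = (LINT z|\<nu>. Re (poly q z) * plateau n z)"
    if n: "s < radius n" for n q
  proof -
    define \<phi> where "\<phi> = (\<lambda>z. Re (poly q z) * plateau n z)"
    have t: "test_function_on disk \<phi>"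
      unfolding \<phi>_def by (rule test_function_mult_plateau[OF smooth_Re_poly])
    have "laplacian \<phi> z = 0" if "norm z < radius n" for z
    proof -
      have "laplacian (\<lambda>z. Re (poly q z)) z = laplacian \<phi> z"
        by (rule laplacian_cong_open[OF smooth_Re_poly, of "ball 0 (radius n)"])
           (use that in \<open>auto simp: \<phi>_def plateau_eq_1\<close>)
      then show ?thesis by (simp add: laplacian_Re_poly)
    qed
    note lap = this
    have "(LINT z:disk|lborel. real_of_ereal (max (u z) (ereal r)) * laplacian \<phi> z) =
      (LINT z:disk|lborel. real_of_ereal (u z) * laplacian \<phi> z)"
    proof (intro set_lebesgue_integral_cong allI impI)
      fix z :: complex assume z: "z \<in> disk"
      show "real_of_ereal (max (u z) (ereal r)) * laplacian \<phi> z = real_of_ereal (u z) * laplacian \<phi> z"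
      proof (cases "s < norm z")
        case True
        then have "max (u z) (ereal r) = u z" using s(3)[of z] z by (auto simp: max_def)
        then show ?thesis by simp
      next
        case False
        then show ?thesis using lap[of z] n by simp
      qed
    qed simp
    then show ?thesis using t \<nu> \<nu>r unfolding has_laplacian_on_def \<phi>_def by simp
  qed
  have pm: "plateau n \<in> borel_measurable borel" for n
    by (intro borel_measurable_continuous_onI smooth_continuous_on smooth_plateau)
  have pint: "integrable \<nu>r (plateau n)" for n
    using integrable_plateau[OF s\<nu>r finr, of "\<lambda>_. 1" n] by simp
  have le: "(\<integral>\<^sup>+z. ennreal (plateau n z) \<partial>M) \<le> emeasure \<nu> disk" if n: "s < radius n" for n
  proof -
    have "(\<integral>\<^sup>+z. ennreal (plateau n z) \<partial>M) \<le> (\<integral>\<^sup>+z. ennreal (plateau n z) \<partial>\<nu>r)"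
      using borel_measurable_disk[OF s\<nu>r pm] by (subst plus) (auto simp: le_iff_add)
    also have "\<dots> = ennreal (LINT z|\<nu>r. plateau n z)"
      by (rule nn_integral_eq_integral[OF pint]) (simp add: plateau_nonneg)
    also have "\<dots> = ennreal (LINT z|\<nu>. plateau n z)" using test[OF n, of 1] by simp
    also have "\<dots> \<le> ennreal (measure \<nu> (space \<nu>))"
    proof -
      have "(LINT z|\<nu>. plateau n z) \<le> (LINT z|\<nu>. 1)"
        using borel_measurable_disk[OF s\<nu> pm[of n]]
        by (intro integral_mono \<nu>.integrable_const_bound[where B=1])
           (auto simp: plateau_le_1 plateau_nonneg)
      then show ?thesis by (simp add: ennreal_leI)
    qed
    finally show ?thesis by (simp add: \<nu>.emeasure_eq_measure spn)
  qed
  \<comment> \<open>Moments over the whole disk make sense only for a finite measure. The case q = 1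
    bounds the integrals of all plateaus, and Fatou's lemma turns this into a bound on the
    mass.\<close>
  have "emeasure M disk \<le> emeasure \<nu> disk"
  proof -
    have "emeasure M disk = (\<integral>\<^sup>+z. 1 \<partial>M)" by (simp add: spM)
    also have "\<dots> \<le> (\<integral>\<^sup>+z. liminf (\<lambda>n. ennreal (plateau n z)) \<partial>M)"
    proof (rule nn_integral_mono)
      fix z assume "z \<in> space M"
      then have "(\<lambda>n. ennreal (plateau n z)) \<longlonglongrightarrow> ennreal 1"
        using plateau_tendsto spM by (intro tendsto_ennrealI) auto
      then show "1 \<le> liminf (\<lambda>n. ennreal (plateau n z))"
        using lim_imp_Liminf[of sequentially] by fastforce
    qed
    also have "\<dots> \<le> liminf (\<lambda>n. \<integral>\<^sup>+z. ennreal (plateau n z) \<partial>M)"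
      by (intro nn_integral_liminf measurable_compose[OF borel_measurable_disk[OF sM pm]]) auto
    also have "\<dots> \<le> limsup (\<lambda>n. \<integral>\<^sup>+z. ennreal (plateau n z) \<partial>M)"
      by (rule Liminf_le_Limsup) simp
    also have "\<dots> \<le> emeasure \<nu> disk"
      using eventually_radius[OF s(2)] by (intro Limsup_bounded) (auto elim!: eventually_mono intro: le)
    finally show ?thesis .
  qed
  then show fM: "finite_measure M"
    by (intro finite_measureI) (use spM spn \<nu>.emeasure_finite[of disk] in \<open>auto simp: top_unique\<close>)
  interpret M: finite_measure M by (rule fM)
  interpret L: finite_measure L by (rule finL)
  have fr: "finite_measure \<nu>r"
  proof
    have "disk \<in> sets M" using sets.top[of M] spM by simp
    from eq[OF this] show "emeasure \<nu>r (space \<nu>r) \<noteq> \<infinity>"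
      using has_laplacian_on_space[OF \<nu>r] by (metis M.emeasure_finite \<nu>.emeasure_finite ennreal_add_eq_top infinity_ennreal_def)
  qed
  define f where "f = (\<lambda>z. Re (poly q z))"
  have f: "continuous_on UNIV f" unfolding f_def by (rule smooth_continuous_on[OF smooth_Re_poly])
  have "(\<lambda>n. LINT z|\<nu>r. f z * plateau n z) \<longlonglongrightarrow> (LINT z|\<nu>r. f z)"
    by (rule finite_measure_disk_tendsto[OF fr s\<nu>r f])
  moreover have "eventually (\<lambda>n. (LINT z|\<nu>. f z * plateau n z) = (LINT z|\<nu>r. f z * plateau n z)) sequentially"
    using eventually_radius[OF s(2)] by eventually_elim (simp add: test f_def)
  ultimately have "(\<lambda>n. LINT z|\<nu>. f z * plateau n z) \<longlonglongrightarrow> (LINT z|\<nu>r. f z)"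
    using tendsto_cong by fastforce
  then have 1: "(LINT z|\<nu>r. f z) = (LINT z|\<nu>. f z)"
    using finite_measure_disk_tendsto[OF fin s\<nu> f] LIMSEQ_unique by blast
  have fi: "integrable \<nu>r f" "integrable M f" "integrable L f" "integrable \<nu> f"
    using finite_measure_disk_tendsto(2)[OF _ _ f] fr s\<nu>r fM sM finL sL fin s\<nu> by auto
  have 2: "(LINT z|\<nu>r. f z) = (LINT z|M. f z) + (LINT z|L. f z)"
    by (rule emeasure_plus_integral(2)[OF _ _ _ fi(2,3)]) (use sM s\<nu> s\<nu>r sL eq eL in auto)
  have 3: "(LINT z|L. f z) = (LINT z|\<nu>. f z * indicator (disk - B) z)"
  proof -
    have "L = density \<nu> (\<lambda>z. ennreal (indicator (disk - B) z))"
      by (simp add: L_def ennreal_indicator)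
    then have "(LINT z|L. f z) = (LINT z|\<nu>. indicator (disk - B) z *\<^sub>R f z)"
      using integral_density[OF borel_measurable_integrable[OF fi(4)] borel_measurable_indicator[OF Bs(2)] AE_I2]
      by (simp only: indicator_pos_le)
    then show ?thesis by (simp only: real_scaleR_def mult.commute)
  qed
  have "(LINT z|\<nu>. f z) = (LINT z|\<nu>. f z * indicator B z + f z * indicator (disk - B) z)"
    by (intro Bochner_Integration.integral_cong) (auto simp: spn indicator_def)
  also have "\<dots> = (LINT z|\<nu>. f z * indicator B z) + (LINT z|\<nu>. f z * indicator (disk - B) z)"
    using fi(4) Bs by (intro Bochner_Integration.integral_add integrable_real_mult_indicator)
  finally have "(LINT z|M. f z) = (LINT z|\<nu>. f z * indicator B z)" using 1 2 3 by linarith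
  then show "(LINT z|M. Re (poly q z)) = (LINT z|\<nu>. Re (poly q z) * indicator {z \<in> disk. u z < ereal r} z)"
    by (simp only: f_def B_def)
qed

section \<open>The Poisson kernel\<close>

definition poisson :: "complex \<Rightarrow> complex \<Rightarrow> real" where
  "poisson w \<zeta> = (1 - (norm w)\<^sup>2) / (norm (\<zeta> - w))\<^sup>2"

text \<open>Harnack's bound, from |\<zeta> - w| \<le> 1 + |w|. It is independent of \<zeta>, so
  integrating it in w bounds a balayage from below uniformly.\<close>

lemma poisson_ge:
  assumes "norm w < 1" "norm \<zeta> = 1"
  shows "(1 - norm w) / (1 + norm w) \<le> poisson w \<zeta>"
proof -
  have "norm (\<zeta> - w) \<le> 1 + norm w" using norm_triangle_ineq4[of \<zeta> w] assms by simp
  moreover have pos: "0 < norm (\<zeta> - w)" using assms by auto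
  ultimately have "(norm (\<zeta> - w))\<^sup>2 \<le> (1 + norm w)\<^sup>2" by (intro power_mono) auto
  then have "(1 - (norm w)\<^sup>2) / (1 + norm w)\<^sup>2 \<le> poisson w \<zeta>"
    unfolding poisson_def
  proof (rule divide_left_mono)
    show "0 \<le> 1 - (norm w)\<^sup>2" using assms power_le_one[of "norm w" 2] by simp
    have "0 < 1 + norm w" using norm_ge_zero[of w] by linarith
    then show "0 < (1 + norm w)\<^sup>2 * (norm (\<zeta> - w))\<^sup>2" using pos by (intro mult_pos_pos zero_less_power)
  qed
  moreover have "(1 - (norm w)\<^sup>2) / (1 + norm w)\<^sup>2 = (1 - norm w) / (1 + norm w)"
  proof -
    have "0 < 1 + norm w" using norm_ge_zero[of w] by linarith
    then show ?thesis by (simp add: power2_eq_square divide_simps) (simp add: algebra_simps)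
  qed
  ultimately show ?thesis by simp
qed

lemma poisson_pos: "norm w < 1 \<Longrightarrow> norm \<zeta> = 1 \<Longrightarrow> 0 < poisson w \<zeta>"
  by (rule less_le_trans[OF _ poisson_ge]) (auto intro!: divide_pos_pos add_pos_nonneg)

text \<open>\<open>K\<close> is chosen holomorphic in \<zeta> on the closed disk, as the mean value
  property requires. On the circle its conjugate is the Herglotz kernel, which has a pole at
  w.\<close>

lemma poisson_eq_Re:
  assumes w: "norm w < 1" and \<zeta>: "norm \<zeta> = 1"
  defines "K \<equiv> (1 + cnj w * \<zeta>) / (1 - cnj w * \<zeta>)"
  shows "poisson w \<zeta> = Re K" and "cnj K = (\<zeta> + w) / (\<zeta> - w)"
proof -
  have n: "\<zeta> * cnj \<zeta> = 1" using \<zeta> by (simp add: complex_norm_square[symmetric])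
  have ne: "\<zeta> \<noteq> w" "\<zeta> \<noteq> 0" using w \<zeta> by auto
  have "cnj K = (1 + w * cnj \<zeta>) / (1 - w * cnj \<zeta>)" by (simp add: K_def)
  also have "\<dots> = (\<zeta> * (1 + w * cnj \<zeta>)) / (\<zeta> * (1 - w * cnj \<zeta>))" using ne by simp
  also have "\<zeta> * (1 + w * cnj \<zeta>) = \<zeta> + w * (\<zeta> * cnj \<zeta>)" by (simp add: algebra_simps)
  also have "\<zeta> * (1 - w * cnj \<zeta>) = \<zeta> - w * (\<zeta> * cnj \<zeta>)" by (simp add: algebra_simps)
  finally show K: "cnj K = (\<zeta> + w) / (\<zeta> - w)" by (simp add: n)
  have "Re (x / y) = Re (x * cnj y) / (norm y)\<^sup>2" for x y
    by (simp add: Re_divide cmod_power2)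
  then have "Re (cnj K) = Re ((\<zeta> + w) * cnj (\<zeta> - w)) / (norm (\<zeta> - w))\<^sup>2"
    unfolding K .
  then have "Re K = Re ((\<zeta> + w) * cnj (\<zeta> - w)) / (norm (\<zeta> - w))\<^sup>2"
    unfolding cnj.sel(1) .
  also have "Re ((\<zeta> + w) * cnj (\<zeta> - w)) = (norm \<zeta>)\<^sup>2 - (norm w)\<^sup>2"
    unfolding cmod_power2 by (simp add: algebra_simps power2_eq_square)
  finally show "poisson w \<zeta> = Re K" by (simp add: poisson_def \<zeta>)
qed

text \<open>The product Re q Re K is half of Re (q K) + Re (q cnj K). The last term is not
  holomorphic in \<zeta>, but writing q = q(w) + (\<zeta> - w) s cancels the pole of cnj K and
  leaves s (\<zeta> + w) + q(w) cnj K, whose last summand may be conjugated under the real part. On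
  the circle the integrand is thus the real part of the holomorphic \<open>H\<close>, and H(0) is
  the average of q(w) and its conjugate.\<close>

lemma poisson_formula:
  assumes w: "norm w < 1"
  shows "(LINT \<zeta>|arc_measure. Re (poly q \<zeta>) * poisson w \<zeta>) = Re (poly q w)"
proof -
  define K where "K \<zeta> = (1 + cnj w * \<zeta>) / (1 - cnj w * \<zeta>)" for \<zeta>
  have "[:-w, 1:] dvd (q - [:poly q w:])" by (simp add: poly_eq_0_iff_dvd[symmetric])
  then obtain s where s: "q - [:poly q w:] = [:-w, 1:] * s" by (elim dvdE)
  have qs: "poly q z = poly q w + (z - w) * poly s z" for z
    using arg_cong[OF s, of "\<lambda>p. poly p z"] by (simp add: algebra_simps)
  define H where "H \<zeta> = (poly q \<zeta> * K \<zeta> + poly s \<zeta> * (\<zeta> + w) + cnj (poly q w) * K \<zeta>) / 2" for \<zeta>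
  have ne: "1 - cnj w * \<zeta> \<noteq> 0" if "\<zeta> \<in> cball 0 1" for \<zeta>
  proof
    assume "1 - cnj w * \<zeta> = 0"
    then have "norm (cnj w * \<zeta>) = 1" by simp
    moreover have "norm (cnj w * \<zeta>) \<le> norm w * 1"
      unfolding norm_mult using that by (intro mult_mono) auto
    ultimately show False using w by simp
  qed
  have hol: "H holomorphic_on cball 0 1"
    unfolding H_def K_def by (intro holomorphic_intros ne) auto
  have "(LINT \<zeta>|arc_measure. Re (poly q \<zeta>) * poisson w \<zeta>) = (LINT \<zeta>|arc_measure. Re (H \<zeta>))"
  proof (rule Bochner_Integration.integral_cong[OF refl])
    fix \<zeta> assume "\<zeta> \<in> space arc_measure"
    then have \<zeta>: "norm \<zeta> = 1" by (simp add: space_arc_measure)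
    then have z: "\<zeta> - w \<noteq> 0" using w by auto
    have "poly q \<zeta> * cnj (K \<zeta>) = poly s \<zeta> * (\<zeta> + w) + poly q w * cnj (K \<zeta>)"
      unfolding qs[of \<zeta>] K_def poisson_eq_Re(2)[OF w \<zeta>] using z by (simp add: field_simps)
    then have "Re (poly q \<zeta> * cnj (K \<zeta>)) = Re (poly s \<zeta> * (\<zeta> + w)) + Re (poly q w * cnj (K \<zeta>))"
      by (simp only: plus_complex.sel(1))
    moreover have "Re (x * cnj y) = Re (cnj x * y)" "Re x * Re y = (Re (x * y) + Re (x * cnj y)) / 2" for x y
      by simp_all
    ultimately have "Re (poly q \<zeta>) * Re (K \<zeta>) =
        (Re (poly q \<zeta> * K \<zeta>) + (Re (poly s \<zeta> * (\<zeta> + w)) + Re (cnj (poly q w) * K \<zeta>))) / 2"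
      by (simp only:)
    also have "\<dots> = Re (H \<zeta>)"
      by (simp only: H_def Re_divide_numeral plus_complex.sel(1) add.assoc)
    finally show "Re (poly q \<zeta>) * poisson w \<zeta> = Re (H \<zeta>)"
      unfolding poisson_eq_Re(1)[OF w \<zeta>, folded K_def] .
  qed
  also have "\<dots> = Re (H 0)" by (rule arc_mean_value_Re[OF hol])
  also have "\<dots> = Re (poly q w)"
    using qs[of 0] by (simp add: H_def K_def algebra_simps)
  finally show ?thesis .
qed

lemma continuous_on_poisson:
  assumes "norm w < 1"
  shows "continuous_on (sphere 0 1) (poisson w)"
  unfolding poisson_def[abs_def] using assms by (intro continuous_intros) auto

lemma poisson_borel: "(\<lambda>p. poisson (fst p) (snd p)) \<in> borel_measurable (borel \<Otimes>\<^sub>M borel)"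
  unfolding poisson_def by measurable

definition balayage :: "complex measure \<Rightarrow> complex \<Rightarrow> ennreal" where
  "balayage \<nu> \<zeta> = (\<integral>\<^sup>+w. ennreal (poisson w \<zeta>) \<partial>\<nu>)"

context
  fixes \<nu> :: "complex measure"
  assumes sets_nu: "sets \<nu> = sets (restrict_space borel disk)" and fin_nu: "finite_measure \<nu>"
begin

lemma space_nu: "space \<nu> = disk"
  using sets_eq_imp_space_eq[OF sets_nu] by (simp add: space_restrict_space)

lemma poisson_pair_measurable:
  "(\<lambda>p. poisson (fst p) (snd p)) \<in> borel_measurable (\<nu> \<Otimes>\<^sub>M arc_measure)"
proof (rule measurable_compose[OF _ poisson_borel, of "\<lambda>p. (fst p, snd p)", simplified])
  have "(\<lambda>z. z) \<in> borel_measurable \<nu>" "(\<lambda>z. z) \<in> borel_measurable arc_measure"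
    by (rule borel_measurable_disk[OF sets_nu], simp) (rule borel_measurable_arcI, simp)
  then show "(\<lambda>x. x) \<in> \<nu> \<Otimes>\<^sub>M arc_measure \<rightarrow>\<^sub>M borel \<Otimes>\<^sub>M borel"
    using measurable_compose[OF measurable_fst] measurable_compose[OF measurable_snd]
    by (intro measurable_pair[of "\<lambda>x. x"]) (auto simp: comp_def)
qed

lemma balayage_measurable: "balayage \<nu> \<in> borel_measurable arc_measure"
proof -
  interpret finite_measure \<nu> by (rule fin_nu)
  have "(\<lambda>p. ennreal (poisson (snd p) (fst p))) \<in> borel_measurable (arc_measure \<Otimes>\<^sub>M \<nu>)"
    using measurable_compose[OF measurable_pair_swap'[of arc_measure \<nu>] poisson_pair_measurable]
    by (intro measurable_compose[OF _ measurable_ennreal]) (simp add: case_prod_beta')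
  then have "(\<lambda>(\<zeta>, w). ennreal (poisson w \<zeta>)) \<in> borel_measurable (arc_measure \<Otimes>\<^sub>M \<nu>)"
    by (simp add: case_prod_beta')
  from borel_measurable_nn_integral[OF this]
  show ?thesis unfolding balayage_def[abs_def] .
qed

text \<open>Tonelli's theorem reduces the claim to the Poisson formula for each w. Positivity on the
  circle is assumed so that the exchange takes place among non-negative functions even when the
  balayage is infinite at some points.\<close>

lemma nn_integral_balayage:
  assumes q: "\<And>\<zeta>. norm \<zeta> = 1 \<Longrightarrow> 0 \<le> Re (poly q \<zeta>)"
  shows "(\<integral>\<^sup>+\<zeta>. ennreal (Re (poly q \<zeta>)) * balayage \<nu> \<zeta> \<partial>arc_measure) =
    (\<integral>\<^sup>+w. ennreal (Re (poly q w)) \<partial>\<nu>)"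
proof -
  interpret finite_measure \<nu> by (rule fin_nu)
  interpret pair_sigma_finite arc_measure \<nu> ..
  have c: "continuous_on UNIV (\<lambda>z. Re (poly q z))" by (intro continuous_intros)
  have qm: "(\<lambda>\<zeta>. ennreal (Re (poly q \<zeta>))) \<in> borel_measurable arc_measure"
    by (rule measurable_compose[OF borel_measurable_arcI[OF borel_measurable_continuous_onI[OF c]] measurable_ennreal])
  have pm: "(\<lambda>p. ennreal (poisson (snd p) (fst p))) \<in> borel_measurable (arc_measure \<Otimes>\<^sub>M \<nu>)"
    using measurable_compose[OF measurable_pair_swap'[of arc_measure \<nu>] poisson_pair_measurable]
    by (intro measurable_compose[OF _ measurable_ennreal]) (simp add: case_prod_beta')
  have pm1: "(\<lambda>w. ennreal (poisson w \<zeta>)) \<in> borel_measurable \<nu>" if "\<zeta> \<in> space arc_measure" for \<zeta>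
    using measurable_compose[OF measurable_Pair1'[OF that] pm] by simp
  have "(\<integral>\<^sup>+\<zeta>. ennreal (Re (poly q \<zeta>)) * balayage \<nu> \<zeta> \<partial>arc_measure) =
     (\<integral>\<^sup>+\<zeta>. (\<integral>\<^sup>+w. ennreal (Re (poly q \<zeta>)) * ennreal (poisson w \<zeta>) \<partial>\<nu>) \<partial>arc_measure)"
    unfolding balayage_def by (intro nn_integral_cong nn_integral_cmult[symmetric] pm1)
  also have "\<dots> = (\<integral>\<^sup>+w. (\<integral>\<^sup>+\<zeta>. ennreal (Re (poly q \<zeta>)) * ennreal (poisson w \<zeta>) \<partial>arc_measure) \<partial>\<nu>)"
    using measurable_compose[OF measurable_fst qm] pm
    by (intro Fubini'[symmetric]) (auto simp: case_prod_beta' intro!: borel_measurable_times_ennreal)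
  also have "\<dots> = (\<integral>\<^sup>+w. ennreal (Re (poly q w)) \<partial>\<nu>)"
  proof (rule nn_integral_cong)
    fix w assume "w \<in> space \<nu>"
    then have w: "norm w < 1" by (simp add: space_nu)
    have "(\<integral>\<^sup>+\<zeta>. ennreal (Re (poly q \<zeta>)) * ennreal (poisson w \<zeta>) \<partial>arc_measure) =
      (\<integral>\<^sup>+\<zeta>. ennreal (Re (poly q \<zeta>) * poisson w \<zeta>) \<partial>arc_measure)"
      using q poisson_pos[OF w] by (intro nn_integral_cong) (auto simp: space_arc_measure ennreal_mult less_imp_le)
    also have "\<dots> = ennreal (LINT \<zeta>|arc_measure. Re (poly q \<zeta>) * poisson w \<zeta>)"
      using q poisson_pos[OF w]
      by (intro nn_integral_eq_integral integrable_arc_continuous continuous_on_mult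
          continuous_on_poisson w continuous_on_subset[OF c] AE_I2) (auto simp: space_arc_measure less_imp_le)
    finally show "(\<integral>\<^sup>+\<zeta>. ennreal (Re (poly q \<zeta>)) * ennreal (poisson w \<zeta>) \<partial>arc_measure) = ennreal (Re (poly q w))"
      by (simp add: poisson_formula[OF w])
  qed
  finally show ?thesis .
qed

lemma balayage_lsc: "lsc_on (sphere 0 1) (\<lambda>\<zeta>. enn2ereal (balayage \<nu> \<zeta>))"
  unfolding lsc_on_def le_Liminf_iff
proof (intro ballI allI impI)
  fix x y assume x: "x \<in> sphere 0 (1::real)" and y: "y < enn2ereal (balayage \<nu> x)"
  show "eventually (\<lambda>\<zeta>. y < enn2ereal (balayage \<nu> \<zeta>)) (at x within sphere 0 1)"
  proof (rule sequentially_imp_eventually_within, intro allI impI)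
    fix f :: "nat \<Rightarrow> complex"
    assume f: "(\<forall>n. f n \<in> sphere 0 1 \<and> f n \<noteq> x) \<and> f \<longlonglongrightarrow> x"
    have pm1: "(\<lambda>w. ennreal (poisson w \<zeta>)) \<in> borel_measurable \<nu>" for \<zeta>
      by (rule borel_measurable_disk[OF sets_nu]) (simp add: poisson_def)
    have "balayage \<nu> x = (\<integral>\<^sup>+w. liminf (\<lambda>n. ennreal (poisson w (f n))) \<partial>\<nu>)"
      unfolding balayage_def
    proof (rule nn_integral_cong)
      fix w assume "w \<in> space \<nu>"
      then have "(\<lambda>n. poisson w (f n)) \<longlonglongrightarrow> poisson w x"
        using continuous_on_tendsto_compose[OF continuous_on_poisson, of w f x sequentially] f x
        by (simp add: space_nu)
      then have "(\<lambda>n. ennreal (poisson w (f n))) \<longlonglongrightarrow> ennreal (poisson w x)" by (rule tendsto_ennrealI)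
      then show "ennreal (poisson w x) = liminf (\<lambda>n. ennreal (poisson w (f n)))"
        using lim_imp_Liminf[of sequentially] by force
    qed
    also have "\<dots> \<le> liminf (\<lambda>n. balayage \<nu> (f n))"
      unfolding balayage_def by (rule nn_integral_liminf[OF pm1])
    finally have le: "balayage \<nu> x \<le> liminf (\<lambda>n. balayage \<nu> (f n))" .
    show "eventually (\<lambda>n. y < enn2ereal (balayage \<nu> (f n))) sequentially"
    proof (cases "y < 0")
      case True
      then show ?thesis by (intro always_eventually allI) (rule less_le_trans, auto)
    next
      case False
      then have "e2ennreal y < balayage \<nu> x"
        using y by (simp add: less_ennreal.rep_eq enn2ereal_e2ennreal not_less)
      then have "e2ennreal y < liminf (\<lambda>n. balayage \<nu> (f n))" using le by (rule less_le_trans)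
      from less_LiminfD[OF this] show ?thesis
        by eventually_elim (use False in \<open>simp add: less_ennreal.rep_eq enn2ereal_e2ennreal not_less\<close>)
    qed
  qed
qed

lemma balayage_lower_bound:
  assumes "emeasure \<nu> disk = 1"
  obtains c :: real where "0 < c" "\<And>\<zeta>. norm \<zeta> = 1 \<Longrightarrow> ereal c \<le> enn2ereal (balayage \<nu> \<zeta>)"
proof -
  interpret finite_measure \<nu> by (rule fin_nu)
  define k where "k w = (1 - norm w) / (1 + norm w)" for w :: complex
  have kc: "continuous_on UNIV k"
  proof -
    have "1 + norm w \<noteq> 0" for w :: complex using norm_ge_zero[of w] by linarith
    then show ?thesis unfolding k_def[abs_def] by (intro continuous_intros) auto
  qed
  have km: "k \<in> borel_measurable \<nu>" by (rule borel_measurable_disk[OF sets_nu borel_measurable_continuous_onI[OF kc]])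
  have k01: "0 < k w \<and> k w \<le> 1" if "w \<in> space \<nu>" for w
    using that by (auto simp: k_def space_nu divide_simps add_pos_nonneg)
  define c where "c = (LINT w|\<nu>. k w)"
  have ki: "integrable \<nu> k"
    by (rule integrable_const_bound[of _ 1, OF AE_I2 km]) (use k01 in force)
  have ck: "(\<integral>\<^sup>+w. ennreal (k w) \<partial>\<nu>) = ennreal c"
    unfolding c_def by (rule nn_integral_eq_integral[OF ki]) (use k01 in \<open>auto simp: less_imp_le\<close>)
  have "c \<noteq> 0"
  proof
    assume "c = 0"
    then have "AE w in \<nu>. ennreal (k w) = 0"
      using ck nn_integral_0_iff_AE[of "\<lambda>w. ennreal (k w)" \<nu>] km by simp
    then have "AE w in \<nu>. False"
      by (rule AE_mp) (use k01 in \<open>force intro!: AE_I2\<close>)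
    then have "space \<nu> \<in> null_sets \<nu>"
      using AE_iff_null[of \<nu> "\<lambda>_. False"] sets.top[of \<nu>] by simp
    then have "emeasure \<nu> (space \<nu>) = 0" by (simp add: null_sets_def)
    then show False using assms unfolding space_nu by simp
  qed
  moreover have "0 \<le> c" unfolding c_def using k01 by (intro integral_nonneg_AE AE_I2) (auto simp: less_imp_le)
  ultimately have "0 < c" by simp
  moreover have "ereal c \<le> enn2ereal (balayage \<nu> \<zeta>)" if "norm \<zeta> = 1" for \<zeta>
  proof -
    have "ennreal c \<le> balayage \<nu> \<zeta>"
      unfolding ck[symmetric] balayage_def k_def using that
      by (intro nn_integral_mono ennreal_leI poisson_ge) (auto simp: space_nu)
    then show ?thesis using \<open>0 < c\<close> by (simp add: less_eq_ennreal.rep_eq)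
  qed
  ultimately show thesis by (rule that)
qed

end

section \<open>The boundary measure is the balayage of the Laplacian\<close>

lemma boundary_measure_harmonic:
  assumes u: "continuous_on disk u" and neg: "\<And>z. z \<in> disk \<Longrightarrow> u z < 0"
    and lim: "(u \<longlongrightarrow> 0) (filtercomap norm (at_left 1))"
    and \<nu>: "has_laplacian_on disk u \<nu>" and fin: "finite_measure \<nu>"
    and M: "\<And>r. r < 0 \<Longrightarrow> level_measure u r (M r)"
  shows "((\<lambda>r. LINT z|M r. Re (poly q z)) \<longlongrightarrow> (LINT z|\<nu>. Re (poly q z))) (at_left 0)"
proof -
  define f where "f = (\<lambda>z. Re (poly q z))"
  have s\<nu>: "sets \<nu> = sets (restrict_space borel disk)" and sp: "space \<nu> = disk"
    using has_laplacian_on_space[OF \<nu>] by auto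
  have fi: "integrable \<nu> f"
    unfolding f_def by (rule finite_measure_disk_tendsto[OF fin s\<nu>]) (intro continuous_intros)
  have "((\<lambda>r. LINT z|\<nu>. f z * indicator {z \<in> disk. u z < ereal r} z) \<longlongrightarrow> (LINT z|\<nu>. f z)) (at_left 0)"
  proof (rule tendsto_at_left_sequentially[of "-1"])
    fix S :: "nat \<Rightarrow> real" assume S: "\<And>n. S n < 0" "S \<longlonglongrightarrow> 0"
    have Bs: "{z \<in> disk. u z < ereal r} \<in> sets \<nu>" for r
      unfolding s\<nu> using open_sublevel[OF u, of r] by (auto simp: sets_restrict_space_iff)
    show "(\<lambda>n. LINT z|\<nu>. f z * indicator {z \<in> disk. u z < ereal (S n)} z) \<longlonglongrightarrow> (LINT z|\<nu>. f z)"
    proof (rule integral_dominated_convergence[where w="\<lambda>z. \<bar>f z\<bar>"])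
      show "(\<lambda>z. f z * indicator {z \<in> disk. u z < ereal (S n)} z) \<in> borel_measurable \<nu>" for n
        by (intro borel_measurable_times borel_measurable_integrable[OF fi] borel_measurable_indicator Bs)
      show "AE z in \<nu>. (\<lambda>n. f z * indicator {z \<in> disk. u z < ereal (S n)} z) \<longlonglongrightarrow> f z"
      proof (rule AE_I2)
        fix z assume "z \<in> space \<nu>"
        then have z: "z \<in> disk" "u z < 0" using sp neg by auto
        have "(\<lambda>n. ereal (S n)) \<longlonglongrightarrow> ereal 0" using S(2) by simp
        then have "eventually (\<lambda>n. u z < ereal (S n)) sequentially"
          using z(2) by (intro order_tendstoD(1)) (auto simp: zero_ereal_def)
        then have "eventually (\<lambda>n. f z * indicator {z \<in> disk. u z < ereal (S n)} z = f z) sequentially"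
          by eventually_elim (use z in simp)
        then show "(\<lambda>n. f z * indicator {z \<in> disk. u z < ereal (S n)} z) \<longlonglongrightarrow> f z" by (rule tendsto_eventually)
      qed
      show "AE z in \<nu>. norm (f z * indicator {z \<in> disk. u z < ereal (S n)} z) \<le> \<bar>f z\<bar>" for n
        by (intro AE_I2) (simp add: abs_mult indicator_def)
    qed (use fi in auto)
  qed simp
  moreover have "eventually (\<lambda>r. (LINT z|M r. f z) = (LINT z|\<nu>. f z * indicator {z \<in> disk. u z < ereal r} z)) (at_left 0)"
    using level_measure_harmonic(2)[OF u lim \<nu> fin _ M] unfolding f_def
    by (auto simp: eventually_at_filter intro!: always_eventually)
  ultimately show ?thesis unfolding f_def[symmetric] using tendsto_cong by fastforce
qed

text \<open>Both sides are finite measures on the circle with the same harmonic moments, and traces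
  of harmonic polynomials are uniformly dense there. Their moments are first compared for
  polynomials that are non-negative on the circle, where extended integrals suffice.\<close>

lemma measure_eq_balayage:
  assumes s\<nu>: "sets \<nu> = sets (restrict_space borel disk)" and fin: "finite_measure \<nu>"
    and s\<mu>: "sets \<mu> = sets (restrict_space borel (cball 0 1))" and fin\<mu>: "finite_measure \<mu>"
    and \<mu>0: "emeasure \<mu> disk = 0"
    and eq: "\<And>q. (LINT z|\<mu>. Re (poly q z)) = (LINT z|\<nu>. Re (poly q z))"
    and A: "A \<in> sets arc_measure"
  shows "emeasure \<mu> A = (\<integral>\<^sup>+\<zeta>. balayage \<nu> \<zeta> * indicator A \<zeta> \<partial>arc_measure)"
proof -
  interpret \<mu>: finite_measure \<mu> by fact
  interpret \<nu>: finite_measure \<nu> by fact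
  have sp\<mu>: "space \<mu> = cball 0 1" using sets_eq_imp_space_eq[OF s\<mu>] by (simp add: space_restrict_space)
  have sp\<nu>: "space \<nu> = disk" using sets_eq_imp_space_eq[OF s\<nu>] by (simp add: space_restrict_space)
  note bm = balayage_measurable[OF s\<nu> fin]
  define M where "M = distr \<mu> borel (\<lambda>z::complex. z)"
  define N where "N = distr (density arc_measure (balayage \<nu>)) borel (\<lambda>z::complex. z)"
  have id\<mu>: "(\<lambda>z. z) \<in> borel_measurable \<mu>"
    by (simp add: measurable_cong_sets[OF s\<mu> refl] measurable_restrict_space1)
  have ida: "(\<lambda>z. z) \<in> borel_measurable (density arc_measure (balayage \<nu>))"
    using borel_measurable_arcI[of "\<lambda>z. z"] by simp
  have ae\<mu>: "AE z in \<mu>. z \<in> sphere 0 1"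
  proof (rule AE_I'[of disk])
    have "disk \<in> sets \<mu>" unfolding s\<mu> by (auto simp: sets_restrict_space_iff)
    then show "disk \<in> null_sets \<mu>" using \<mu>0 by (simp add: null_sets_def)
    show "{z \<in> space \<mu>. z \<notin> sphere 0 1} \<subseteq> disk" by (auto simp: sp\<mu>)
  qed
  have nn: "(\<integral>\<^sup>+z. ennreal (Re (poly q z)) \<partial>N) = (\<integral>\<^sup>+z. ennreal (Re (poly q z)) \<partial>M)"
    if q: "\<And>\<zeta>. norm \<zeta> = 1 \<Longrightarrow> 0 \<le> Re (poly q \<zeta>)" for q
  proof -
    have c: "continuous_on UNIV (\<lambda>z. Re (poly q z))" by (intro continuous_intros)
    then have m: "(\<lambda>z. Re (poly q z)) \<in> borel_measurable borel" by (rule borel_measurable_continuous_onI)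
    have pos: "0 \<le> Re (poly q w)" if "w \<in> disk" for w
    proof -
      have w: "norm w < 1" using that by simp
      show ?thesis
        unfolding poisson_formula[OF w, symmetric] using q poisson_pos[OF w]
        by (intro integral_nonneg_AE AE_I2) (auto simp: space_arc_measure less_imp_le)
    qed
    have "(\<integral>\<^sup>+z. ennreal (Re (poly q z)) \<partial>N) = (\<integral>\<^sup>+\<zeta>. ennreal (Re (poly q \<zeta>)) * balayage \<nu> \<zeta> \<partial>arc_measure)"
      unfolding N_def using m bm
      by (simp add: nn_integral_distr[OF ida] nn_integral_density borel_measurable_arcI mult.commute)
    also have "\<dots> = (\<integral>\<^sup>+w. ennreal (Re (poly q w)) \<partial>\<nu>)" by (rule nn_integral_balayage[OF s\<nu> fin q])
    also have "\<dots> = ennreal (LINT w|\<nu>. Re (poly q w))"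
      using finite_measure_disk_tendsto(2)[OF fin s\<nu> c] pos
      by (intro nn_integral_eq_integral) (auto simp: sp\<nu>)
    also have "\<dots> = ennreal (LINT z|\<mu>. Re (poly q z))" by (simp only: eq)
    also have "\<dots> = (\<integral>\<^sup>+z. ennreal (Re (poly q z)) \<partial>\<mu>)"
    proof (rule nn_integral_eq_integral[symmetric])
      have "bounded ((\<lambda>z. Re (poly q z)) ` cball 0 1)"
        by (intro compact_imp_bounded compact_continuous_image continuous_on_subset[OF c]) auto
      then obtain C where C: "\<forall>z\<in>cball 0 1. \<bar>Re (poly q z)\<bar> \<le> C" unfolding bounded_iff by auto
      show "integrable \<mu> (\<lambda>z. Re (poly q z))"
        by (rule \<mu>.integrable_const_bound[of _ C])
           (use C measurable_compose[OF id\<mu> m] in \<open>auto simp: sp\<mu>\<close>)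
      show "AE z in \<mu>. 0 \<le> Re (poly q z)" using ae\<mu> by eventually_elim (use q in auto)
    qed
    also have "\<dots> = (\<integral>\<^sup>+z. ennreal (Re (poly q z)) \<partial>M)"
      unfolding M_def using m by (simp add: nn_integral_distr[OF id\<mu>])
    finally show ?thesis .
  qed
  have finM: "finite_measure M"
    unfolding M_def by (rule \<mu>.finite_measure_distr[OF id\<mu>])
  have mass: "emeasure N UNIV = emeasure M UNIV"
    using nn[of 1] by (simp add: N_def M_def)
  have finN: "finite_measure N"
    by (rule finite_measureI) (use mass finite_measure.emeasure_finite[OF finM, of UNIV] in \<open>simp add: N_def\<close>)
  have "AE \<zeta> in density arc_measure (balayage \<nu>). \<zeta> \<in> sphere 0 1"
    by (rule AE_I2) (simp add: space_arc_measure)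
  then have aeN: "AE z in N. z \<in> sphere 0 1" unfolding N_def by (subst AE_distr_iff[OF ida]) auto
  have aeM: "AE z in M. z \<in> sphere 0 1" unfolding M_def using ae\<mu> by (subst AE_distr_iff[OF id\<mu>]) auto
  have sM: "sets M = sets borel" and sN: "sets N = sets borel" by (auto simp: M_def N_def)
  have "M = N"
  proof (rule finite_measures_eqI[OF finM finN sM sN compact_sphere aeM aeN])
    fix f :: "complex \<Rightarrow> real" and e :: real assume f: "continuous_on UNIV f" and e: "0 < e"
    obtain q where q: "\<And>\<zeta>. norm \<zeta> = 1 \<Longrightarrow> \<bar>f \<zeta> - Re (poly q \<zeta>)\<bar> < e"
      by (rule circle_approximation[OF continuous_on_subset[OF f subset_UNIV] e]) (rule that)
    have c: "continuous_on UNIV (\<lambda>z. Re (poly p z))" for p by (intro continuous_intros)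
    have "bounded ((\<lambda>z. Re (poly q z)) ` sphere 0 1)"
      by (intro compact_imp_bounded compact_continuous_image continuous_on_subset[OF c]) auto
    then obtain C where C: "\<forall>z\<in>sphere 0 1. \<bar>Re (poly q z)\<bar> \<le> C" unfolding bounded_iff by auto
    \<comment> \<open>Adding the constant \<open>C\<close> makes the polynomial non-negative on the
      circle. The total masses agree, so the contribution of the constant can be removed
      again.\<close>
    define p where "p = q + [:of_real C:]"
    have pq: "Re (poly p z) = Re (poly q z) + C" for z by (simp add: p_def)
    have pos: "0 \<le> Re (poly p \<zeta>)" if "norm \<zeta> = 1" for \<zeta>
      using C[rule_format, of \<zeta>] that unfolding pq by auto
    have "(LINT z|L. Re (poly p z)) = enn2real (\<integral>\<^sup>+z. ennreal (Re (poly p z)) \<partial>L)"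
      if "sets L = sets borel" "AE z in L. z \<in> sphere 0 1" for L
    proof (rule integral_eq_nn_integral)
      show "(\<lambda>z. Re (poly p z)) \<in> borel_measurable L"
        by (rule borel_measurable_cong_borel[OF that(1) borel_measurable_continuous_onI[OF c]])
      show "AE z in L. 0 \<le> Re (poly p z)" using that(2) by eventually_elim (use pos in auto)
    qed
    then have "(LINT z|M. Re (poly p z)) = (LINT z|N. Re (poly p z))"
      using nn[OF pos] sM sN aeM aeN by simp
    moreover have "(LINT z|L. Re (poly p z)) = (LINT z|L. Re (poly q z)) + C * measure L UNIV"
      if L: "finite_measure L" "sets L = sets borel" "AE z in L. z \<in> sphere 0 1" for L
    proof -
      interpret finite_measure L by fact
      show ?thesis
        unfolding pq using integrable_continuous_finite_measure[OF L(1,2) compact_sphere L(3) c[of q]]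
          sets_eq_imp_space_eq[OF L(2)] by simp
    qed
    ultimately have "(LINT z|M. Re (poly q z)) = (LINT z|N. Re (poly q z))"
      using finM finN sM sN aeM aeN mass by (simp add: measure_def)
    then show "\<exists>g. continuous_on UNIV g \<and> (\<forall>z\<in>sphere 0 1. \<bar>f z - g z\<bar> \<le> e) \<and> (LINT z|M. g z) = (LINT z|N. g z)"
      using c q by (intro exI[of _ "\<lambda>z. Re (poly q z)"]) (auto intro: less_imp_le)
  qed
  moreover have A': "A \<in> sets borel" "A \<subseteq> sphere 0 1"
    using A unfolding sets_arc_measure by (auto simp: sets_restrict_space_iff)
  moreover have "A \<in> sets \<mu>" unfolding s\<mu> using A' by (auto simp: sets_restrict_space_iff)
  then have "emeasure M A = emeasure \<mu> A"
    unfolding M_def using A' sets.sets_into_space[of A \<mu>] by (simp add: emeasure_distr[OF id\<mu>] Int_absorb2)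
  moreover have "emeasure N A = (\<integral>\<^sup>+\<zeta>. balayage \<nu> \<zeta> * indicator A \<zeta> \<partial>arc_measure)"
    unfolding N_def using A A' bm by (simp add: emeasure_distr[OF ida] space_arc_measure Int_absorb2 emeasure_density)
  ultimately show ?thesis by simp
qed

text \<open>A priori \<alpha> has any sign, and the convention \<infinity> - \<infinity> =
  \<infinity> could hide a negative part. The negative part is therefore shown to vanish almost
  everywhere before the positive part is compared with \<open>b\<close>. Borel versions
  \<open>p\<close> and \<open>n\<close> of both parts allow working with
  \<open>arc_measure\<close>.\<close>

lemma circle_density_unique:
  fixes \<alpha> :: "complex \<Rightarrow> ereal" and b :: "complex \<Rightarrow> ennreal"
  assumes \<alpha>: "\<alpha> \<in> borel_measurable circle_measure" and b: "b \<in> borel_measurable arc_measure"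
    and eq: "\<And>A. A \<in> sets arc_measure \<Longrightarrow> ereal_integral circle_measure (\<lambda>\<zeta>. indicator A \<zeta> * \<alpha> \<zeta>) =
      enn2ereal (\<integral>\<^sup>+\<zeta>. b \<zeta> * indicator A \<zeta> \<partial>arc_measure)"
  shows "AE \<zeta> in circle_measure. \<alpha> \<zeta> = enn2ereal (b \<zeta>)"
proof -
  have m: "(\<lambda>\<zeta>. e2ennreal (\<alpha> \<zeta>)) \<in> borel_measurable (completion arc_measure)"
    "(\<lambda>\<zeta>. e2ennreal (- \<alpha> \<zeta>)) \<in> borel_measurable (completion arc_measure)"
    using \<alpha> unfolding circle_measure_eq by measurable
  obtain p where p: "p \<in> borel_measurable arc_measure" "AE \<zeta> in arc_measure. e2ennreal (\<alpha> \<zeta>) = p \<zeta>"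
    using completion_ex_borel_measurable[OF m(1)] by (elim bexE) (rule that)
  obtain n where n: "n \<in> borel_measurable arc_measure" "AE \<zeta> in arc_measure. e2ennreal (- \<alpha> \<zeta>) = n \<zeta>"
    using completion_ex_borel_measurable[OF m(2)] by (elim bexE) (rule that)
  have e: "ereal_integral circle_measure (\<lambda>\<zeta>. indicator A \<zeta> * \<alpha> \<zeta>) =
      enn2ereal (\<integral>\<^sup>+\<zeta>. p \<zeta> * indicator A \<zeta> \<partial>arc_measure) - enn2ereal (\<integral>\<^sup>+\<zeta>. n \<zeta> * indicator A \<zeta> \<partial>arc_measure)" for A
  proof -
    have "(\<integral>\<^sup>+\<zeta>. e2ennreal (indicator A \<zeta> * \<alpha> \<zeta>) \<partial>arc_measure) = (\<integral>\<^sup>+\<zeta>. p \<zeta> * indicator A \<zeta> \<partial>arc_measure)"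
      using p(2) by (intro nn_integral_cong_AE, eventually_elim) (auto simp: e2ennreal_neg split: split_indicator)
    moreover have "(\<integral>\<^sup>+\<zeta>. e2ennreal (- (indicator A \<zeta> * \<alpha> \<zeta>)) \<partial>arc_measure) = (\<integral>\<^sup>+\<zeta>. n \<zeta> * indicator A \<zeta> \<partial>arc_measure)"
      using n(2) by (intro nn_integral_cong_AE, eventually_elim) (auto simp: e2ennreal_neg split: split_indicator)
    ultimately show ?thesis
      unfolding ereal_integral_def circle_measure_eq nn_integral_completion by simp
  qed
  \<comment> \<open>On \<open>A0\<close> the positive part vanishes almost everywhere, so no
    \<infinity> - \<infinity> arises: the integral of \<alpha> over \<open>A0\<close> is minus that
    of \<open>n\<close>, yet it equals a non-negative number.\<close>
  define A0 where "A0 = {\<zeta> \<in> space arc_measure. 0 < n \<zeta>}"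
  have A0: "A0 \<in> sets arc_measure" unfolding A0_def using n(1) by measurable
  have "(\<integral>\<^sup>+\<zeta>. p \<zeta> * indicator A0 \<zeta> \<partial>arc_measure) = (\<integral>\<^sup>+\<zeta>. 0 \<partial>arc_measure)"
  proof (rule nn_integral_cong_AE)
    show "AE \<zeta> in arc_measure. p \<zeta> * indicator A0 \<zeta> = 0"
      using p(2) n(2)
    proof eventually_elim
      case (elim \<zeta>)
      show ?case
      proof (cases "\<zeta> \<in> A0")
        case True
        then have pos: "0 < e2ennreal (- \<alpha> \<zeta>)" using elim by (simp add: A0_def)
        have "\<alpha> \<zeta> \<le> 0"
        proof (rule ccontr)
          assume "\<not> \<alpha> \<zeta> \<le> 0"
          then have "- \<alpha> \<zeta> \<le> 0" by (simp add: not_le less_imp_le)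
          then have "e2ennreal (- \<alpha> \<zeta>) = 0" by (rule e2ennreal_neg)
          then show False using pos by simp
        qed
        then have "e2ennreal (\<alpha> \<zeta>) = 0" by (rule e2ennreal_neg)
        then show ?thesis using elim by simp
      qed simp
    qed
  qed
  then have "enn2ereal (\<integral>\<^sup>+\<zeta>. b \<zeta> * indicator A0 \<zeta> \<partial>arc_measure) = - enn2ereal (\<integral>\<^sup>+\<zeta>. n \<zeta> * indicator A0 \<zeta> \<partial>arc_measure)"
    using e[of A0] eq[OF A0] by (simp add: zero_ennreal.rep_eq)
  moreover have "0 \<le> enn2ereal (\<integral>\<^sup>+\<zeta>. b \<zeta> * indicator A0 \<zeta> \<partial>arc_measure)" by simp
  ultimately have "enn2ereal (\<integral>\<^sup>+\<zeta>. n \<zeta> * indicator A0 \<zeta> \<partial>arc_measure) \<le> 0" by simp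
  then have "(\<integral>\<^sup>+\<zeta>. n \<zeta> * indicator A0 \<zeta> \<partial>arc_measure) = 0"
    by (simp add: less_eq_ennreal.rep_eq[symmetric] zero_ennreal.rep_eq[symmetric])
  then have "AE \<zeta> in arc_measure. n \<zeta> * indicator A0 \<zeta> = 0"
    using n(1) A0 by (subst (asm) nn_integral_0_iff_AE) auto
  then have n0: "AE \<zeta> in arc_measure. n \<zeta> = 0"
    by (rule AE_mp) (auto simp: A0_def indicator_def not_gr_zero intro!: AE_I2 split: if_splits)
  have "(\<integral>\<^sup>+\<zeta>. p \<zeta> * indicator A \<zeta> \<partial>arc_measure) = (\<integral>\<^sup>+\<zeta>. b \<zeta> * indicator A \<zeta> \<partial>arc_measure)"
    if A: "A \<in> sets arc_measure" for A
  proof -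
    have "(\<integral>\<^sup>+\<zeta>. n \<zeta> * indicator A \<zeta> \<partial>arc_measure) = (\<integral>\<^sup>+\<zeta>. 0 \<partial>arc_measure)"
      using n0 by (intro nn_integral_cong_AE, eventually_elim) simp
    then show ?thesis
      using e[of A] eq[OF A] by (simp add: zero_ennreal.rep_eq enn2ereal_inject)
  qed
  then have "density arc_measure p = density arc_measure b"
    using p(1) b by (intro measure_eqI) (auto simp: emeasure_density)
  then have "AE \<zeta> in arc_measure. p \<zeta> = b \<zeta>"
    using arc.density_unique[OF p(1) b] by simp
  with p(2) n(2) n0 have "AE \<zeta> in arc_measure. \<alpha> \<zeta> = enn2ereal (b \<zeta>)"
  proof eventually_elim
    case (elim \<zeta>)
    have "0 \<le> \<alpha> \<zeta>"
    proof (rule ccontr)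
      assume "\<not> 0 \<le> \<alpha> \<zeta>"
      then have "0 < - \<alpha> \<zeta>" by simp
      then have "enn2ereal (e2ennreal (- \<alpha> \<zeta>)) = - \<alpha> \<zeta>" by (intro enn2ereal_e2ennreal less_imp_le)
      then show False using elim \<open>0 < - \<alpha> \<zeta>\<close> by (simp add: zero_ennreal.rep_eq)
    qed
    then show ?case using elim enn2ereal_e2ennreal[of "\<alpha> \<zeta>"] by simp
  qed
  then show ?thesis unfolding circle_measure_eq by (rule AE_completion)
qed

lemma circle_density_of_exhaustion:
  assumes \<alpha>: "\<alpha> \<in> borel_measurable circle_measure" and u: "u \<in> exhaustion_functions_1"
    and \<mu>: "boundary_measure u \<mu>" and d: "is_circle_density \<alpha> \<mu>"
  shows "\<exists>\<beta>. (AE \<zeta> in circle_measure. \<alpha> \<zeta> = \<beta> \<zeta>) \<and>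
       lsc_on (sphere 0 1) \<beta> \<and>
       (\<exists>c::real. 0 < c \<and> (\<forall>\<theta>::real. ereal c \<le> \<beta> (cis \<theta>))) \<and>
       ereal_integral circle_measure \<beta> = 1"
proof -
  obtain \<nu> where \<nu>: "has_laplacian_on disk u \<nu>" "emeasure \<nu> disk = 1"
    and u': "continuous_on disk u" "\<And>z. z \<in> disk \<Longrightarrow> u z < 0" "(u \<longlongrightarrow> 0) (filtercomap norm (at_left 1))"
    using u unfolding exhaustion_functions_1_def exhaustion_functions_def by auto
  have s\<nu>: "sets \<nu> = sets (restrict_space borel disk)" and sp\<nu>: "space \<nu> = disk"
    using has_laplacian_on_space[OF \<nu>(1)] by auto
  have fin: "finite_measure \<nu>" by (rule finite_measureI) (simp add: sp\<nu> \<nu>(2))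
  obtain M where s\<mu>: "sets \<mu> = sets (restrict_space borel (cball 0 1))" and fin\<mu>: "finite_measure \<mu>"
    and M: "\<And>r. r < 0 \<Longrightarrow> level_measure u r (M r)"
    and conv: "\<And>f :: complex \<Rightarrow> real. continuous_on (cball 0 1) f \<Longrightarrow> ((\<lambda>r. LINT z|M r. f z) \<longlongrightarrow> (LINT z|\<mu>. f z)) (at_left 0)"
    using \<mu> unfolding boundary_measure_def by auto
  have eq: "(LINT z|\<mu>. Re (poly q z)) = (LINT z|\<nu>. Re (poly q z))" for q
    by (rule tendsto_unique[OF _ conv boundary_measure_harmonic[OF u' \<nu>(1) fin M]])
       (auto intro!: continuous_intros)
  \<comment> \<open>The circle measure does not charge the open disk, so being a density on the
    circle already forces the boundary measure to have no mass inside.\<close>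
  have \<mu>0: "emeasure \<mu> disk = 0"
  proof -
    have "disk \<in> sets \<mu>" unfolding s\<mu> by (auto simp: sets_restrict_space_iff)
    then have "enn2ereal (emeasure \<mu> disk) = ereal_integral circle_measure (\<lambda>\<zeta>. indicator disk \<zeta> * \<alpha> \<zeta>)"
      using d unfolding is_circle_density_def by simp
    also have "\<dots> = ereal_integral circle_measure (\<lambda>\<zeta>. 0)"
      unfolding ereal_integral_def circle_measure_eq nn_integral_completion
      by (intro arg_cong2[where f="(-)"] arg_cong[where f=enn2ereal] nn_integral_cong)
         (auto simp: space_arc_measure)
    also have "\<dots> = 0" by (simp add: ereal_integral_def zero_ennreal.abs_eq[symmetric] zero_ennreal.rep_eq)
    finally show ?thesis by (metis enn2ereal_inject zero_ennreal.rep_eq)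
  qed
  let ?b = "balayage \<nu>"
  have "AE \<zeta> in circle_measure. \<alpha> \<zeta> = enn2ereal (?b \<zeta>)"
  proof (rule circle_density_unique[OF \<alpha> balayage_measurable[OF s\<nu> fin]])
    fix A assume A: "A \<in> sets arc_measure"
    then have "A \<in> sets \<mu>" unfolding s\<mu> sets_arc_measure by (auto simp: sets_restrict_space_iff)
    then show "ereal_integral circle_measure (\<lambda>\<zeta>. indicator A \<zeta> * \<alpha> \<zeta>) = enn2ereal (\<integral>\<^sup>+\<zeta>. ?b \<zeta> * indicator A \<zeta> \<partial>arc_measure)"
      using d measure_eq_balayage[OF s\<nu> fin s\<mu> fin\<mu> \<mu>0 eq A] unfolding is_circle_density_def by simp
  qed
  moreover have "lsc_on (sphere 0 1) (\<lambda>\<zeta>. enn2ereal (?b \<zeta>))" by (rule balayage_lsc[OF s\<nu> fin])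
  moreover obtain c :: real where "0 < c" "\<And>\<zeta>. norm \<zeta> = 1 \<Longrightarrow> ereal c \<le> enn2ereal (?b \<zeta>)"
    by (rule balayage_lower_bound[OF s\<nu> fin \<nu>(2)]) (rule that)
  then have "\<exists>c::real. 0 < c \<and> (\<forall>\<theta>::real. ereal c \<le> enn2ereal (?b (cis \<theta>)))"
    by (intro exI[of _ c]) simp
  moreover have "ereal_integral circle_measure (\<lambda>\<zeta>. enn2ereal (?b \<zeta>)) = 1"
  proof -
    have "(\<integral>\<^sup>+\<zeta>. ?b \<zeta> \<partial>arc_measure) = 1"
      using nn_integral_balayage[OF s\<nu> fin, of 1] \<nu>(2) sp\<nu> by simp
    moreover have "e2ennreal (- enn2ereal x) = 0" for x by (rule e2ennreal_neg) simp
    ultimately show ?thesis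
      unfolding ereal_integral_def circle_measure_eq nn_integral_completion
      by (simp add: one_ennreal.rep_eq zero_ennreal.rep_eq)
  qed
  ultimately show ?thesis by (intro exI[of _ "\<lambda>\<zeta>. enn2ereal (?b \<zeta>)"] conjI)
qed

section \<open>Existence of level measures\<close>

text \<open>Serves to assemble the Laplacian of \<open>max u r\<close> from the level measure and
  the part of the Laplacian of u outside the sublevel set.\<close>

lemma sum_measure_exists:
  fixes M L :: "'a measure"
  assumes sets: "sets L = sets M"
  obtains N where "sets N = sets M" "\<And>A. A \<in> sets M \<Longrightarrow> emeasure N A = emeasure M A + emeasure L A"
proof -
  define N where "N = measure_of (space M) (sets M) (\<lambda>A. emeasure M A + emeasure L A)"
  have "emeasure N A = emeasure M A + emeasure L A" if "A \<in> sets M" for A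
    unfolding N_def
  proof (rule emeasure_measure_of_sigma[OF _ _ _ that])
    show "sigma_algebra (space M) (sets M)" by (rule sets.sigma_algebra_axioms)
    show "positive (sets M) (\<lambda>A. emeasure M A + emeasure L A)" by (simp add: positive_def)
    show "countably_additive (sets M) (\<lambda>A. emeasure M A + emeasure L A)"
    proof (rule countably_additiveI)
      fix A :: "nat \<Rightarrow> 'a set" assume A: "range A \<subseteq> sets M" "disjoint_family A"
      have "(\<Sum>i. emeasure M (A i) + emeasure L (A i)) = (\<Sum>i. emeasure M (A i)) + (\<Sum>i. emeasure L (A i))"
        by (rule suminf_add[symmetric]) auto
      then show "(\<Sum>i. emeasure M (A i) + emeasure L (A i)) = emeasure M (\<Union>i. A i) + emeasure L (\<Union>i. A i)"
        using A sets by (simp add: suminf_emeasure)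
    qed
  qed
  moreover have "sets N = sets M" by (simp add: N_def sets.sigma_sets_eq)
  ultimately show thesis using that by blast
qed

text \<open>A smoothing of \<open>max s r\<close> whose derivative tends to \<open>1\<close> for \<open>s \<ge> r\<close>, including \<open>s = r\<close>, and to
  \<open>0\<close> for \<open>s < r\<close>; hence the shift by \<open>K\<close>.\<close>

definition sigmoid :: "real \<Rightarrow> real" where "sigmoid x = exp x / (1 + exp x)"

definition soft_max :: "real \<Rightarrow> real \<Rightarrow> real \<Rightarrow> real" where
  "soft_max K r s = r + ln (1 + exp (K\<^sup>2 * (s - r) + K)) / K\<^sup>2"

lemma one_plus_exp_pos: "0 < 1 + exp (x::real)"
  by (simp add: add_pos_pos)

lemma sigmoid_bounds: "0 \<le> sigmoid x" "sigmoid x \<le> 1"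
  using one_plus_exp_pos[of x] by (auto simp: sigmoid_def divide_simps)

lemma sigmoid_deriv: "(sigmoid has_real_derivative sigmoid x * (1 - sigmoid x)) (at x)"
proof -
  have "1 + exp x \<noteq> 0" using one_plus_exp_pos[of x] by linarith
  then show ?thesis
    unfolding sigmoid_def[abs_def]
    by (auto intro!: derivative_eq_intros simp: field_simps power2_eq_square)
qed

lemma soft_max_deriv:
  assumes "K > 0"
  shows "(soft_max K r has_real_derivative sigmoid (K\<^sup>2 * (s - r) + K)) (at s)"
    and "((\<lambda>s. sigmoid (K\<^sup>2 * (s - r) + K)) has_real_derivative
      K\<^sup>2 * (sigmoid (K\<^sup>2 * (s - r) + K) * (1 - sigmoid (K\<^sup>2 * (s - r) + K)))) (at s)"
proof -
  have 1: "((\<lambda>s. K\<^sup>2 * (s - r) + K) has_real_derivative K\<^sup>2) (at s)"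
    by (auto intro!: derivative_eq_intros)
  have "((\<lambda>x. ln (1 + exp x)) has_real_derivative sigmoid x) (at x)" for x :: real
    unfolding sigmoid_def using one_plus_exp_pos[of x] by (auto intro!: derivative_eq_intros)
  from DERIV_add[OF DERIV_const[of r] DERIV_cdivide[OF DERIV_chain2[OF this 1], of "K\<^sup>2"]]
  show "(soft_max K r has_real_derivative sigmoid (K\<^sup>2 * (s - r) + K)) (at s)"
    unfolding soft_max_def[abs_def] using assms by simp
  show "((\<lambda>s. sigmoid (K\<^sup>2 * (s - r) + K)) has_real_derivative
      K\<^sup>2 * (sigmoid (K\<^sup>2 * (s - r) + K) * (1 - sigmoid (K\<^sup>2 * (s - r) + K)))) (at s)"
    using DERIV_chain2[OF sigmoid_deriv 1] by (simp add: mult_ac)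
qed

text \<open>The function ln (1 + exp x) is within 1 of the positive part of x, which contributes at
  most 1 / K after the scaling. The shift moves the kink from r to r - 1/K and contributes another 1
  / K.\<close>

lemma soft_max_close:
  assumes K: "1 \<le> K"
  shows "\<bar>soft_max K r s - max s r\<bar> \<le> 2 / K"
proof -
  define x where "x = K\<^sup>2 * (s - r) + K"
  have sp: "max x 0 \<le> ln (1 + exp x)" "ln (1 + exp x) \<le> max x 0 + 1"
  proof -
    have "ln (exp x) \<le> ln (1 + exp x)" by (rule ln_mono) (auto simp: one_plus_exp_pos)
    moreover have "0 \<le> ln (1 + exp x)" by (rule ln_ge_zero) simp
    ultimately show "max x 0 \<le> ln (1 + exp x)" by simp
    have "1 + exp x \<le> exp (max x 0) + exp (max x 0)" by (intro add_mono) auto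
    also have "\<dots> \<le> exp 1 * exp (max x 0)"
      using exp_ge_add_one_self[of 1] by (auto intro!: mult_right_mono)
    also have "\<dots> = exp (max x 0 + 1)" by (simp add: exp_add)
    finally have "ln (1 + exp x) \<le> ln (exp (max x 0 + 1))" by (intro ln_mono) (auto simp: one_plus_exp_pos)
    then show "ln (1 + exp x) \<le> max x 0 + 1" by simp
  qed
  have K2: "K\<^sup>2 > 0" "K\<^sup>2 \<ge> K" using K by (auto simp: power2_eq_square)
  define m where "m = max x 0 / K\<^sup>2"
  have "x = K\<^sup>2 * (s - r + 1 / K)" using K by (simp add: x_def power2_eq_square field_simps)
  then have "max x 0 = K\<^sup>2 * max (s - r + 1 / K) 0"
    using K2(1) by (auto simp: max_def mult_le_0_iff)
  then have m: "m = max (s - r + 1 / K) 0" using K2 by (simp add: m_def)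
  have "m \<le> ln (1 + exp x) / K\<^sup>2" unfolding m_def using sp(1) K2 by (intro divide_right_mono) auto
  moreover have "ln (1 + exp x) / K\<^sup>2 \<le> m + 1 / K"
  proof -
    have "ln (1 + exp x) / K\<^sup>2 \<le> (max x 0 + 1) / K\<^sup>2" using sp(2) K2 by (intro divide_right_mono) auto
    also have "\<dots> = m + 1 / K\<^sup>2" by (simp add: m_def add_divide_distrib)
    also have "1 / K\<^sup>2 \<le> 1 / K" using K K2 by (intro divide_left_mono) auto
    finally show ?thesis by simp
  qed
  moreover have "soft_max K r s = r + ln (1 + exp x) / K\<^sup>2" by (simp add: soft_max_def x_def)
  moreover have "0 < 1 / K" "2 / K = 1 / K + 1 / K" using K by auto
  moreover have "max y 0 \<le> max (y + d) 0 \<and> max (y + d) 0 \<le> max y 0 + d" if "0 < d" for y d :: real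
    using that by auto
  then have "max (s - r) 0 \<le> m \<and> m \<le> max (s - r) 0 + 1 / K" unfolding m using \<open>0 < 1 / K\<close> by blast
  moreover have "max s r = r + max (s - r) 0" by (simp add: max_def)
  ultimately show ?thesis by linarith
qed

lemma sigmoid_at_top: "(sigmoid \<longlongrightarrow> 1) at_top" and sigmoid_at_bot: "(sigmoid \<longlongrightarrow> 0) at_bot"
  unfolding sigmoid_def[abs_def] by real_asymp+

text \<open>Approximation from above is decisive at x = r: the argument of the sigmoid is then at
  least \<open>Suc k\<close>. For x < r the quadratic term eventually outweighs the linear shift and
  sends the argument to -\<infinity>.\<close>

lemma soft_max_deriv_tendsto:
  assumes X: "X \<longlonglongrightarrow> x" and ge: "\<And>k. x \<le> X k"
  shows "(\<lambda>k. sigmoid ((real (Suc k))\<^sup>2 * (X k - r) + real (Suc k))) \<longlonglongrightarrow> indicator {r..} x"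
proof (cases "r \<le> x")
  case True
  have "filterlim (\<lambda>k. (real (Suc k))\<^sup>2 * (X k - r) + real (Suc k)) at_top sequentially"
  proof (rule filterlim_at_top_mono)
    show "filterlim (\<lambda>k. real (Suc k)) at_top sequentially" by real_asymp
    show "eventually (\<lambda>k. real (Suc k) \<le> (real (Suc k))\<^sup>2 * (X k - r) + real (Suc k)) sequentially"
    proof (intro always_eventually allI)
      fix k
      have "0 \<le> X k - r" using True ge[of k] by linarith
      then show "real (Suc k) \<le> (real (Suc k))\<^sup>2 * (X k - r) + real (Suc k)" by simp
    qed
  qed
  from filterlim_compose[OF sigmoid_at_top this] show ?thesis using True by simp
next
  case False
  define d where "d = (r - x) / 2"
  have d: "d > 0" using False by (simp add: d_def)
  have "filterlim (\<lambda>k. (real (Suc k))\<^sup>2 * (X k - r) + real (Suc k)) at_bot sequentially"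
  proof (rule filterlim_at_bot_mono)
    show "filterlim (\<lambda>k. (real (Suc k))\<^sup>2 * (- d) + real (Suc k)) at_bot sequentially"
      using d by real_asymp
    have "eventually (\<lambda>k. X k < x + d) sequentially"
      using d by (intro order_tendstoD(2)[OF X]) simp
    then show "eventually (\<lambda>k. (real (Suc k))\<^sup>2 * (X k - r) + real (Suc k) \<le> (real (Suc k))\<^sup>2 * (- d) + real (Suc k)) sequentially"
    proof eventually_elim
      case (elim k)
      have "X k - r \<le> - d" using elim by (simp add: d_def field_simps)
      then show ?case by (intro add_right_mono mult_left_mono) auto
    qed
  qed
  from filterlim_compose[OF sigmoid_at_bot this] show ?thesis using False by simp
qed

section \<open>Smooth approximation from above and passage to the limit in the Laplacian\<close>

lemma dir_C2_comp:
  assumes f: "dir_C2 v f f1 f2"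
    and h: "\<And>t. (h has_real_derivative h' t) (at t)" "\<And>t. (h' has_real_derivative h'' t) (at t)"
    and h'': "continuous_on UNIV h''"
  shows "dir_C2 v (\<lambda>z. h (f z)) (\<lambda>z. h' (f z) * f1 z) (\<lambda>z. h'' (f z) * (f1 z)\<^sup>2 + h' (f z) * f2 z)"
proof -
  note f = f[unfolded dir_C2_def]
  have c: "continuous_on UNIV h" "continuous_on UNIV h'"
    using h by (auto intro!: continuous_at_imp_continuous_on DERIV_isCont)
  have cf: "continuous_on UNIV (\<lambda>z. g (f z))" if "continuous_on UNIV g" for g :: "real \<Rightarrow> real"
    by (rule continuous_on_compose2[OF that]) (use f in auto)
  have "dir_deriv v (\<lambda>z. h' (f z) * f1 z) (\<lambda>z. (h'' (f z) * f1 z) * f1 z + h' (f z) * f2 z)"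
    using f by (intro dir_deriv_mult dir_deriv_comp[OF h(2)]) auto
  then have "dir_deriv v (\<lambda>z. h' (f z) * f1 z) (\<lambda>z. h'' (f z) * (f1 z)\<^sup>2 + h' (f z) * f2 z)"
    by (simp add: power2_eq_square mult.assoc)
  then show ?thesis
    unfolding dir_C2_def using f cf[OF c(1)] cf[OF c(2)] cf[OF h'']
    by (intro conjI dir_deriv_comp[OF h(1)] continuous_on_add continuous_on_mult continuous_on_power) auto
qed

text \<open>This isolates what level measures require of the partial sums \<open>U k\<close> and of
  their limit \<open>u\<close>. Extending \<open>u\<close> by 0 to a continuous function on the
  plane encodes the boundary values, and the integrable \<open>D\<close> is both the density of
  \<Delta>u and the majorant of the Laplacians of the \<open>U k\<close>.\<close>

locale smooth_approximation =
  fixes U Ux Uxx Uy Uyy :: "nat \<Rightarrow> complex \<Rightarrow> real" and u D :: "complex \<Rightarrow> real" and B :: real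
  assumes C2x: "\<And>k. dir_C2 1 (U k) (Ux k) (Uxx k)" and C2y: "\<And>k. dir_C2 \<i> (U k) (Uy k) (Uyy k)"
    and U_tendsto: "\<And>z. z \<in> disk \<Longrightarrow> (\<lambda>k. U k z) \<longlonglongrightarrow> u z"
    and U_ge: "\<And>z k. z \<in> disk \<Longrightarrow> u z \<le> U k z"
    and U_bound: "\<And>z k. z \<in> disk \<Longrightarrow> \<bar>U k z\<bar> \<le> B"
    and u_cont: "continuous_on UNIV u"
    and u_neg: "\<And>z. z \<in> disk \<Longrightarrow> u z < 0" and u_0: "\<And>z. z \<notin> disk \<Longrightarrow> u z = 0"
    and D_int: "integrable lborel D" and D_nonneg: "\<And>z. 0 \<le> D z" and D_0: "\<And>z. z \<notin> disk \<Longrightarrow> D z = 0"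
    and lap_tendsto: "AE z in lborel. z \<in> disk \<longrightarrow> (\<lambda>k. Uxx k z + Uyy k z) \<longlonglongrightarrow> D z"
    and lap_bound: "AE z in lborel. z \<in> disk \<longrightarrow> (\<forall>k. \<bar>Uxx k z + Uyy k z\<bar> \<le> D z)"
begin

definition riesz :: "complex measure" where
  "riesz = restrict_space (density lborel (\<lambda>z. ennreal (D z))) disk"

lemma D_meas: "D \<in> borel_measurable borel"
  using borel_measurable_integrable[OF D_int] by simp

lemma sets_riesz: "sets riesz = sets (restrict_space borel disk)"
  unfolding riesz_def by (intro sets_restrict_space_cong) simp

lemma space_riesz: "space riesz = disk"
  by (simp add: riesz_def space_restrict_space)

lemma emeasure_riesz: "A \<in> sets borel \<Longrightarrow> A \<subseteq> disk \<Longrightarrow> emeasure riesz A = (\<integral>\<^sup>+z. ennreal (D z) * indicator A z \<partial>lborel)"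
  unfolding riesz_def using D_meas by (simp add: emeasure_restrict_space emeasure_density)

lemma finite_riesz: "finite_measure riesz"
proof
  have "emeasure riesz (space riesz) \<le> (\<integral>\<^sup>+z. ennreal (D z) \<partial>lborel)"
    unfolding space_riesz by (subst emeasure_riesz) (auto intro!: nn_integral_mono simp: indicator_def)
  also have "\<dots> = ennreal (LINT z|lborel. D z)"
    by (rule nn_integral_eq_integral[OF D_int]) (simp add: D_nonneg)
  finally show "emeasure riesz (space riesz) \<noteq> \<infinity>" by (auto simp: top_unique)
qed

lemma integral_riesz:
  fixes f :: "complex \<Rightarrow> real"
  assumes "f \<in> borel_measurable borel"
  shows "(LINT z|riesz. f z) = (LINT z|lborel. D z * f z)"
proof -
  have m: "(\<lambda>z. indicator disk z *\<^sub>R f z) \<in> borel_measurable lborel"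
    using assms by (intro borel_measurable_scaleR borel_measurable_indicator) auto
  have "(LINT z|riesz. f z) = (LINT z|density lborel (\<lambda>z. ennreal (D z)). indicator disk z *\<^sub>R f z)"
    unfolding riesz_def by (rule integral_restrict_space) simp
  also have "\<dots> = (LINT z|lborel. D z *\<^sub>R (indicator disk z *\<^sub>R f z))"
    by (rule integral_density[OF m]) (use D_meas D_nonneg in auto)
  also have "\<dots> = (LINT z|lborel. D z * f z)"
    by (intro Bochner_Integration.integral_cong) (auto simp: indicator_def D_0)
  finally show ?thesis .
qed

lemma test_function_disk:
  assumes "test_function_on disk \<phi>"
  shows "continuous_on UNIV \<phi>" "continuous_on UNIV (laplacian \<phi>)"
    "\<And>z. z \<notin> disk \<Longrightarrow> \<phi> z = 0" "\<And>z. z \<notin> disk \<Longrightarrow> laplacian \<phi> z = 0"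
    "integrable lborel \<phi>" "integrable lborel (laplacian \<phi>)" "\<exists>C. \<forall>z. \<bar>\<phi> z\<bar> \<le> C" "smooth \<phi>"
proof -
  obtain K where K: "smooth \<phi>" "compact K" "K \<subseteq> disk" "\<And>z. z \<notin> K \<Longrightarrow> \<phi> z = 0"
    "\<And>z. z \<notin> K \<Longrightarrow> laplacian \<phi> z = 0" and c: "continuous_on UNIV \<phi>" "continuous_on UNIV (laplacian \<phi>)"
    by (rule test_function_onE[OF assms]) (rule that; assumption)
  show "continuous_on UNIV \<phi>" "continuous_on UNIV (laplacian \<phi>)" by (rule c)+
  show "\<And>z. z \<notin> disk \<Longrightarrow> \<phi> z = 0" "\<And>z. z \<notin> disk \<Longrightarrow> laplacian \<phi> z = 0"
    using K(3) by (blast intro: K(4,5))+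
  show "integrable lborel \<phi>" by (rule integrable_continuous_compact_support[OF c(1) K(2,4)])
  show "integrable lborel (laplacian \<phi>)" by (rule integrable_continuous_compact_support[OF c(2) K(2,5)])
  have "bounded (\<phi> ` K)"
    by (intro compact_imp_bounded compact_continuous_image continuous_on_subset[OF c(1)] K) auto
  then obtain C where C: "\<forall>z\<in>K. \<bar>\<phi> z\<bar> \<le> C" unfolding bounded_iff by auto
  have "\<bar>\<phi> z\<bar> \<le> \<bar>C\<bar>" for z using C K(4)[of z] by (cases "z \<in> K") fastforce+
  then show "\<exists>C. \<forall>z. \<bar>\<phi> z\<bar> \<le> C" by blast
  show "smooth \<phi>" by (rule K)
qed

text \<open>\<open>h\<close> stands for the identity or for a smoothed maximum.\<close>

lemma integral_laplacian_tendsto: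
  fixes h h' :: "nat \<Rightarrow> real \<Rightarrow> real" and g g' :: "complex \<Rightarrow> real"
  assumes \<phi>: "test_function_on disk \<phi>"
    and hc: "\<And>k. continuous_on UNIV (h k)" "\<And>k. continuous_on UNIV (h' k)"
    and hb: "\<And>k z. z \<in> disk \<Longrightarrow> \<bar>h k (U k z)\<bar> \<le> C" and h'b: "\<And>k t. \<bar>h' k t\<bar> \<le> 1"
    and gm: "g \<in> borel_measurable borel" "g' \<in> borel_measurable borel"
    and hl: "\<And>z. z \<in> disk \<Longrightarrow> (\<lambda>k. h k (U k z)) \<longlonglongrightarrow> g z"
      "\<And>z. z \<in> disk \<Longrightarrow> (\<lambda>k. h' k (U k z)) \<longlonglongrightarrow> g' z"
  shows "(\<lambda>k. LINT z|lborel. h k (U k z) * laplacian \<phi> z) \<longlonglongrightarrow> (LINT z|lborel. g z * laplacian \<phi> z)"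
    and "(\<lambda>k. LINT z|lborel. (h' k (U k z) * (Uxx k z + Uyy k z)) * \<phi> z) \<longlonglongrightarrow> (LINT z|lborel. (g' z * D z) * \<phi> z)"
proof -
  note t = test_function_disk[OF \<phi>]
  have Uc: "continuous_on UNIV (U k)" "continuous_on UNIV (Uxx k)" "continuous_on UNIV (Uyy k)" for k
    using C2x[of k] C2y[of k] by (auto simp: dir_C2_def)
  have hU: "continuous_on UNIV (\<lambda>z. h k (U k z))" "continuous_on UNIV (\<lambda>z. h' k (U k z))" for k
    by (rule continuous_on_compose2[OF hc(1) Uc(1)], simp) (rule continuous_on_compose2[OF hc(2) Uc(1)], simp)
  show "(\<lambda>k. LINT z|lborel. h k (U k z) * laplacian \<phi> z) \<longlonglongrightarrow> (LINT z|lborel. g z * laplacian \<phi> z)"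
  proof (rule integral_dominated_convergence[where w="\<lambda>z. \<bar>C * laplacian \<phi> z\<bar>"])
    show "(\<lambda>z. g z * laplacian \<phi> z) \<in> borel_measurable lborel"
      using gm(1) borel_measurable_continuous_onI[OF t(2)] by simp
    show "(\<lambda>z. h k (U k z) * laplacian \<phi> z) \<in> borel_measurable lborel" for k
      using borel_measurable_continuous_onI[OF continuous_on_mult[OF hU(1)[of k] t(2)]] by simp
    show "integrable lborel (\<lambda>z. \<bar>C * laplacian \<phi> z\<bar>)" using t(6) by simp
    show "AE z in lborel. (\<lambda>k. h k (U k z) * laplacian \<phi> z) \<longlonglongrightarrow> g z * laplacian \<phi> z"
    proof (rule AE_I2)
      fix z show "(\<lambda>k. h k (U k z) * laplacian \<phi> z) \<longlonglongrightarrow> g z * laplacian \<phi> z"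
      proof (cases "z \<in> disk")
        case True
        then show ?thesis by (intro tendsto_mult_right hl(1))
      next
        case False
        then show ?thesis using t(4)[OF False] by simp
      qed
    qed
    show "AE z in lborel. norm (h k (U k z) * laplacian \<phi> z) \<le> \<bar>C * laplacian \<phi> z\<bar>" for k
    proof (rule AE_I2)
      fix z show "norm (h k (U k z) * laplacian \<phi> z) \<le> \<bar>C * laplacian \<phi> z\<bar>"
      proof (cases "z \<in> disk")
        case True
        then have "\<bar>h k (U k z)\<bar> \<le> \<bar>C\<bar>" using hb[OF True, of k] by linarith
        then show ?thesis by (simp add: abs_mult mult_right_mono)
      next
        case False
        then show ?thesis using t(4)[OF False] by simp
      qed
    qed
  qed
  obtain C' where C': "\<And>z. \<bar>\<phi> z\<bar> \<le> C'" using t(7) by blast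
  show "(\<lambda>k. LINT z|lborel. (h' k (U k z) * (Uxx k z + Uyy k z)) * \<phi> z) \<longlonglongrightarrow> (LINT z|lborel. (g' z * D z) * \<phi> z)"
  proof (rule integral_dominated_convergence[where w="\<lambda>z. D z * C'"])
    show "(\<lambda>z. (g' z * D z) * \<phi> z) \<in> borel_measurable lborel"
      using gm(2) D_meas borel_measurable_continuous_onI[OF t(1)] by simp
    show "(\<lambda>z. (h' k (U k z) * (Uxx k z + Uyy k z)) * \<phi> z) \<in> borel_measurable lborel" for k
      using borel_measurable_continuous_onI[OF continuous_on_mult[OF continuous_on_mult[OF hU(2)[of k]
        continuous_on_add[OF Uc(2,3)]] t(1)], of k k] by simp
    show "integrable lborel (\<lambda>z. D z * C')" using D_int by simp
    show "AE z in lborel. (\<lambda>k. (h' k (U k z) * (Uxx k z + Uyy k z)) * \<phi> z) \<longlonglongrightarrow> (g' z * D z) * \<phi> z"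
      using lap_tendsto
    proof eventually_elim
      case (elim z)
      show ?case
      proof (cases "z \<in> disk")
        case True
        then show ?thesis using elim by (intro tendsto_mult hl(2) tendsto_const) auto
      next
        case False
        then show ?thesis using t(3)[OF False] by simp
      qed
    qed
    show "AE z in lborel. norm ((h' k (U k z) * (Uxx k z + Uyy k z)) * \<phi> z) \<le> D z * C'" for k
      using lap_bound
    proof eventually_elim
      case (elim z)
      show ?case
      proof (cases "z \<in> disk")
        case True
        then have "\<bar>h' k (U k z) * (Uxx k z + Uyy k z)\<bar> \<le> 1 * D z"
          unfolding abs_mult using elim h'b by (intro mult_mono) auto
        then show ?thesis
          unfolding real_norm_def abs_mult using C'[of z] D_nonneg[of z] by (intro mult_mono) auto
      next
        case False
        have "0 \<le> C'" using C'[of z] by linarith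
        with False show ?thesis using D_nonneg[of z] t(3)[OF False] by simp
      qed
    qed
  qed
qed

lemma integral_disk_eq:
  fixes f :: "complex \<Rightarrow> real"
  assumes "\<And>z. z \<notin> disk \<Longrightarrow> f z = 0"
  shows "(LINT z:disk|lborel. f z) = (LINT z|lborel. f z)"
  unfolding set_lebesgue_integral_def using assms
  by (intro Bochner_Integration.integral_cong) (auto simp: indicator_def)

lemma laplacian_u:
  assumes \<phi>: "test_function_on disk \<phi>"
  shows "(LINT z|lborel. u z * laplacian \<phi> z) = (LINT z|lborel. D z * \<phi> z)"
proof -
  have "(\<lambda>k. LINT z|lborel. U k z * laplacian \<phi> z) \<longlonglongrightarrow> (LINT z|lborel. u z * laplacian \<phi> z)"
    by (rule integral_laplacian_tendsto(1)[OF \<phi>, of "\<lambda>k t. t" "\<lambda>k t. 1" B u "\<lambda>z. 1"])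
       (use U_bound U_tendsto borel_measurable_continuous_onI[OF u_cont] in auto)
  moreover have "(\<lambda>k. LINT z|lborel. (1 * (Uxx k z + Uyy k z)) * \<phi> z) \<longlonglongrightarrow> (LINT z|lborel. (1 * D z) * \<phi> z)"
    by (rule integral_laplacian_tendsto(2)[OF \<phi>, of "\<lambda>k t. t" "\<lambda>k t. 1" B u "\<lambda>z. 1"])
       (use U_bound U_tendsto borel_measurable_continuous_onI[OF u_cont] in auto)
  ultimately show ?thesis
    using green_identity[OF C2x C2y \<phi>] LIMSEQ_unique by simp
qed

lemma set_integrable_continuous:
  fixes f :: "complex \<Rightarrow> real"
  assumes "continuous_on UNIV f" "compact K"
  shows "set_integrable lborel K f"
  unfolding set_integrable_def
  by (rule borel_integrable_compact[OF assms(2) continuous_on_subset[OF assms(1)]]) simp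

lemma has_laplacian_riesz: "has_laplacian_on disk (\<lambda>z. ereal (u z)) riesz"
  unfolding has_laplacian_on_def
proof (intro conjI allI impI)
  show "sets riesz = sets (restrict_space borel disk)" by (rule sets_riesz)
  show "emeasure riesz K < \<infinity>" for K
    using finite_measure.emeasure_finite[OF finite_riesz, of K] by (simp add: less_top)
  show "set_integrable lborel K (\<lambda>z. real_of_ereal (ereal (u z)))" if "compact K" for K
    using set_integrable_continuous[OF u_cont that] by simp
  fix \<phi> assume \<phi>: "test_function_on disk \<phi>"
  note t = test_function_disk[OF \<phi>]
  have "(LINT z|riesz. \<phi> z) = (LINT z|lborel. u z * laplacian \<phi> z)"
    using integral_riesz[OF borel_measurable_continuous_onI[OF t(1)]] laplacian_u[OF \<phi>] by simp
  also have "\<dots> = (LINT z:disk|lborel. real_of_ereal (ereal (u z)) * laplacian \<phi> z)"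
  proof -
    have "real_of_ereal (ereal (u z)) * laplacian \<phi> z = 0" if "z \<notin> disk" for z
      using t(4)[OF that] by simp
    from integral_disk_eq[OF this] show ?thesis by simp
  qed
  finally show "(LINT z|riesz. \<phi> z) = (LINT z:disk|lborel. real_of_ereal (ereal (u z)) * laplacian \<phi> z)" .
qed simp

end

lemma compact_in_disk:
  assumes "compact K" "K \<subseteq> disk"
  obtains s where "0 \<le> s" "s < 1" "\<And>z. z \<in> K \<Longrightarrow> norm z \<le> s"
proof (cases "K = {}")
  case False
  obtain x where x: "x \<in> K" "\<And>z. z \<in> K \<Longrightarrow> norm z \<le> norm x"
    using continuous_attains_sup[OF assms(1) False, of norm] by (auto intro: continuous_on_norm_id)
  then show thesis using assms(2) by (intro that[of "norm x"]) auto
qed (use that[of 0] in auto)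

context smooth_approximation
begin

lemma u_tendsto_0: "((\<lambda>z. ereal (u z)) \<longlongrightarrow> 0) (filtercomap norm (at_left 1))"
proof -
  have "(u \<longlongrightarrow> 0) (filtercomap norm (at_left 1))"
  proof (rule tendstoI)
    fix e :: real assume e: "0 < e"
    \<comment> \<open>As u vanishes off the open disk, the points of the closed disk with |u| \<ge>
      e form a compact subset of the open one, and a thin annulus avoids it.\<close>
    define K where "K = {z \<in> cball 0 1. e \<le> \<bar>u z\<bar>}"
    have "closed {z. e \<le> \<bar>u z\<bar>}"
      by (rule closed_Collect_le) (intro continuous_intros u_cont)+
    then have "compact (cball 0 1 \<inter> {z. e \<le> \<bar>u z\<bar>})" by (intro compact_Int_closed) auto
    also have "cball 0 1 \<inter> {z. e \<le> \<bar>u z\<bar>} = K" by (auto simp: K_def)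
    finally have "compact K" .
    moreover have "K \<subseteq> disk"
    proof
      fix z assume "z \<in> K"
      then have "u z \<noteq> 0" using e by (auto simp: K_def)
      then show "z \<in> disk" using u_0 by blast
    qed
    ultimately obtain s where s: "0 \<le> s" "s < 1" "\<And>z. z \<in> K \<Longrightarrow> norm z \<le> s"
      by (rule compact_in_disk) (rule that; assumption)
    have "eventually (\<lambda>t. s < t \<and> t < 1) (at_left (1::real))"
      unfolding eventually_at_left_field using s(2) by blast
    then show "eventually (\<lambda>z. dist (u z) 0 < e) (filtercomap norm (at_left 1))"
      unfolding eventually_filtercomap
    proof (intro exI conjI allI impI)
      fix z :: complex assume z: "s < norm z \<and> norm z < 1"
      then have "z \<notin> K" using s(3)[of z] by auto
      then show "dist (u z) 0 < e" using z by (auto simp: K_def)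
    qed
  qed
  then have "((\<lambda>z. ereal (u z)) \<longlongrightarrow> ereal 0) (filtercomap norm (at_left 1))" by (rule tendsto_ereal)
  then show ?thesis by (simp add: zero_ereal_def)
qed

text \<open>This is h''(U) |\<nabla>U|^2, where h is the soft maximum with parameter K =
  \<open>Suc k\<close>: the part of \<Delta>(h(U)) that does not come from \<Delta>U.\<close>

definition gradient_weight :: "real \<Rightarrow> nat \<Rightarrow> complex \<Rightarrow> real" where
  "gradient_weight r k z = (let x = sigmoid ((real (Suc k))\<^sup>2 * (U k z - r) + real (Suc k)) in
     (real (Suc k))\<^sup>2 * (x * (1 - x)) * ((Ux k z)\<^sup>2 + (Uy k z)\<^sup>2))"

lemma gradient_weight_nonneg: "0 \<le> gradient_weight r k z"
  unfolding gradient_weight_def Let_def using sigmoid_bounds by (intro mult_nonneg_nonneg) auto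

lemma continuous_sigmoid: "continuous_on UNIV (\<lambda>s. sigmoid (K\<^sup>2 * (s - r) + K))"
proof -
  have "1 + exp x \<noteq> 0" for x :: real using one_plus_exp_pos[of x] by linarith
  then show ?thesis unfolding sigmoid_def[abs_def] by (intro continuous_intros) auto
qed

lemma gradient_weight_cont: "continuous_on UNIV (gradient_weight r k)"
proof -
  have c: "continuous_on UNIV (U k)" "continuous_on UNIV (Ux k)" "continuous_on UNIV (Uy k)"
    using C2x[of k] C2y[of k] by (auto simp: dir_C2_def)
  have "continuous_on UNIV (\<lambda>z. sigmoid ((real (Suc k))\<^sup>2 * (U k z - r) + real (Suc k)))"
    by (rule continuous_on_compose2[OF continuous_sigmoid c(1)]) simp
  then show ?thesis
    unfolding gradient_weight_def[abs_def] Let_def using c by (intro continuous_intros)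
qed

text \<open>The level measure as a distribution, before it is known to be a measure. The closed
  half-line \<open>{r..}\<close> selects the complement of B(u,r), which includes {u = r}.\<close>

definition level_functional :: "real \<Rightarrow> (complex \<Rightarrow> real) \<Rightarrow> real" where
  "level_functional r \<phi> = (LINT z|lborel. max (u z) r * laplacian \<phi> z) - (LINT z|lborel. (indicator {r..} (u z) * D z) * \<phi> z)"

text \<open>Green's identity for h(U) expresses the gradient term as the difference of an integral
  of h(U) \<Delta>\<phi> and one of h'(U) \<Delta>U \<phi>. Each of these converges by dominated
  convergence, although the gradient term itself has no majorant.\<close>

lemma level_functional_tendsto:
  assumes \<phi>: "test_function_on disk \<phi>"
  shows "(\<lambda>k. LINT z|lborel. gradient_weight r k z * \<phi> z) \<longlonglongrightarrow> level_functional r \<phi>"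
proof -
  define h where "h k = soft_max (real (Suc k)) r" for k
  define h' where "h' k s = sigmoid ((real (Suc k))\<^sup>2 * (s - r) + real (Suc k))" for k s
  define h'' where "h'' k s = (real (Suc k))\<^sup>2 * (h' k s * (1 - h' k s))" for k s
  have d: "(h k has_real_derivative h' k t) (at t)" "(h' k has_real_derivative h'' k t) (at t)" for k t
    unfolding h''_def h'_def[abs_def] h_def by (rule soft_max_deriv; simp)+
  have ch': "continuous_on UNIV (h' k)" for k unfolding h'_def[abs_def] by (rule continuous_sigmoid)
  have ch'': "continuous_on UNIV (h'' k)" for k unfolding h''_def[abs_def] by (intro continuous_intros ch')
  have ch: "continuous_on UNIV (h k)" for k
    using d(1) by (auto intro!: continuous_at_imp_continuous_on DERIV_isCont)
  have close: "\<bar>h k s - max s r\<bar> \<le> 2 / real (Suc k)" for k s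
    unfolding h_def by (rule soft_max_close) simp
  have um: "u \<in> borel_measurable borel" using u_cont by (rule borel_measurable_continuous_onI)
  have "B \<ge> 0" using U_bound[of 0 0] by force
  have hb: "\<bar>h k (U k z)\<bar> \<le> B + \<bar>r\<bar> + 2" if "z \<in> disk" for k z
  proof -
    have "2 / real (Suc k) \<le> 2" by (simp add: divide_simps)
    then show ?thesis using close[of k "U k z"] U_bound[OF that, of k] \<open>B \<ge> 0\<close> by (auto simp: max_def split: if_splits)
  qed
  have hl: "(\<lambda>k. h k (U k z)) \<longlonglongrightarrow> max (u z) r" if "z \<in> disk" for z
  proof -
    have "(\<lambda>k. h k (U k z) - max (U k z) r) \<longlonglongrightarrow> 0"
    proof (rule Lim_null_comparison[of _ "\<lambda>k. 2 / real (Suc k)"])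
      show "(\<lambda>k. 2 / real (Suc k)) \<longlonglongrightarrow> 0" by real_asymp
    qed (use close in auto)
    from tendsto_add[OF this tendsto_max[OF U_tendsto[OF that] tendsto_const[of r]]]
    show ?thesis by simp
  qed
  have h'l: "(\<lambda>k. h' k (U k z)) \<longlonglongrightarrow> indicator {r..} (u z)" if "z \<in> disk" for z
    unfolding h'_def by (rule soft_max_deriv_tendsto[OF U_tendsto[OF that] U_ge[OF that]])
  have h'b: "\<bar>h' k t\<bar> \<le> 1" for k t
    using sigmoid_bounds by (simp add: h'_def)
  have m: "(\<lambda>z. max (u z) r) \<in> borel_measurable borel" "(\<lambda>z. indicator {r..} (u z) :: real) \<in> borel_measurable borel"
    using um by (auto intro!: borel_measurable_max measurable_compose[OF um])
  note lim = integral_laplacian_tendsto[OF \<phi> ch ch' hb h'b m hl h'l]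
  obtain K where K: "smooth \<phi>" "compact K" "K \<subseteq> disk" "\<And>z. z \<notin> K \<Longrightarrow> \<phi> z = 0"
    by (rule test_function_onE[OF \<phi>]) (rule that; assumption)
  have "(LINT z|lborel. gradient_weight r k z * \<phi> z) =
      (LINT z|lborel. h k (U k z) * laplacian \<phi> z) - (LINT z|lborel. (h' k (U k z) * (Uxx k z + Uyy k z)) * \<phi> z)" for k
  proof -
    have c: "continuous_on UNIV (U k)" "continuous_on UNIV (Uxx k)" "continuous_on UNIV (Uyy k)"
      using C2x[of k] C2y[of k] by (auto simp: dir_C2_def)
    have ch'U: "continuous_on UNIV (\<lambda>z. h' k (U k z))"
      by (rule continuous_on_compose2[OF ch' c(1)]) simp
    have i: "integrable lborel (\<lambda>z. gradient_weight r k z * \<phi> z)"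
      "integrable lborel (\<lambda>z. (h' k (U k z) * (Uxx k z + Uyy k z)) * \<phi> z)"
      by (rule integrable_continuous_compact_support[OF _ K(2)];
          simp add: K(4) continuous_on_mult continuous_on_add gradient_weight_cont smooth_continuous_on[OF K(1)] ch'U c)+
    have "(LINT z|lborel. h k (U k z) * laplacian \<phi> z) =
      (LINT z|lborel. ((h'' k (U k z) * (Ux k z)\<^sup>2 + h' k (U k z) * Uxx k z) +
        (h'' k (U k z) * (Uy k z)\<^sup>2 + h' k (U k z) * Uyy k z)) * \<phi> z)"
      by (rule green_identity[OF dir_C2_comp[OF C2x d ch''] dir_C2_comp[OF C2y d ch''] \<phi>])
    also have "\<dots> = (LINT z|lborel. gradient_weight r k z * \<phi> z + (h' k (U k z) * (Uxx k z + Uyy k z)) * \<phi> z)"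
      by (intro Bochner_Integration.integral_cong refl)
         (simp add: gradient_weight_def Let_def h''_def h'_def algebra_simps)
    also have "\<dots> = (LINT z|lborel. gradient_weight r k z * \<phi> z) + (LINT z|lborel. (h' k (U k z) * (Uxx k z + Uyy k z)) * \<phi> z)"
      by (rule Bochner_Integration.integral_add[OF i])
    finally show ?thesis by simp
  qed
  then show ?thesis unfolding level_functional_def using tendsto_diff[OF lim] by simp
qed

lemma integrable_max_laplacian:
  assumes "test_function_on disk \<phi>"
  shows "integrable lborel (\<lambda>z. max (u z) r * laplacian \<phi> z)"
    and "integrable lborel (\<lambda>z. (indicator {r..} (u z) * D z) * \<phi> z)"
proof -
  note t = test_function_disk[OF assms]
  obtain K where K: "smooth \<phi>" "compact K" "K \<subseteq> disk" "\<And>z. z \<notin> K \<Longrightarrow> \<phi> z = 0" "\<And>z. z \<notin> K \<Longrightarrow> laplacian \<phi> z = 0"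
    by (rule test_function_onE[OF assms]) (rule that; assumption)
  show "integrable lborel (\<lambda>z. max (u z) r * laplacian \<phi> z)"
    by (rule integrable_continuous_compact_support[OF _ K(2)])
       (auto intro!: continuous_on_mult continuous_on_max u_cont continuous_on_const t(2) simp: K(5))
  obtain C where C: "\<And>z. \<bar>\<phi> z\<bar> \<le> C" using t(7) by blast
  have um: "u \<in> borel_measurable borel" using u_cont by (rule borel_measurable_continuous_onI)
  have "(\<lambda>z. indicator {r..} (u z) :: real) \<in> borel_measurable borel"
    by (intro measurable_compose[OF um]) auto
  then have m: "(\<lambda>z. (indicator {r..} (u z) * D z) * \<phi> z) \<in> borel_measurable lborel"
    using D_meas borel_measurable_continuous_onI[OF t(1)] by simp
  show "integrable lborel (\<lambda>z. (indicator {r..} (u z) * D z) * \<phi> z)"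
  proof (rule Bochner_Integration.integrable_bound[OF integrable_mult_left[OF D_int, of C] m AE_I2])
    fix z
    have "\<bar>indicator {r..} (u z) * D z\<bar> \<le> D z" using D_nonneg[of z] by (auto simp: indicator_def)
    then have "\<bar>indicator {r..} (u z) * D z\<bar> * \<bar>\<phi> z\<bar> \<le> D z * C"
      using C[of z] by (intro mult_mono) (auto simp: D_nonneg)
    then show "norm ((indicator {r..} (u z) * D z) * \<phi> z) \<le> norm (D z * C)"
      unfolding real_norm_def by (subst abs_mult) linarith
  qed
qed

lemma level_functional_add:
  assumes "test_function_on disk \<phi>" "test_function_on disk \<psi>" "\<And>z. \<eta> z = \<phi> z + \<psi> z"
  shows "level_functional r \<eta> = level_functional r \<phi> + level_functional r \<psi>"
proof -
  have s: "smooth \<phi>" "smooth \<psi>" using test_function_disk(8) assms by auto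
  have \<eta>: "\<eta> = (\<lambda>z. \<phi> z + \<psi> z)" using assms(3) by auto
  have "laplacian \<eta> z = laplacian \<phi> z + laplacian \<psi> z" for z
    unfolding laplacian_def \<eta> partial_deriv_add[OF s]
    by (simp add: partial_deriv_add[OF smooth_partial_deriv[OF s(1)] smooth_partial_deriv[OF s(2)]])
  then show ?thesis
    unfolding level_functional_def \<eta>
    using integrable_max_laplacian[OF assms(1)] integrable_max_laplacian[OF assms(2)]
    by (simp add: distrib_left)
qed

text \<open>On the support of \<phi> the maximum is u and the indicator is 1, so the two terms
  cancel by \<open>laplacian_u\<close>. The level measure thus stays away from the circle.\<close>

lemma level_functional_eq_0:
  assumes \<phi>: "test_function_on disk \<phi>" and r: "\<And>z. norm z < t \<Longrightarrow> \<phi> z = 0"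
    and t: "\<And>z. t \<le> norm z \<Longrightarrow> z \<in> disk \<Longrightarrow> r < u z"
  shows "level_functional r \<phi> = 0"
proof -
  note td = test_function_disk[OF \<phi>]
  have l0: "laplacian \<phi> z = 0" if "norm z < t" for z
  proof -
    have "laplacian \<phi> z = laplacian (\<lambda>z. Re (poly 0 z)) z"
      by (rule laplacian_cong_open[OF td(8), of "ball 0 t"]) (use that r in auto)
    then show ?thesis by (simp only: laplacian_Re_poly)
  qed
  have "(LINT z|lborel. max (u z) r * laplacian \<phi> z) = (LINT z|lborel. u z * laplacian \<phi> z)"
  proof (intro Bochner_Integration.integral_cong refl)
    fix z show "max (u z) r * laplacian \<phi> z = u z * laplacian \<phi> z"
    proof (cases "z \<in> disk \<and> t \<le> norm z")
      case True
      then show ?thesis using t[of z] by (simp add: max_def)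
    next
      case False
      then have "laplacian \<phi> z = 0" using l0 td(4) by (meson not_le)
      then show ?thesis by simp
    qed
  qed
  moreover have "(LINT z|lborel. (indicator {r..} (u z) * D z) * \<phi> z) = (LINT z|lborel. D z * \<phi> z)"
  proof (intro Bochner_Integration.integral_cong refl)
    fix z show "(indicator {r..} (u z) * D z) * \<phi> z = D z * \<phi> z"
    proof (cases "z \<in> disk \<and> t \<le> norm z")
      case True
      then show ?thesis using t[of z] by simp
    next
      case False
      then have "\<phi> z = 0" using r td(3) by (meson not_le)
      then show ?thesis by simp
    qed
  qed
  ultimately show ?thesis unfolding level_functional_def using laplacian_u[OF \<phi>] by simp
qed

text \<open>Multiplied by a plateau \<open>X\<close> the gradient weights are densities of finite
  measures, and their masses converge because \<open>X\<close> is itself a test function; so weak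
  compactness applies. The cut-off changes nothing in the limit, since \<phi> (1 - X) lives where r
  < u.\<close>

lemma level_functional_represented:
  assumes r: "r < 0"
  obtains M where "finite_measure M" "sets M = sets (borel :: complex measure)"
    "\<And>\<phi>. test_function_on disk \<phi> \<Longrightarrow> (LINT z|M. \<phi> z) = level_functional r \<phi>"
proof -
  obtain s where s: "0 \<le> s" "s < 1" "\<And>z::complex. s < norm z \<Longrightarrow> norm z < 1 \<Longrightarrow> ereal r < ereal (u z)"
    by (rule sublevel_radius[OF u_tendsto_0 r]) (rule that; assumption)
  obtain n where n: "s < radius n"
    using eventually_radius[OF s(2)] unfolding eventually_sequentially by blast
  define X where "X = plateau n"
  have X: "smooth X" "\<And>z. 0 \<le> X z" "\<And>z. norm z \<le> radius n \<Longrightarrow> X z = 1" "\<And>z. radius (Suc n) \<le> norm z \<Longrightarrow> X z = 0"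
    unfolding X_def by (auto intro: smooth_plateau plateau_nonneg plateau_eq_1 plateau_eq_0)
  have tX: "test_function_on disk (\<lambda>z. f z * X z)" if "smooth f" for f
    unfolding X_def by (rule test_function_mult_plateau[OF that])
  have Xc: "continuous_on UNIV X" by (rule smooth_continuous_on[OF X(1)])
  define w where "w k z = gradient_weight r k z * X z" for k z
  have w0: "0 \<le> w k z" for k z unfolding w_def using gradient_weight_nonneg X(2) by simp
  have wc: "continuous_on UNIV (w k)" for k
    unfolding w_def by (intro continuous_on_mult gradient_weight_cont Xc)
  have wm: "w k \<in> borel_measurable borel" for k using wc by (rule borel_measurable_continuous_onI)
  have wout: "w k z = 0" if "z \<notin> cball 0 1" for k z
  proof -
    have "radius (Suc n) \<le> norm z" using that radius_bounds(3)[of "Suc n"] by auto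
    then show ?thesis by (simp add: w_def X(4))
  qed
  have wi: "integrable lborel (w k)" for k
    by (rule integrable_continuous_compact_support[OF wc compact_cball wout])
  define N where "N k = density lborel (\<lambda>z. ennreal (w k z))" for k
  have sN: "sets (N k) = sets borel" for k by (simp add: N_def)
  have eN: "emeasure (N k) UNIV = ennreal (LINT z|lborel. w k z)" for k
    unfolding N_def using wm nn_integral_eq_integral[OF wi AE_I2[OF w0]] by (simp add: emeasure_density)
  have fN: "finite_measure (N k)" for k
    by (rule finite_measureI) (use eN[of k] in \<open>simp add: N_def\<close>)
  have mN: "measure (N k) UNIV = (LINT z|lborel. w k z)" for k
    using eN[of k] w0 by (simp add: measure_def integral_nonneg_AE)
  have aeN: "AE z in N k. norm z \<le> 1" for k
  proof -
    have "norm z \<le> 1" if "0 < ennreal (w k z)" for z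
      using wout[of z k] that by (cases "norm z \<le> 1") auto
    then show ?thesis unfolding N_def using wm by (subst AE_density) (auto intro!: AE_I2)
  qed
  have iN: "(LINT z|N k. f z) = (LINT z|lborel. gradient_weight r k z * (f z * X z))"
    if "continuous_on UNIV f" for f k
  proof -
    have "(LINT z|N k. f z) = (LINT z|lborel. w k z *\<^sub>R f z)"
      unfolding N_def using wm w0 borel_measurable_continuous_onI[OF that] by (intro integral_density) auto
    then show ?thesis by (simp add: w_def mult_ac)
  qed
  have lim: "(\<lambda>k. LINT z|N k. f z) \<longlonglongrightarrow> level_functional r (\<lambda>z. f z * X z)" if "smooth f" for f
    unfolding iN[OF smooth_continuous_on[OF that]] by (rule level_functional_tendsto[OF tX[OF that]])
  have mass: "(\<lambda>k. measure (N k) UNIV) \<longlonglongrightarrow> level_functional r (\<lambda>z. 1 * X z)"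
  proof -
    have "(LINT z|N k. 1) = measure (N k) UNIV" for k
      using sets_eq_imp_space_eq[OF sN[of k]] by simp
    then show ?thesis using lim[OF smooth_const[of 1]] by simp
  qed
  obtain M and \<rho> :: "nat \<Rightarrow> nat" where \<rho>: "strict_mono \<rho>" and M: "sets M = sets borel" "finite_measure M"
    and conv: "\<And>f :: complex \<Rightarrow> real. continuous_on UNIV f \<Longrightarrow> (\<lambda>k. LINT z|N (\<rho> k). f z) \<longlonglongrightarrow> (LINT z|M. f z)"
    by (rule weak_limit_exists[OF sN fN aeN mass]) (rule that; assumption)
  show thesis
  proof (rule that[OF M(2,1)])
    fix \<phi> assume \<phi>: "test_function_on disk \<phi>"
    note td = test_function_disk[OF \<phi>]
    have "(\<lambda>k. LINT z|N (\<rho> k). \<phi> z) \<longlonglongrightarrow> level_functional r (\<lambda>z. \<phi> z * X z)"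
      using LIMSEQ_subseq_LIMSEQ[OF lim[OF td(8)] \<rho>] by (simp add: o_def)
    then have "(LINT z|M. \<phi> z) = level_functional r (\<lambda>z. \<phi> z * X z)"
      using conv[OF td(1)] LIMSEQ_unique by blast
    moreover have "test_function_on disk (\<lambda>z. \<phi> z * (1 - X z))"
    proof -
      obtain K where K: "smooth \<phi>" "compact K" "K \<subseteq> disk" "\<And>z. z \<notin> K \<Longrightarrow> \<phi> z = 0"
        by (rule test_function_onE[OF \<phi>]) (rule that; assumption)
      show ?thesis
        by (rule test_function_onI[OF smooth_mult[OF K(1) smooth_diff[OF smooth_const X(1)]] K(2,3)]) (simp add: K(4))
    qed
    then have "level_functional r \<phi> = level_functional r (\<lambda>z. \<phi> z * X z) + level_functional r (\<lambda>z. \<phi> z * (1 - X z))"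
      by (rule level_functional_add[OF tX[OF td(8)]]) (simp add: algebra_simps)
    moreover have "level_functional r (\<lambda>z. \<phi> z * (1 - X z)) = 0"
    proof (rule level_functional_eq_0[where t="radius n"])
      show "test_function_on disk (\<lambda>z. \<phi> z * (1 - X z))" by fact
      show "\<phi> z * (1 - X z) = 0" if "norm z < radius n" for z using that X(3)[of z] by simp
      show "r < u z" if "radius n \<le> norm z" "z \<in> disk" for z using s(3)[of z] n that by simp
    qed
    ultimately show "(LINT z|M. \<phi> z) = level_functional r \<phi>" by simp
  qed
qed

text \<open>The Laplacian of \<open>max u r\<close> is not given in advance. It is built as the sum
  \<open>N\<close> of the measure \<open>M\<close> representing the level functional and of the
  restriction \<open>L\<close> of \<Delta>u to {u \<ge> r}, which makes the defining equation of a
  level measure hold by construction.\<close>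

lemma level_measure_exists:
  assumes r: "r < 0"
  shows "\<exists>M. level_measure (\<lambda>z. ereal (u z)) r M"
proof -
  obtain M0 where M0: "finite_measure M0" "sets M0 = sets (borel :: complex measure)"
    "\<And>\<phi>. test_function_on disk \<phi> \<Longrightarrow> (LINT z|M0. \<phi> z) = level_functional r \<phi>"
    by (rule level_functional_represented[OF r]) (rule that; assumption)
  interpret M0: finite_measure M0 by (rule M0)
  have sp0: "space M0 = UNIV" using sets_eq_imp_space_eq[OF M0(2)] by simp
  \<comment> \<open>The weak limit is a measure on the plane. Test functions vanish off the disk, so
    restricting it preserves their integrals.\<close>
  define M where "M = restrict_space M0 disk"
  have sM: "sets M = sets (restrict_space borel disk)" unfolding M_def by (rule sets_restrict_space_cong[OF M0(2)])
  have spM: "space M = disk" using sets_eq_imp_space_eq[OF sM] by (simp add: space_restrict_space)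
  have dM: "disk \<inter> space M0 \<in> sets M0" using M0(2) sp0 by simp
  have fM: "finite_measure M"
    by (rule finite_measureI) (use dM sp0 in \<open>simp add: spM M_def emeasure_restrict_space\<close>)
  have iM: "(LINT z|M. \<phi> z) = level_functional r \<phi>" if "test_function_on disk \<phi>" for \<phi>
  proof -
    have "(LINT z|M. \<phi> z) = (LINT z|M0. indicator disk z *\<^sub>R \<phi> z)"
      unfolding M_def by (rule integral_restrict_space[OF dM])
    also have "\<dots> = (LINT z|M0. \<phi> z)"
      using test_function_disk(3)[OF that] by (intro Bochner_Integration.integral_cong refl) (auto simp: indicator_def)
    finally show ?thesis using M0(3)[OF that] by simp
  qed
  define S where "S = {z \<in> disk. ereal (u z) < ereal r}"
  define L where "L = density riesz (indicator (disk - S))"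
  have Sb: "open S" "S \<subseteq> disk"
    unfolding S_def using open_sublevel[of "\<lambda>z. ereal (u z)" r] continuous_on_subset[OF u_cont]
    by (auto intro!: continuous_on_ereal)
  have Ss: "disk - S \<in> sets riesz" unfolding sets_riesz using Sb by (auto simp: sets_restrict_space_iff)
  have sL: "sets L = sets (restrict_space borel disk)" by (simp add: L_def sets_riesz)
  have eL: "emeasure L A = emeasure riesz (A - S)" if "A \<in> sets (restrict_space borel disk)" for A
  proof -
    have A: "A \<in> sets riesz" using that sets_riesz by simp
    have "emeasure L A = (\<integral>\<^sup>+z. indicator (disk - S) z * indicator A z \<partial>riesz)"
      unfolding L_def using A Ss by (subst emeasure_density) auto
    also have "\<dots> = (\<integral>\<^sup>+z. indicator (A - S) z \<partial>riesz)"
      by (intro nn_integral_cong) (auto simp: space_riesz indicator_def)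
    also have "\<dots> = emeasure riesz (A - S)"
    proof -
      have "A - S = A \<inter> (disk - S)" using sets.sets_into_space[OF A] space_riesz by auto
      then have "A - S \<in> sets riesz" using A Ss by simp
      then show ?thesis by simp
    qed
    finally show ?thesis .
  qed
  have fL: "finite_measure L"
  proof
    have "space L \<in> sets (restrict_space borel disk)" using sets.top[of L] sL by simp
    then show "emeasure L (space L) \<noteq> \<infinity>"
      using eL finite_measure.emeasure_finite[OF finite_riesz] by simp
  qed
  have sLM: "sets L = sets M" by (simp add: sL sM)
  obtain N where sN: "sets N = sets M" and eN: "\<And>A. A \<in> sets M \<Longrightarrow> emeasure N A = emeasure M A + emeasure L A"
    by (rule sum_measure_exists[OF sLM]) (rule that; assumption)
  have fN: "emeasure N A < \<infinity>" if "A \<in> sets M" for A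
    using eN[OF that] finite_measure.emeasure_finite[OF fM, of A] finite_measure.emeasure_finite[OF fL, of A]
    by (simp add: less_top)
  have "has_laplacian_on disk (\<lambda>z. max (ereal (u z)) (ereal r)) N"
    unfolding has_laplacian_on_def
  proof (intro conjI allI impI)
    have mx: "max (ereal (u z)) (ereal r) = ereal (max (u z) r)" for z by (simp add: max_def)
    show "sets N = sets (restrict_space borel disk)" using sN sM by simp
    show "emeasure N K < \<infinity>" if "compact K" "K \<subseteq> disk" for K
      by (rule fN) (use that in \<open>auto simp: sM sets_restrict_space_iff intro: borel_compact\<close>)
    show "AE z in lborel. z \<in> disk \<longrightarrow> \<bar>max (ereal (u z)) (ereal r)\<bar> \<noteq> \<infinity>"
      unfolding mx by (simp del: ereal_max)
    show "set_integrable lborel K (\<lambda>z. real_of_ereal (max (ereal (u z)) (ereal r)))" if "compact K" for K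
      unfolding mx real_of_ereal.simps
      by (rule set_integrable_continuous[OF continuous_on_max[OF u_cont continuous_on_const] that])
    fix \<phi> assume \<phi>: "test_function_on disk \<phi>"
    note td = test_function_disk[OF \<phi>]
    have int: "integrable M \<phi>" "integrable L \<phi>"
      using finite_measure_disk_tendsto(2)[OF fM sM td(1)] finite_measure_disk_tendsto(2)[OF fL sL td(1)] by auto
    have "(LINT z|N. \<phi> z) = (LINT z|M. \<phi> z) + (LINT z|L. \<phi> z)"
      by (rule emeasure_plus_integral(2)[OF _ _ _ int]) (use sN sM sL eN in auto)
    also have "(LINT z|L. \<phi> z) = (LINT z|riesz. indicator (disk - S) z *\<^sub>R \<phi> z)"
    proof -
      have L: "L = density riesz (\<lambda>z. ennreal (indicator (disk - S) z))" by (simp add: L_def ennreal_indicator)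
      show ?thesis
        unfolding L by (rule integral_density[OF borel_measurable_disk[OF sets_riesz borel_measurable_continuous_onI[OF td(1)]]
          borel_measurable_indicator[OF Ss] AE_I2]) (rule indicator_pos_le)
    qed
    also have "\<dots> = (LINT z|lborel. D z * (indicator (disk - S) z *\<^sub>R \<phi> z))"
      using Sb by (intro integral_riesz borel_measurable_scaleR borel_measurable_indicator
        borel_measurable_continuous_onI[OF td(1)]) auto
    also have "\<dots> = (LINT z|lborel. (indicator {r..} (u z) * D z) * \<phi> z)"
      by (intro Bochner_Integration.integral_cong refl) (use D_0 in \<open>auto simp: S_def indicator_def\<close>)
    also have "(LINT z|M. \<phi> z) + (LINT z|lborel. (indicator {r..} (u z) * D z) * \<phi> z) = (LINT z|lborel. max (u z) r * laplacian \<phi> z)"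
      using iM[OF \<phi>] by (simp add: level_functional_def)
    also have "\<dots> = (LINT z:disk|lborel. real_of_ereal (max (ereal (u z)) (ereal r)) * laplacian \<phi> z)"
    proof -
      have "real_of_ereal (max (ereal (u z)) (ereal r)) * laplacian \<phi> z = 0" if "z \<notin> disk" for z
        using td(4)[OF that] by simp
      from integral_disk_eq[OF this] show ?thesis unfolding mx real_of_ereal.simps by simp
    qed
    finally show "(LINT z|N. \<phi> z) = (LINT z:disk|lborel. real_of_ereal (max (ereal (u z)) (ereal r)) * laplacian \<phi> z)" .
  qed
  then have "level_measure (\<lambda>z. ereal (u z)) r M"
    unfolding level_measure_def
    using sM has_laplacian_riesz eN eL unfolding S_def[symmetric]
    by (intro conjI exI[of _ riesz] exI[of _ N]) auto
  then show ?thesis by blast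
qed

end

section \<open>Escape of the level measures to the circle and weak convergence\<close>

lemma integral_laplacian_0:
  assumes "test_function_on S \<phi>"
  shows "(LINT z|lborel. laplacian \<phi> z) = 0"
proof -
  have "dir_C2 v (\<lambda>_. 1) (\<lambda>_. 0) (\<lambda>_. 0)" for v
    by (auto simp: dir_C2_def dir_deriv_def)
  from green_identity[OF this this assms] show ?thesis by simp
qed

text \<open>Where u < r the maximum is the constant r. Testing with a plateau supported there gives
  r times the integral of its Laplacian, which is 0, so the Laplacian of the maximum has no mass on
  the smaller disk, and neither does the level measure.\<close>

lemma level_measure_vanishes:
  assumes M: "level_measure u r M" and A: "A \<in> sets borel" "A \<subseteq> cball 0 (radius n)"
    and u: "\<And>z. norm z \<le> radius (Suc n) \<Longrightarrow> u z < ereal r"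
  shows "emeasure M A = 0"
proof -
  obtain \<nu> N where N: "has_laplacian_on disk (\<lambda>z. max (u z) (ereal r)) N"
    and eq: "\<And>A. A \<in> sets M \<Longrightarrow> emeasure M A + emeasure \<nu> (A - {z \<in> disk. u z < ereal r}) = emeasure N A"
    and sM: "sets M = sets (restrict_space borel disk)"
    using M unfolding level_measure_def by blast
  have sN: "sets N = sets (restrict_space borel disk)" using has_laplacian_on_space[OF N] by simp
  have finN: "emeasure N K < \<infinity>" if "compact K" "K \<subseteq> disk" for K
    using N that by (auto simp: has_laplacian_on_def)
  note t = test_function_plateau'[of n]
  have As: "A \<in> sets M" "A \<in> sets N"
    unfolding sM sN using A radius_bounds(3)[of n] by (auto simp: sets_restrict_space_iff)
  have "(LINT z|N. plateau n z) = (LINT z:disk|lborel. real_of_ereal (max (u z) (ereal r)) * laplacian (plateau n) z)"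
    using N t unfolding has_laplacian_on_def by blast
  also have "\<dots> = (LINT z|lborel. r * laplacian (plateau n) z)"
    unfolding set_lebesgue_integral_def
  proof (intro Bochner_Integration.integral_cong refl)
    fix z :: complex
    show "indicator disk z *\<^sub>R (real_of_ereal (max (u z) (ereal r)) * laplacian (plateau n) z) = r * laplacian (plateau n) z"
    proof (cases "norm z \<le> radius (Suc n)")
      case True
      then have "max (u z) (ereal r) = ereal r" using less_imp_le[OF u[OF True]] by (simp add: max_def)
      moreover have "z \<in> disk" using True radius_bounds(3)[of "Suc n"] by simp
      ultimately show ?thesis by simp
    next
      case False
      have "laplacian (plateau n) z = laplacian (\<lambda>z. Re (poly 0 z)) z"
        by (rule laplacian_cong_open[OF smooth_plateau, of "- cball 0 (radius (Suc n))"])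
           (use False in \<open>auto intro: plateau_eq_0\<close>)
      then have "laplacian (plateau n) z = 0" by (simp only: laplacian_Re_poly)
      then show ?thesis by simp
    qed
  qed
  also have "\<dots> = 0" using integral_laplacian_0[OF t] by simp
  finally have 0: "(LINT z|N. plateau n z) = 0" .
  have "emeasure N A = (\<integral>\<^sup>+z. indicator A z \<partial>N)" using As by simp
  also have "\<dots> \<le> (\<integral>\<^sup>+z. ennreal (plateau n z) \<partial>N)"
    using A(2) by (intro nn_integral_mono) (auto simp: indicator_def plateau_eq_1)
  also have "\<dots> = ennreal (LINT z|N. plateau n z)"
    using integrable_plateau[OF sN finN, of "\<lambda>_. 1" n]
    by (intro nn_integral_eq_integral) (auto simp: plateau_nonneg)
  finally have "emeasure N A = 0" using 0 by simp
  then show ?thesis using eq[OF As(1)] by simp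
qed

context smooth_approximation
begin

text \<open>Convergence is known for harmonic polynomials. A continuous function is uniformly close
  to one of them on the circle, hence near the circle, and the level measures leave every compact
  subset of the disk as r tends to 0.\<close>

lemma boundary_measure_exists:
  assumes b: "b \<in> borel_measurable arc_measure" "(\<integral>\<^sup>+\<zeta>. b \<zeta> \<partial>arc_measure) < \<infinity>"
    and mom: "\<And>q. (LINT z|riesz. Re (poly q z)) = (LINT \<zeta>|density arc_measure b. Re (poly q \<zeta>))"
  shows "boundary_measure (\<lambda>z. ereal (u z))
    (distr (density arc_measure b) (restrict_space borel (cball 0 1)) (\<lambda>z. z))"
proof -
  define P where "P = density arc_measure b"
  define \<mu> where "\<mu> = distr P (restrict_space borel (cball 0 1)) (\<lambda>z::complex. z)"
  have spP: "space P = sphere 0 1" by (simp add: P_def space_arc_measure)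
  have id: "(\<lambda>z. z) \<in> P \<rightarrow>\<^sub>M restrict_space borel (cball 0 1)"
    using borel_measurable_arcI[of "\<lambda>z. z"]
    by (intro measurable_restrict_space2) (auto simp: P_def space_arc_measure)
  have finP: "finite_measure P"
  proof
    have "sphere 0 1 \<in> sets arc_measure" using sets.top[of arc_measure] by (simp add: space_arc_measure)
    then have "emeasure P (space P) = (\<integral>\<^sup>+\<zeta>. b \<zeta> * indicator (sphere 0 1) \<zeta> \<partial>arc_measure)"
      unfolding spP using b(1) by (simp add: P_def emeasure_density)
    also have "\<dots> = (\<integral>\<^sup>+\<zeta>. b \<zeta> \<partial>arc_measure)"
      by (intro nn_integral_cong) (simp add: space_arc_measure)
    finally show "emeasure P (space P) \<noteq> \<infinity>" using b(2) by simp
  qed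
  interpret P: finite_measure P by (rule finP)
  have s\<mu>: "sets \<mu> = sets (restrict_space borel (cball 0 1))" by (simp add: \<mu>_def)
  have fin\<mu>: "finite_measure \<mu>" unfolding \<mu>_def by (rule P.finite_measure_distr[OF id])
  have "\<forall>r. \<exists>M. r < 0 \<longrightarrow> level_measure (\<lambda>z. ereal (u z)) r M" using level_measure_exists by blast
  then obtain M where M: "\<And>r. r < 0 \<Longrightarrow> level_measure (\<lambda>z. ereal (u z)) r (M r)" by metis
  have ucd: "continuous_on disk (\<lambda>z. ereal (u z))"
    using continuous_on_subset[OF u_cont] by (auto intro!: continuous_on_ereal)
  have negd: "ereal (u z) < 0" if "z \<in> disk" for z using u_neg[OF that] by simp
  have fM: "finite_measure (M r)" if "r < 0" for r
    by (rule level_measure_harmonic(1)[OF ucd u_tendsto_0 has_laplacian_riesz finite_riesz that M[OF that]])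
  have sM: "sets (M r) = sets (restrict_space borel disk)" if "r < 0" for r
    using M[OF that] by (simp add: level_measure_def)
  have spM: "space (M r) = disk" if "r < 0" for r
    using sets_eq_imp_space_eq[OF sM[OF that]] by (simp add: space_restrict_space)
  have harm: "((\<lambda>r. LINT z|M r. Re (poly q z)) \<longlongrightarrow> (LINT z|P. Re (poly q z))) (at_left 0)" for q
    using boundary_measure_harmonic[OF ucd negd u_tendsto_0 has_laplacian_riesz finite_riesz M, of q] mom[of q]
    unfolding P_def by simp
  have neg_ev: "eventually (\<lambda>r::real. r < 0) (at_left 0)"
    by (simp add: eventually_at_filter)
  define m where "m = measure P (space P) + 1"
  have m0: "m > 0" unfolding m_def using measure_nonneg[of P "space P"] by linarith
  have mass: "eventually (\<lambda>r. measure (M r) disk < m) (at_left 0)"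
  proof -
    have "((\<lambda>r. LINT z|M r. (1::real)) \<longlongrightarrow> (LINT z|P. 1)) (at_left 0)" using harm[of 1] by simp
    then have "eventually (\<lambda>r. (LINT z|M r. (1::real)) < m) (at_left 0)"
      by (rule order_tendstoD(2)) (simp add: m_def)
    then show ?thesis using neg_ev by eventually_elim (simp add: spM)
  qed
  have vanish: "eventually (\<lambda>r. emeasure (M r) (cball 0 (radius n)) = 0) (at_left 0)" for n
  proof -
    have "cball (0::complex) (radius (Suc n)) \<noteq> {}" using radius_bounds(1)[of "Suc n"] by simp
    then obtain x where x: "x \<in> cball 0 (radius (Suc n))" "\<And>z. z \<in> cball 0 (radius (Suc n)) \<Longrightarrow> u z \<le> u x"
      using continuous_attains_sup[OF compact_cball, of 0 "radius (Suc n)" u] continuous_on_subset[OF u_cont] by blast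
    have "u x < 0" using x(1) radius_bounds(3)[of "Suc n"] by (intro u_neg) auto
    then have "eventually (\<lambda>r. u x < r) (at_left 0)"
      by (auto simp: eventually_at_left_field)
    then show ?thesis using neg_ev
    proof eventually_elim
      case (elim r)
      show ?case
      proof (rule level_measure_vanishes[OF M[OF elim(2)]])
        show "ereal (u z) < ereal r" if "norm z \<le> radius (Suc n)" for z
          using x(2)[of z] elim(1) that by simp
      qed auto
    qed
  qed
  have conv: "((\<lambda>r. LINT z|M r. f z) \<longlongrightarrow> (LINT z|P. f z)) (at_left 0)"
    if f: "continuous_on (cball 0 1) f" for f :: "complex \<Rightarrow> real"
  proof (rule tendstoI)
    fix e :: real assume e: "0 < e"
    \<comment> \<open>Three errors share the budget: f against g under the limit measure, the
      convergence for g, and f against g under \<open>M r\<close>. Each is at most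
      \<open>e / 4\<close>, because both total masses are at most \<open>m\<close>.\<close>
    define \<epsilon> where "\<epsilon> = e / (4 * m)"
    have \<epsilon>: "\<epsilon> > 0" using e m0 by (simp add: \<epsilon>_def)
    have fs: "continuous_on (sphere 0 1) f" by (rule continuous_on_subset[OF f]) auto
    obtain q where q: "\<And>\<zeta>. norm \<zeta> = 1 \<Longrightarrow> \<bar>f \<zeta> - Re (poly q \<zeta>)\<bar> < \<epsilon>"
      by (rule circle_approximation[OF fs \<epsilon>]) (rule that)
    define g where "g = (\<lambda>z. Re (poly q z))"
    have gc: "continuous_on S g" for S unfolding g_def by (intro continuous_intros)
    \<comment> \<open>The approximation of f by g is controlled on the circle only. The set where it
      fails is compact in the open disk and carries no mass once r is close to 0.\<close>
    define K where "K = {z \<in> cball 0 1. \<epsilon> \<le> \<bar>f z - g z\<bar>}"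
    have "closed (cball 0 1 \<inter> (\<lambda>z. \<bar>f z - g z\<bar>) -` {\<epsilon>..})"
      by (rule continuous_closed_preimage) (auto intro!: continuous_intros f gc)
    then have "compact (cball 0 1 \<inter> (cball 0 1 \<inter> (\<lambda>z. \<bar>f z - g z\<bar>) -` {\<epsilon>..}))"
      by (intro compact_Int_closed) auto
    also have "cball 0 1 \<inter> (cball 0 1 \<inter> (\<lambda>z. \<bar>f z - g z\<bar>) -` {\<epsilon>..}) = K" by (auto simp: K_def)
    finally have "compact K" .
    moreover have "K \<subseteq> disk"
    proof
      fix z assume z: "z \<in> K"
      then have "norm z \<noteq> 1" using q[of z] by (auto simp: K_def g_def)
      then show "z \<in> disk" using z by (simp add: K_def)
    qed
    ultimately obtain s where s: "0 \<le> s" "s < 1" "\<And>z. z \<in> K \<Longrightarrow> norm z \<le> s"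
      by (rule compact_in_disk) (rule that; assumption)
    obtain n where n: "s < radius n"
      using eventually_radius[OF s(2)] unfolding eventually_sequentially by blast
    have P1: "\<bar>(LINT z|P. f z) - (LINT z|P. g z)\<bar> \<le> e / 4"
    proof -
      have i: "integrable P f" "integrable P g"
      proof -
        have "integrable P h" if h: "continuous_on (sphere 0 1) h" for h :: "complex \<Rightarrow> real"
        proof -
          have "bounded (h ` sphere 0 1)" by (intro compact_imp_bounded compact_continuous_image h) auto
          then obtain C where "\<forall>z\<in>sphere 0 1. \<bar>h z\<bar> \<le> C" unfolding bounded_iff by auto
          moreover have "h \<in> borel_measurable P"
            using borel_measurable_integrable[OF integrable_arc_continuous[OF h]] by (simp add: P_def)
          ultimately show ?thesis
            by (intro P.integrable_const_bound[of h C] AE_I2) (auto simp: spP)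
        qed
        then show "integrable P f" "integrable P g" using fs gc by auto
      qed
      have "(LINT z|P. f z) - (LINT z|P. g z) = (LINT z|P. f z - g z)" using i by simp
      also have "\<bar>\<dots>\<bar> \<le> (LINT z|P. \<bar>f z - g z\<bar>)" by (rule integral_abs_bound)
      also have "\<dots> \<le> (LINT z|P. \<epsilon>)"
        using i q by (intro integral_mono) (auto simp: spP g_def intro: less_imp_le)
      also have "\<dots> \<le> \<epsilon> * m" using \<epsilon> by (simp add: m_def mult.commute)
      also have "\<dots> = e / 4" using m0 by (simp add: \<epsilon>_def)
      finally show ?thesis .
    qed
    have "eventually (\<lambda>r. dist (LINT z|M r. g z) (LINT z|P. g z) < e / 4) (at_left 0)"
      using e unfolding g_def by (intro tendstoD[OF harm]) simp
    then show "eventually (\<lambda>r. dist (LINT z|M r. f z) (LINT z|P. f z) < e) (at_left 0)"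
      using neg_ev mass vanish[of n]
    proof eventually_elim
      case (elim r)
      interpret M: finite_measure "M r" by (rule fM[OF elim(2)])
      note sp = spM[OF elim(2)]
      have i: "integrable (M r) h" if h: "continuous_on (cball 0 1) h" for h :: "complex \<Rightarrow> real"
      proof -
        have "bounded (h ` cball 0 1)" by (intro compact_imp_bounded compact_continuous_image h) auto
        then obtain C where "\<forall>z\<in>cball 0 1. \<bar>h z\<bar> \<le> C" unfolding bounded_iff by auto
        moreover have "h \<in> borel_measurable (M r)"
          using borel_measurable_continuous_on_restrict[OF continuous_on_subset[OF h ball_subset_cball]]
          by (simp add: measurable_cong_sets[OF sM[OF elim(2)] refl])
        ultimately show ?thesis
          by (intro M.integrable_const_bound[of h C] AE_I2) (auto simp: sp)
      qed
      have ae: "AE z in M r. \<bar>f z - g z\<bar> \<le> \<epsilon>"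
      proof (rule AE_I'[of "cball 0 (radius n)"])
        have "cball 0 (radius n) \<in> sets (M r)"
          unfolding sM[OF elim(2)] using radius_bounds(3)[of n] by (auto simp: sets_restrict_space_iff)
        then show "cball 0 (radius n) \<in> null_sets (M r)" using elim(4) by (simp add: null_sets_def)
        show "{z \<in> space (M r). \<not> \<bar>f z - g z\<bar> \<le> \<epsilon>} \<subseteq> cball 0 (radius n)"
        proof
          fix z assume "z \<in> {z \<in> space (M r). \<not> \<bar>f z - g z\<bar> \<le> \<epsilon>}"
          then have "z \<in> K" by (auto simp: K_def sp)
          then show "z \<in> cball 0 (radius n)" using s(3)[of z] n by simp
        qed
      qed
      have "(LINT z|M r. f z) - (LINT z|M r. g z) = (LINT z|M r. f z - g z)" using i[OF f] i[OF gc] by simp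
      also have "\<bar>\<dots>\<bar> \<le> (LINT z|M r. \<bar>f z - g z\<bar>)" by (rule integral_abs_bound)
      also have "\<dots> \<le> (LINT z|M r. \<epsilon>)"
        by (rule integral_mono_AE[OF _ _ ae]) (use i[OF f] i[OF gc] in auto)
      also have "\<dots> \<le> \<epsilon> * m" using \<epsilon> elim(3) by (simp add: sp mult.commute)
      also have "\<dots> = e / 4" using m0 by (simp add: \<epsilon>_def)
      finally have "\<bar>(LINT z|M r. f z) - (LINT z|M r. g z)\<bar> \<le> e / 4" .
      then show ?case using P1 elim(1) e unfolding dist_real_def by linarith
    qed
  qed
  have i\<mu>: "(LINT z|\<mu>. f z) = (LINT z|P. f z)" if "continuous_on (cball 0 1) f" for f :: "complex \<Rightarrow> real"
    unfolding \<mu>_def by (rule integral_distr[OF id borel_measurable_continuous_on_restrict[OF that]])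
  show ?thesis
    unfolding boundary_measure_def P_def[symmetric] \<mu>_def[symmetric]
    using s\<mu> fin\<mu> M conv i\<mu> by (intro conjI exI[of _ M]) auto
qed

end

section \<open>Sub-mean value property\<close>

lemma partial_deriv_linear:
  assumes "smooth f"
  shows "partial_deriv v f z = Re v * partial_deriv 1 f z + Im v * partial_deriv \<i> f z"
proof -
  interpret linear "\<lambda>v. partial_deriv v f z"
    using has_derivative_linear[OF smooth_has_derivative[OF assms]] .
  have "v = Re v *\<^sub>R 1 + Im v *\<^sub>R \<i>" by (simp add: complex_eq_iff)
  then have "partial_deriv v f z = partial_deriv (Re v *\<^sub>R 1 + Im v *\<^sub>R \<i>) f z" by simp
  then show ?thesis by (simp only: add scale real_scaleR_def)
qed

lemma smooth_radial_derivative: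
  assumes "smooth f"
  shows "((\<lambda>\<rho>. f (a + of_real \<rho> * cis t)) has_real_derivative
    cos t * partial_deriv 1 f (a + of_real \<rho> * cis t) + sin t * partial_deriv \<i> f (a + of_real \<rho> * cis t)) (at \<rho>)"
  using dir_deriv_at[OF dir_deriv_smooth[OF assms, of "cis t"], of a \<rho>]
  unfolding partial_deriv_linear[OF assms, of "cis t"] by simp

lemma smooth_angular_derivative:
  assumes "smooth f"
  shows "((\<lambda>t. f (a + of_real \<rho> * cis t)) has_real_derivative
    \<rho> * (- sin t * partial_deriv 1 f (a + of_real \<rho> * cis t) + cos t * partial_deriv \<i> f (a + of_real \<rho> * cis t))) (at t)"
proof -
  have "((\<lambda>t. a + of_real \<rho> * cis t) has_derivative (\<lambda>h. h *\<^sub>R (of_real \<rho> * (\<i> * cis t)))) (at t)"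
    by (auto intro!: derivative_eq_intros simp: scaleR_conv_of_real mult_ac)
  from has_derivative_compose[OF this smooth_has_derivative[OF assms]]
  have "((\<lambda>t. f (a + of_real \<rho> * cis t)) has_derivative
      (\<lambda>h. partial_deriv (h *\<^sub>R (of_real \<rho> * (\<i> * cis t))) f (a + of_real \<rho> * cis t))) (at t)" .
  then show ?thesis
    unfolding has_field_derivative_def
    by (rule has_derivative_eq_rhs)
       (simp add: fun_eq_iff partial_deriv_linear[OF assms, of "_ *\<^sub>R _"] algebra_simps)
qed

text \<open>Let E and T be the radial and tangential components of the gradient on the circle of
  radius \<rho>. Then d/d\<rho> (\<rho> E) + d/dt T = \<rho> \<Delta>V, and T is periodic, so its
  derivative integrates to 0 over a full turn. The integral of \<rho> E therefore vanishes at \<rho>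
  = 0 and is nondecreasing; hence the circular means, whose derivative is the integral of E,
  increase from the value at the centre.\<close>

lemma smooth_sub_mean_value:
  assumes V: "smooth V" and lap: "\<And>z. z \<in> cball a r \<Longrightarrow> 0 \<le> laplacian V z" and r: "0 < r"
  shows "V a \<le> (LINT \<zeta>|arc_measure. V (a + of_real r * \<zeta>))"
proof -
  define A Bf where "A = partial_deriv 1 V" and "Bf = partial_deriv \<i> V"
  have sA: "smooth A" and sB: "smooth Bf" unfolding A_def Bf_def by (rule smooth_partial_deriv[OF V]; simp)+
  define p where "p \<rho> t = a + of_real \<rho> * cis t" for \<rho> t
  define E where "E \<rho> t = cos t * A (p \<rho> t) + sin t * Bf (p \<rho> t)" for \<rho> t
  define T where "T \<rho> t = - sin t * A (p \<rho> t) + cos t * Bf (p \<rho> t)" for \<rho> t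
  define E1 where "E1 \<rho> t = E \<rho> t + \<rho> * (cos t * (cos t * partial_deriv 1 A (p \<rho> t) + sin t * partial_deriv \<i> A (p \<rho> t))
     + sin t * (cos t * partial_deriv 1 Bf (p \<rho> t) + sin t * partial_deriv \<i> Bf (p \<rho> t)))" for \<rho> t
  define T1 where "T1 \<rho> t = - E \<rho> t + \<rho> * (- sin t * (- sin t * partial_deriv 1 A (p \<rho> t) + cos t * partial_deriv \<i> A (p \<rho> t))
     + cos t * (- sin t * partial_deriv 1 Bf (p \<rho> t) + cos t * partial_deriv \<i> Bf (p \<rho> t)))" for \<rho> t
  have cp: "continuous_on UNIV (\<lambda>(\<rho>, t). f (p \<rho> t))" if "smooth f" for f
    unfolding p_def case_prod_beta'
    by (rule continuous_on_compose2[OF smooth_continuous_on[OF that, of UNIV]]) (auto intro!: continuous_intros)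
  have cp1: "continuous_on UNIV (\<lambda>x. f (p (fst x) (snd x)))" if "smooth f" for f
    using cp[OF that] by (simp add: case_prod_beta')
  have cE: "continuous_on UNIV (\<lambda>x. E (fst x) (snd x))"
    unfolding E_def by (intro continuous_intros cp1 sA sB)
  have cE1: "continuous_on UNIV (\<lambda>x. E1 (fst x) (snd x))"
    unfolding E1_def by (intro continuous_intros cE cp1 smooth_partial_deriv sA sB) auto
  have slice: "continuous_on UNIV (\<lambda>t. g \<rho> t)" if "continuous_on UNIV (\<lambda>x. g (fst x) (snd x))" for g :: "real \<Rightarrow> real \<Rightarrow> real" and \<rho>
  proof -
    have "continuous_on UNIV (\<lambda>t. g (fst (\<rho>, t)) (snd (\<rho>, t)))"
      by (rule continuous_on_compose2[OF that, of UNIV "\<lambda>t. (\<rho>, t)"])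
         (auto intro!: continuous_on_Pair continuous_on_const continuous_on_id)
    then show ?thesis by simp
  qed
  have int: "g \<rho> integrable_on cbox 0 (2 * pi)" if "continuous_on UNIV (\<lambda>x. g (fst x) (snd x))" for g :: "real \<Rightarrow> real \<Rightarrow> real" and \<rho>
    by (rule integrable_continuous[OF continuous_on_subset[OF slice[OF that]]]) simp
  have dE: "((\<lambda>\<rho>. V (p \<rho> t)) has_real_derivative E \<rho> t) (at \<rho>)" for \<rho> t
    unfolding p_def E_def A_def Bf_def by (rule smooth_radial_derivative[OF V])
  have dE1: "((\<lambda>\<rho>. \<rho> * E \<rho> t) has_real_derivative E1 \<rho> t) (at \<rho>)" for \<rho> t
  proof -
    have "((\<lambda>\<rho>. E \<rho> t) has_real_derivative
      cos t * (cos t * partial_deriv 1 A (p \<rho> t) + sin t * partial_deriv \<i> A (p \<rho> t))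
      + sin t * (cos t * partial_deriv 1 Bf (p \<rho> t) + sin t * partial_deriv \<i> Bf (p \<rho> t))) (at \<rho>)"
      unfolding E_def p_def
      by (intro DERIV_add DERIV_cmult smooth_radial_derivative sA sB)
    from DERIV_mult[OF DERIV_ident this] show ?thesis by (simp add: E1_def algebra_simps)
  qed
  have dT: "(T \<rho> has_real_derivative T1 \<rho> t) (at t)" for \<rho> t
  proof -
    have "((\<lambda>t. - sin t * A (p \<rho> t) + cos t * Bf (p \<rho> t)) has_real_derivative
      (- cos t * A (p \<rho> t) + (\<rho> * (- sin t * partial_deriv 1 A (p \<rho> t) + cos t * partial_deriv \<i> A (p \<rho> t))) * - sin t)
      + (- sin t * Bf (p \<rho> t) + (\<rho> * (- sin t * partial_deriv 1 Bf (p \<rho> t) + cos t * partial_deriv \<i> Bf (p \<rho> t))) * cos t)) (at t)"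
      unfolding p_def
      by (intro DERIV_add DERIV_mult smooth_angular_derivative sA sB DERIV_minus DERIV_sin DERIV_cos)
    then show ?thesis unfolding T_def[abs_def] T1_def E_def by (simp add: algebra_simps)
  qed
  have ET: "E1 \<rho> t = \<rho> * laplacian V (p \<rho> t) - T1 \<rho> t" for \<rho> t
  proof -
    have "E1 \<rho> t + T1 \<rho> t = \<rho> * ((cos t)\<^sup>2 + (sin t)\<^sup>2) * (partial_deriv 1 A (p \<rho> t) + partial_deriv \<i> Bf (p \<rho> t))"
      unfolding E1_def T1_def by algebra
    then show ?thesis by (simp add: laplacian_def A_def Bf_def)
  qed
  define m where "m \<rho> = integral (cbox 0 (2 * pi)) (\<lambda>t. V (p \<rho> t))" for \<rho>
  define e where "e \<rho> = integral (cbox 0 (2 * pi)) (E \<rho>)" for \<rho>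
  have dm: "(m has_real_derivative e \<rho>) (at \<rho>)" for \<rho>
    unfolding m_def[abs_def] e_def
    by (rule leibniz_rule_field_derivative[of UNIV])
       (use dE int[OF cp1[OF V]] continuous_on_subset[OF cE] in \<open>auto simp: case_prod_beta'\<close>)
  have dq: "((\<lambda>\<rho>. integral (cbox 0 (2 * pi)) (\<lambda>t. \<rho> * E \<rho> t)) has_real_derivative integral (cbox 0 (2 * pi)) (E1 \<rho>)) (at \<rho>)" for \<rho>
    by (rule leibniz_rule_field_derivative[of UNIV])
       (use dE1 int[OF continuous_on_mult[OF continuous_on_fst[OF continuous_on_id] cE]] continuous_on_subset[OF cE1] in \<open>auto simp: case_prod_beta'\<close>)
  have E1_nonneg: "0 \<le> integral (cbox 0 (2 * pi)) (E1 \<rho>)" if \<rho>: "0 \<le> \<rho>" "\<rho> \<le> r" for \<rho>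
  proof -
    have "(T1 \<rho> has_integral T \<rho> (2 * pi) - T \<rho> 0) {0..2 * pi}"
      by (rule fundamental_theorem_of_calculus)
         (use dT in \<open>auto simp: has_real_derivative_iff_has_vector_derivative[symmetric] intro: has_field_derivative_at_within\<close>)
    moreover have "T \<rho> (2 * pi) = T \<rho> 0" by (simp add: T_def p_def)
    ultimately have T1: "(T1 \<rho> has_integral 0) (cbox 0 (2 * pi))" by simp
    have "((\<lambda>t. E1 \<rho> t + T1 \<rho> t) has_integral integral (cbox 0 (2 * pi)) (E1 \<rho>) + 0) (cbox 0 (2 * pi))"
      by (rule has_integral_add[OF integrable_integral[OF int[OF cE1]] T1])
    then show ?thesis
    proof (rule has_integral_nonneg[where f="\<lambda>t. E1 \<rho> t + T1 \<rho> t", THEN ord_le_eq_trans])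
      fix t
      have "p \<rho> t \<in> cball a r" using \<rho> by (simp add: p_def dist_norm norm_mult)
      then show "0 \<le> E1 \<rho> t + T1 \<rho> t" unfolding ET using lap \<rho> by simp
    qed simp
  qed
  have e_nonneg: "0 \<le> e \<rho>" if \<rho>: "0 < \<rho>" "\<rho> \<le> r" for \<rho>
  proof -
    have "integral (cbox 0 (2 * pi)) (\<lambda>t. 0 * E 0 t) \<le> integral (cbox 0 (2 * pi)) (\<lambda>t. \<rho> * E \<rho> t)"
      by (rule DERIV_nonneg_imp_nondecreasing[of 0 \<rho> "\<lambda>\<rho>. integral (cbox 0 (2 * pi)) (\<lambda>t. \<rho> * E \<rho> t)"])
         (use \<rho> dq E1_nonneg in \<open>auto intro!: exI\<close>)
    then have "0 \<le> \<rho> * e \<rho>" by (simp add: e_def)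
    then show ?thesis using \<rho> by (simp add: zero_le_mult_iff)
  qed
  obtain \<xi> where \<xi>: "0 < \<xi>" "\<xi> < r" "m r - m 0 = (r - 0) * e \<xi>"
    using MVT2[of 0 r m e] r dm by blast
  have "0 \<le> (r - 0) * e \<xi>" using e_nonneg[of \<xi>] \<xi> r by (intro mult_nonneg_nonneg) auto
  then have "m 0 \<le> m r" using \<xi>(3) by linarith
  moreover have "m 0 = 2 * pi * V a" by (simp add: m_def p_def)
  moreover have "m r = 2 * pi * (LINT \<zeta>|arc_measure. V (a + of_real r * \<zeta>))"
  proof -
    have "continuous_on (sphere 0 1) (\<lambda>\<zeta>. V (a + of_real r * \<zeta>))"
      by (rule continuous_on_compose2[OF smooth_continuous_on[OF V, of UNIV]]) (auto intro!: continuous_intros)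
    from integral_unique[OF has_integral_arc[OF this]] show ?thesis
      by (simp add: m_def p_def)
  qed
  ultimately show ?thesis by simp
qed

section \<open>The building blocks\<close>

lemma partial_deriv_Re: "partial_deriv v Re = (\<lambda>z. Re v)"
  and partial_deriv_Im: "partial_deriv v Im = (\<lambda>z. Im v)"
  by (intro ext partial_deriv_eqI bounded_linear_imp_has_derivative bounded_linear_Re bounded_linear_Im)+

lemma partial_deriv_norm_square:
  "partial_deriv v (\<lambda>z. (norm z)\<^sup>2) = (\<lambda>z. 2 * (Re v * Re z + Im v * Im z))"
proof -
  have "(\<lambda>z. (norm z)\<^sup>2) = (\<lambda>z. Re z * Re z + Im z * Im z)"
    by (simp add: cmod_power2 fun_eq_iff) (simp add: power2_eq_square)
  then show ?thesis
    by (simp add: partial_deriv_add partial_deriv_mult smooth_mult smooth_Re smooth_Im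
      partial_deriv_Re partial_deriv_Im fun_eq_iff algebra_simps)
qed

lemma smooth_norm_power: "smooth (\<lambda>z. norm z ^ (2 * m))"
proof (induction m)
  case (Suc m)
  have "smooth (\<lambda>z. (norm z)\<^sup>2 * norm z ^ (2 * m))" by (rule smooth_mult[OF smooth_norm_square Suc])
  then show ?case by (simp add: power_add[symmetric])
qed (simp add: smooth_const)

lemma partial_deriv_norm_power:
  "partial_deriv v (\<lambda>z. norm z ^ (2 * Suc m)) = (\<lambda>z. real (Suc m) * norm z ^ (2 * m) * (2 * (Re v * Re z + Im v * Im z)))"
proof
  fix z
  have d: "((\<lambda>t. t ^ Suc m) has_real_derivative real (Suc m) * t ^ m) (at t)" for t :: real
    using DERIV_pow[of "Suc m" t UNIV] by simp
  have "partial_deriv v (\<lambda>z. ((norm z)\<^sup>2) ^ Suc m) z = real (Suc m) * ((norm z)\<^sup>2) ^ m * partial_deriv v (\<lambda>z. (norm z)\<^sup>2) z"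
    by (rule partial_deriv_comp(1)[OF d smooth_differentiable[OF smooth_norm_square]])
  then show "partial_deriv v (\<lambda>z. norm z ^ (2 * Suc m)) z = real (Suc m) * norm z ^ (2 * m) * (2 * (Re v * Re z + Im v * Im z))"
    unfolding partial_deriv_norm_square power_mult[symmetric] .
qed

text \<open>The two successors let both differentiations lower the exponent without truncated
  subtraction.\<close>

lemma laplacian_norm_power:
  "laplacian (\<lambda>z. norm z ^ (2 * Suc (Suc m))) z = 4 * (real (Suc (Suc m)))\<^sup>2 * norm z ^ (2 * Suc m)"
proof -
  define c where "c = real (Suc (Suc m))"
  have lin: "smooth (\<lambda>z. 2 * (Re v * Re z + Im v * Im z))" for v
    by (intro smooth_cmult smooth_add smooth_Re smooth_Im)
  have plin: "partial_deriv v (\<lambda>z. 2 * (Re v * Re z + Im v * Im z)) z = 2 * ((Re v)\<^sup>2 + (Im v)\<^sup>2)" for v z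
  proof (rule partial_deriv_eqI[THEN trans])
    show "((\<lambda>z. 2 * (Re v * Re z + Im v * Im z)) has_derivative (\<lambda>h. 2 * (Re v * Re h + Im v * Im h))) (at z)"
      by (auto intro!: derivative_eq_intros)
  qed (simp add: power2_eq_square)
  have "partial_deriv v (partial_deriv v (\<lambda>z. norm z ^ (2 * Suc (Suc m)))) z =
     c * norm z ^ (2 * Suc m) * (2 * ((Re v)\<^sup>2 + (Im v)\<^sup>2)) +
     c * (real (Suc m) * norm z ^ (2 * m) * (2 * (Re v * Re z + Im v * Im z))) * (2 * (Re v * Re z + Im v * Im z))" for v
  proof -
    have s: "smooth (\<lambda>z. c * norm z ^ (2 * Suc m))" by (intro smooth_cmult smooth_norm_power)
    have pc: "partial_deriv v (\<lambda>z. c * norm z ^ (2 * Suc m)) = (\<lambda>z. c * (real (Suc m) * norm z ^ (2 * m) * (2 * (Re v * Re z + Im v * Im z))))"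
    proof
      fix z
      have "partial_deriv v (\<lambda>z. c) z = 0" by (rule partial_deriv_eqI) auto
      then show "partial_deriv v (\<lambda>z. c * norm z ^ (2 * Suc m)) z = c * (real (Suc m) * norm z ^ (2 * m) * (2 * (Re v * Re z + Im v * Im z)))"
        unfolding partial_deriv_mult[OF smooth_const smooth_norm_power] partial_deriv_norm_power by simp
    qed
    show ?thesis
      unfolding partial_deriv_norm_power[of v "Suc m"] c_def[symmetric] partial_deriv_mult[OF s lin] pc plin by simp
  qed
  then have "laplacian (\<lambda>z. norm z ^ (2 * Suc (Suc m))) z =
     4 * c * norm z ^ (2 * Suc m) + 4 * c * real (Suc m) * (norm z ^ (2 * m) * ((Re z)\<^sup>2 + (Im z)\<^sup>2))"
    unfolding laplacian_def by (simp add: power2_eq_square algebra_simps)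
  also have "norm z ^ (2 * m) * ((Re z)\<^sup>2 + (Im z)\<^sup>2) = norm z ^ (2 * Suc m)"
    by (simp add: cmod_power2[symmetric] power_add[symmetric])
  also have "4 * c * norm z ^ (2 * Suc m) + 4 * c * real (Suc m) * norm z ^ (2 * Suc m) = 4 * c\<^sup>2 * norm z ^ (2 * Suc m)"
    by (simp add: c_def power2_eq_square algebra_simps)
  finally show ?thesis by (simp add: c_def)
qed

lemma laplacian_mult:
  assumes f: "smooth f" and g: "smooth g"
  shows "laplacian (\<lambda>z. f z * g z) z = f z * laplacian g z + laplacian f z * g z +
    2 * (partial_deriv 1 f z * partial_deriv 1 g z + partial_deriv \<i> f z * partial_deriv \<i> g z)"
proof -
  have "partial_deriv v (partial_deriv v (\<lambda>z. f z * g z)) z =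
    f z * partial_deriv v (partial_deriv v g) z + partial_deriv v (partial_deriv v f) z * g z +
    2 * (partial_deriv v f z * partial_deriv v g z)" if v: "v \<in> {1, \<i>}" for v
    unfolding partial_deriv_mult[OF f g]
      partial_deriv_add[OF smooth_mult[OF f smooth_partial_deriv[OF g v]] smooth_mult[OF smooth_partial_deriv[OF f v] g]]
      partial_deriv_mult[OF f smooth_partial_deriv[OF g v]] partial_deriv_mult[OF smooth_partial_deriv[OF f v] g]
    by (simp add: algebra_simps)
  then show ?thesis by (simp add: laplacian_def algebra_simps)
qed

text \<open>\<open>block P m\<close> vanishes on the circle, where its normal derivative is \<open>Re P / (2 * pi)\<close>; it is
  small and has nonnegative Laplacian once \<open>m\<close> is large.\<close>

definition block :: "complex poly \<Rightarrow> nat \<Rightarrow> complex \<Rightarrow> real" where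
  "block P m z = 1 / (4 * pi * real (Suc (Suc m))) * (Re (poly P z) * (norm z ^ (2 * Suc (Suc m)) - 1))"

text \<open>The second summand is the Euler operator applied to P: it multiplies the coefficient of
  degree j by j. With c = m + 2 the bracket acts on the mode of degree j as multiplication by c +
  j.\<close>

definition block_laplacian :: "complex poly \<Rightarrow> nat \<Rightarrow> complex \<Rightarrow> real" where
  "block_laplacian P m z = 1 / pi * (norm z ^ (2 * Suc m) *
     (real (Suc (Suc m)) * Re (poly P z) + Re (z * poly (pderiv P) z)))"

lemma smooth_block: "smooth (block P m)"
  unfolding block_def[abs_def]
  by (intro smooth_cmult smooth_mult smooth_Re_poly smooth_diff smooth_norm_power smooth_const)

lemma laplacian_block: "laplacian (block P m) z = block_laplacian P m z"
proof -
  define c where "c = real (Suc (Suc m))"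
  define G where "G = (\<lambda>z::complex. norm z ^ (2 * Suc (Suc m)) - 1)"
  have c: "c > 0" by (simp add: c_def)
  have p0: "partial_deriv v (\<lambda>z. k) = (\<lambda>z. 0)" for v k by (intro ext partial_deriv_eqI) auto
  have sG: "smooth G" unfolding G_def by (intro smooth_diff smooth_norm_power smooth_const)
  have pG: "partial_deriv v G = partial_deriv v (\<lambda>z. norm z ^ (2 * Suc (Suc m)))" for v
    unfolding G_def diff_conv_add_uminus
    by (simp only: partial_deriv_add[OF smooth_norm_power smooth_const] p0 add_0_right)
  have lG: "laplacian G z = 4 * c\<^sup>2 * norm z ^ (2 * Suc m)"
    using laplacian_norm_power[of m z] unfolding laplacian_def pG c_def by simp
  have "laplacian (\<lambda>z. Re (poly P z) * G z) z = Re (poly P z) * (4 * c\<^sup>2 * norm z ^ (2 * Suc m)) +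
     2 * (Re (poly (pderiv P) z) * (c * norm z ^ (2 * Suc m) * (2 * Re z)) +
       Re (\<i> * poly (pderiv P) z) * (c * norm z ^ (2 * Suc m) * (2 * Im z)))"
    unfolding laplacian_mult[OF smooth_Re_poly sG] lG laplacian_Re_poly pG partial_deriv_norm_power
      partial_deriv_Re_poly c_def by simp
  also have "\<dots> = 4 * c * (norm z ^ (2 * Suc m) * (c * Re (poly P z) + Re (z * poly (pderiv P) z)))"
    by (simp add: algebra_simps power2_eq_square)
  finally have l: "laplacian (\<lambda>z. Re (poly P z) * G z) z = 4 * c * (norm z ^ (2 * Suc m) * (c * Re (poly P z) + Re (z * poly (pderiv P) z)))" .
  have "laplacian (\<lambda>z. 1 / (4 * pi * c) * (Re (poly P z) * G z)) z = 1 / (4 * pi * c) * laplacian (\<lambda>z. Re (poly P z) * G z) z"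
    by (subst laplacian_mult[OF smooth_const smooth_mult[OF smooth_Re_poly sG]]) (simp add: laplacian_def p0)
  moreover have "block P m = (\<lambda>z. 1 / (4 * pi * c) * (Re (poly P z) * G z))"
    by (simp only: block_def[abs_def] c_def G_def)
  ultimately have "laplacian (block P m) z =
      1 / (4 * pi * c) * (4 * c * (norm z ^ (2 * Suc m) * (c * Re (poly P z) + Re (z * poly (pderiv P) z))))"
    by (simp only: l)
  also have "1 / (4 * pi * c) * (4 * c * x) = 1 / pi * x" for x using c by simp
  finally show ?thesis by (simp only: block_laplacian_def c_def)
qed

text \<open>After expansion into modes, the weight (c + j) / \<pi> of the Laplacian meets the radial
  integral \<pi> / (c + k), where c = m + 2. Only j = k survives, so the two factors cancel and the
  moment is that of Re P on the circle, independent of m.\<close>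

lemma block_moment:
  "(LINT z:disk|lborel. Re (poly q z) * block_laplacian P m z) = (LINT \<zeta>|arc_measure. Re (poly q \<zeta>) * Re (poly P \<zeta>))"
proof -
  define a where "a j = coeff P j" for j
  define b where "b k = coeff q k" for k
  define n where "n = real (Suc (Suc m))"
  have zP: "z * poly (pderiv P) z = (\<Sum>j\<le>degree P. of_nat j * (a j * z ^ j))" for z
  proof -
    have "degree (pCons 0 (pderiv P)) \<le> degree P"
      by (cases "pderiv P = 0") (auto simp: degree_pderiv pderiv_eq_0_iff)
    then have "pCons 0 (pderiv P) = (\<Sum>j\<le>degree P. monom (coeff (pCons 0 (pderiv P)) j) j)"
      by (rule poly_as_sum_of_monoms'[symmetric])
    then have "z * poly (pderiv P) z = poly (\<Sum>j\<le>degree P. monom (coeff (pCons 0 (pderiv P)) j) j) z"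
      by (metis poly_pCons add_0)
    also have "\<dots> = (\<Sum>j\<le>degree P. of_nat j * (a j * z ^ j))"
      unfolding poly_sum poly_monom
      by (intro sum.cong refl) (auto simp: a_def coeff_pCons coeff_pderiv split: nat.split)
    finally show ?thesis .
  qed
  have nP: "n * Re (poly P z) + Re (z * poly (pderiv P) z) = (\<Sum>j\<le>degree P. (n + real j) * Re (a j * z ^ j))" for z
    unfolding zP by (simp add: poly_altdef a_def sum_distrib_left sum.distrib[symmetric] algebra_simps)
  have eq: "Re (poly q z) * block_laplacian P m z =
    (\<Sum>k\<le>degree q. \<Sum>j\<le>degree P. (n + real j) / pi * (norm z ^ (2 * Suc m) * (Re (a j * z ^ j) * Re (b k * z ^ k))))" for z
  proof -
    have "(\<Sum>k\<in>I. y k) * (1 / pi * (N * (\<Sum>j\<in>J. (n + real j) * x j))) =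
      (\<Sum>k\<in>I. \<Sum>j\<in>J. (n + real j) / pi * (N * (x j * y k)))" for I J and x y :: "nat \<Rightarrow> real" and N
      unfolding sum_distrib_right sum_distrib_left by (subst sum.swap, intro sum.cong refl) simp
    moreover have "Re (poly q z) = (\<Sum>k\<le>degree q. Re (b k * z ^ k))"
      by (simp only: poly_altdef b_def Re_sum)
    ultimately show ?thesis
      unfolding block_laplacian_def n_def[symmetric] nP by (simp only:)
  qed
  have si: "set_integrable lborel disk (\<lambda>z. (n + real j) / pi * (norm z ^ (2 * Suc m) * (Re (a j * z ^ j) * Re (b k * z ^ k))))" for j k
  proof -
    have "set_integrable lborel (cball 0 1) (\<lambda>z. (n + real j) / pi * (norm z ^ (2 * Suc m) * (Re (a j * z ^ j) * Re (b k * z ^ k))))"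
      unfolding set_integrable_def by (rule borel_integrable_compact) (auto intro!: continuous_intros)
    then show ?thesis by (rule set_integrable_subset) auto
  qed
  have "(LINT z:disk|lborel. Re (poly q z) * block_laplacian P m z) =
    (\<Sum>k\<le>degree q. \<Sum>j\<le>degree P. (LINT z:disk|lborel. (n + real j) / pi * (norm z ^ (2 * Suc m) * (Re (a j * z ^ j) * Re (b k * z ^ k)))))"
    unfolding eq set_lebesgue_integral_def scaleR_sum_right
    using si unfolding set_integrable_def
    by (subst Bochner_Integration.integral_sum; simp add: Bochner_Integration.integral_sum)
  also have "\<dots> = (\<Sum>k\<le>degree q. \<Sum>j\<le>degree P. mode_pair (a j) (b k) j k)"
  proof (intro sum.cong refl)
    fix k j
    have "(LINT z:disk|lborel. (n + real j) / pi * (norm z ^ (2 * Suc m) * (Re (a j * z ^ j) * Re (b k * z ^ k)))) =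
      (n + real j) / pi * (mode_pair (a j) (b k) j k * pi / real (Suc m + k + 1))"
      using disk_mode_pair[of "Suc m" "a j" j "b k" k] by (simp only: set_integral_mult_right)
    also have "\<dots> = mode_pair (a j) (b k) j k"
    proof (cases "j = k")
      case True
      have "n + real j = real (Suc m + k + 1)" using True by (simp add: n_def)
      then show ?thesis by simp
    qed (simp add: mode_pair_def)
    finally show "(LINT z:disk|lborel. (n + real j) / pi * (norm z ^ (2 * Suc m) * (Re (a j * z ^ j) * Re (b k * z ^ k)))) = mode_pair (a j) (b k) j k" .
  qed
  also have "\<dots> = (\<Sum>k\<le>degree q. \<Sum>j\<le>degree P. (LINT \<zeta>|arc_measure. Re (a j * \<zeta> ^ j) * Re (b k * \<zeta> ^ k)))"
    by (simp only: arc_mode_pair)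
  also have "\<dots> = (LINT \<zeta>|arc_measure. (\<Sum>k\<le>degree q. \<Sum>j\<le>degree P. Re (a j * \<zeta> ^ j) * Re (b k * \<zeta> ^ k)))"
  proof -
    have "integrable arc_measure (\<lambda>\<zeta>. Re (a j * \<zeta> ^ j) * Re (b k * \<zeta> ^ k))" for j k
      by (rule integrable_arc_continuous) (intro continuous_intros)
    then show ?thesis by (simp only: Bochner_Integration.integral_sum Bochner_Integration.integrable_sum)
  qed
  also have "\<dots> = (LINT \<zeta>|arc_measure. Re (poly q \<zeta>) * Re (poly P \<zeta>))"
    unfolding poly_altdef Re_sum sum_product a_def b_def
    by (intro Bochner_Integration.integral_cong sum.cong refl mult.commute)
  finally show ?thesis .
qed

section \<open>Lower semicontinuous densities as sums of positive harmonic polynomials\<close>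

lemma lsc_on_lower_bound:
  assumes "lsc_on S \<beta>" "x \<in> S" "y < \<beta> x"
  shows "\<exists>\<delta>>0. \<forall>\<eta>\<in>S. dist \<eta> x < \<delta> \<longrightarrow> y < \<beta> \<eta>"
proof -
  have "eventually (\<lambda>\<eta>. y < \<beta> \<eta>) (at x within S)"
    using assms unfolding lsc_on_def by (auto simp: le_Liminf_iff)
  then obtain \<delta> where \<delta>: "\<delta> > 0" "\<forall>\<eta>\<in>S. \<eta> \<noteq> x \<and> dist \<eta> x < \<delta> \<longrightarrow> y < \<beta> \<eta>"
    unfolding eventually_at by blast
  show ?thesis by (rule exI[of _ \<delta>]) (use \<delta> assms(3) in auto)
qed

text \<open>Inf-convolution of truncations of \<beta> with the penalty n dist: each
  \<open>g n\<close> is Lipschitz with constant n, and lower semicontinuity makes the sequence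
  exhaust \<beta> from below.\<close>

lemma lsc_on_lipschitz_approximation:
  fixes \<beta> :: "'a::metric_space \<Rightarrow> ereal" and c :: real
  assumes lsc: "lsc_on S \<beta>" and c: "\<And>x. x \<in> S \<Longrightarrow> ereal c \<le> \<beta> x" and ne: "S \<noteq> {}"
  obtains g :: "nat \<Rightarrow> 'a \<Rightarrow> real" where "\<And>n. continuous_on S (g n)"
    "\<And>n x. x \<in> S \<Longrightarrow> c \<le> g n x" "\<And>n x. x \<in> S \<Longrightarrow> ereal (g n x) \<le> \<beta> x"
    "\<And>n x. x \<in> S \<Longrightarrow> g n x \<le> g (Suc n) x"
    "\<And>x y. x \<in> S \<Longrightarrow> ereal y < \<beta> x \<Longrightarrow> \<exists>n0. \<forall>n\<ge>n0. y \<le> g n x"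
proof -
  \<comment> \<open>The truncation makes \<beta> real-valued; its height c + n, rather than n,
    preserves the lower bound c.\<close>
  define t where "t n x = real_of_ereal (min (\<beta> x) (ereal (c + real n)))" for n x
  have t: "ereal (t n x) = min (\<beta> x) (ereal (c + real n))" if "x \<in> S" for n x
  proof -
    have "ereal c \<le> min (\<beta> x) (ereal (c + real n))" using c[OF that] by simp
    moreover have "min (\<beta> x) (ereal (c + real n)) \<le> ereal (c + real n)" by simp
    ultimately have "\<bar>min (\<beta> x) (ereal (c + real n))\<bar> \<noteq> \<infinity>" by (cases "min (\<beta> x) (ereal (c + real n))") auto
    then show ?thesis by (simp add: t_def ereal_real')
  qed
  have tc: "c \<le> t n x" if "x \<in> S" for n x
  proof -
    have "ereal c \<le> ereal (t n x)" unfolding t[OF that] using c[OF that] by simp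
    then show ?thesis by simp
  qed
  have tSuc: "t n x \<le> t (Suc n) x" if "x \<in> S" for n x
  proof -
    have "ereal (t n x) \<le> ereal (t (Suc n) x)"
      unfolding t[OF that] by (intro min.mono) auto
    then show ?thesis by simp
  qed
  define g where "g n x = (INF y\<in>S. t n y + real n * dist x y)" for n x
  have bdd: "bdd_below ((\<lambda>y. t n y + real n * dist x y) ` S)" for n x
    by (rule bdd_belowI[of _ c]) (use tc in \<open>auto intro!: add_increasing2\<close>)
  have le: "g n x \<le> t n y + real n * dist x y" if "y \<in> S" for n x y
    unfolding g_def by (rule cINF_lower[OF bdd that])
  have ge: "a \<le> g n x" if "\<And>y. y \<in> S \<Longrightarrow> a \<le> t n y + real n * dist x y" for a n x
    unfolding g_def by (rule cINF_greatest[OF ne that])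
  show thesis
  proof (rule that)
    fix n
    have lip: "g n x \<le> g n x' + real n * dist x x'" for x x'
    proof -
      have "g n x - real n * dist x x' \<le> g n x'"
      proof (rule ge)
        fix y assume y: "y \<in> S"
        have "real n * dist x y \<le> real n * (dist x x' + dist x' y)"
          by (intro mult_left_mono dist_triangle) simp
        then show "g n x - real n * dist x x' \<le> t n y + real n * dist x' y"
          using le[OF y, of n x] by (simp add: distrib_left)
      qed
      then show ?thesis by simp
    qed
    show "continuous_on S (g n)"
    proof (rule continuous_onI)
      fix x e assume e: "(0::real) < e"
      have p: "e / (real n + 1) > 0" using e by simp
      have "dist (g n x') (g n x) \<le> e" if d: "dist x' x < e / (real n + 1)" for x'
      proof -
        have "\<bar>g n x' - g n x\<bar> \<le> real n * dist x' x"
          using lip[of x' x] lip[of x x'] by (simp add: dist_commute abs_le_iff)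
        also have "\<dots> \<le> (real n + 1) * (e / (real n + 1))"
          using d by (intro mult_mono) auto
        finally show ?thesis by (simp add: dist_real_def)
      qed
      then show "\<exists>d>0. \<forall>x'\<in>S. dist x' x < d \<longrightarrow> dist (g n x') (g n x) \<le> e" using p by blast
    qed
  next
    fix n x assume x: "x \<in> S"
    show "c \<le> g n x" by (rule ge) (use tc in \<open>auto intro!: add_increasing2\<close>)
    have "g n x \<le> t n x" using le[OF x, of n x] by simp
    then have "ereal (g n x) \<le> ereal (t n x)" by simp
    also have "\<dots> \<le> \<beta> x" unfolding t[OF x] by simp
    finally show "ereal (g n x) \<le> \<beta> x" .
    show "g n x \<le> g (Suc n) x"
    proof (rule ge)
      fix y assume y: "y \<in> S"
      have "real n * dist x y \<le> real (Suc n) * dist x y" by (intro mult_right_mono) auto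
      then show "g n x \<le> t (Suc n) y + real (Suc n) * dist x y"
        using le[OF y, of n x] tSuc[OF y, of n] by linarith
    qed
  next
    fix x y assume x: "x \<in> S" and y: "ereal y < \<beta> x"
    obtain \<delta> where \<delta>: "\<delta> > 0" "\<forall>\<eta>\<in>S. dist \<eta> x < \<delta> \<longrightarrow> ereal y < \<beta> \<eta>"
      using lsc_on_lower_bound[OF lsc x y] by blast
    \<comment> \<open>Beyond y - c the truncation height exceeds y, which settles the points near x.
      Beyond (y - c) / \<delta> the penalty alone exceeds y - c at distance at least \<delta>, where
      the truncation contributes at least c.\<close>
    obtain n0 :: nat where n0: "max (y - c) ((y - c) / \<delta>) < real n0" using reals_Archimedean2 by blast
    have "y \<le> g n x" if "n \<ge> n0" for n
    proof (rule ge)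
      fix \<eta> assume \<eta>: "\<eta> \<in> S"
      have n: "y - c < real n" "(y - c) / \<delta> < real n" using n0 that by auto
      show "y \<le> t n \<eta> + real n * dist x \<eta>"
      proof (cases "dist \<eta> x < \<delta>")
        case True
        then have "ereal y \<le> min (\<beta> \<eta>) (ereal (c + real n))"
          using \<delta>(2) \<eta> n(1) by (auto intro: less_imp_le)
        then have "y \<le> t n \<eta>" unfolding t[OF \<eta>, symmetric] by simp
        then show ?thesis by (simp add: add_increasing2)
      next
        case False
        have "y - c \<le> real n * \<delta>" using n(2) \<delta>(1) by (simp add: field_simps)
        also have "\<dots> \<le> real n * dist x \<eta>" using False by (intro mult_left_mono) (auto simp: dist_commute)
        finally show ?thesis using tc[OF \<eta>, of n] by linarith
      qed
    qed
    then show "\<exists>n0. \<forall>n\<ge>n0. y \<le> g n x" by blast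
  qed
qed

text \<open>Differences of polynomials that approximate an increasing sequence need not be positive.
  Approximating \<open>g n - 8 * \<epsilon> n\<close> instead, with errors below
  \<open>\<epsilon> n\<close>, turns the sequence into a strictly increasing one; its differences
  are the summands.\<close>

lemma lsc_harmonic_decomposition:
  fixes \<beta> :: "complex \<Rightarrow> ereal" and c :: real
  assumes lsc: "lsc_on (sphere 0 1) \<beta>" and c: "0 < c" "\<And>\<zeta>. norm \<zeta> = 1 \<Longrightarrow> ereal c \<le> \<beta> \<zeta>"
  obtains P :: "nat \<Rightarrow> complex poly" where "\<And>n \<zeta>. norm \<zeta> = 1 \<Longrightarrow> 0 < Re (poly (P n) \<zeta>)"
    "\<And>\<zeta>. norm \<zeta> = 1 \<Longrightarrow> (\<lambda>n. ennreal (Re (poly (P n) \<zeta>))) sums e2ennreal (\<beta> \<zeta>)"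
proof -
  have ne: "sphere (0::complex) 1 \<noteq> {}" by simp
  have cS: "ereal c \<le> \<beta> x" if "x \<in> sphere 0 1" for x using c(2) that by simp
  obtain g :: "nat \<Rightarrow> complex \<Rightarrow> real" where g: "\<And>n. continuous_on (sphere 0 1) (g n)"
    "\<And>n x. x \<in> sphere 0 1 \<Longrightarrow> c \<le> g n x" "\<And>n x. x \<in> sphere 0 1 \<Longrightarrow> ereal (g n x) \<le> \<beta> x"
    "\<And>n x. x \<in> sphere 0 1 \<Longrightarrow> g n x \<le> g (Suc n) x"
    "\<And>x y. x \<in> sphere 0 1 \<Longrightarrow> ereal y < \<beta> x \<Longrightarrow> \<exists>n0. \<forall>n\<ge>n0. y \<le> g n x"
    by ((rule lsc_on_lipschitz_approximation[OF lsc cS ne], assumption), (rule that; assumption))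
  \<comment> \<open>Halving makes the shift rise by \<open>8 * \<epsilon> (Suc n)\<close> from one
    term to the next, more than the two approximation errors, which total
    \<open>3 * \<epsilon> (Suc n)\<close>. The divisor 16 keeps the first polynomial positive, as
    \<open>9 * \<epsilon> 0 < c\<close>.\<close>
  define \<epsilon> where "\<epsilon> n = c / 2 ^ n / 16" for n
  have \<epsilon>: "\<epsilon> n > 0" "\<epsilon> n = 2 * \<epsilon> (Suc n)" for n using c(1) by (auto simp: \<epsilon>_def)
  have "\<exists>q. \<forall>\<zeta>. norm \<zeta> = 1 \<longrightarrow> \<bar>g n \<zeta> - 8 * \<epsilon> n - Re (poly q \<zeta>)\<bar> < \<epsilon> n" for n
  proof -
    have "continuous_on (sphere 0 1) (\<lambda>\<zeta>. g n \<zeta> - 8 * \<epsilon> n)" by (intro continuous_intros g)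
    then obtain q where "\<And>\<zeta>. norm \<zeta> = 1 \<Longrightarrow> \<bar>g n \<zeta> - 8 * \<epsilon> n - Re (poly q \<zeta>)\<bar> < \<epsilon> n"
      by (rule circle_approximation[OF _ \<epsilon>(1)]) (rule that)
    then show ?thesis by blast
  qed
  then obtain q where q: "\<And>n \<zeta>. norm \<zeta> = 1 \<Longrightarrow> \<bar>g n \<zeta> - 8 * \<epsilon> n - Re (poly (q n) \<zeta>)\<bar> < \<epsilon> n" by metis
  define P where "P n = (case n of 0 \<Rightarrow> q 0 | Suc k \<Rightarrow> q (Suc k) - q k)" for n
  have part: "(\<Sum>i<Suc n. Re (poly (P i) \<zeta>)) = Re (poly (q n) \<zeta>)" for n \<zeta>
    by (induction n) (auto simp: P_def)
  have pos: "0 < Re (poly (P n) \<zeta>)" if \<zeta>: "norm \<zeta> = 1" for n \<zeta>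
  proof (cases n)
    case 0
    have "\<epsilon> 0 = c / 16" by (simp add: \<epsilon>_def)
    then show ?thesis using q[OF \<zeta>, of 0] g(2)[of \<zeta> 0] \<zeta> c(1) by (simp add: 0 P_def)
  next
    case (Suc k)
    show ?thesis
      using q[OF \<zeta>, of k] q[OF \<zeta>, of "Suc k"] g(4)[of \<zeta> k] \<epsilon>(2)[of k] \<epsilon>(1)[of "Suc k"] \<zeta>
      by (simp add: Suc P_def)
  qed
  have sums: "(\<lambda>n. ennreal (Re (poly (P n) \<zeta>))) sums e2ennreal (\<beta> \<zeta>)" if \<zeta>: "norm \<zeta> = 1" for \<zeta>
  proof -
    have lim\<epsilon>: "\<epsilon> \<longlonglongrightarrow> 0"
      unfolding \<epsilon>_def[abs_def] using c(1) by real_asymp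
    have "(\<lambda>n. ereal (Re (poly (q n) \<zeta>))) \<longlonglongrightarrow> \<beta> \<zeta>"
    proof (rule order_tendstoI)
      fix a assume "a < \<beta> \<zeta>"
      then obtain y where y: "a < ereal y" "ereal y < \<beta> \<zeta>" using ereal_dense2 by blast
      then obtain y' where y': "ereal y < ereal y'" "ereal y' < \<beta> \<zeta>" using ereal_dense2 by blast
      obtain n0 where n0: "\<forall>n\<ge>n0. y' \<le> g n \<zeta>" using g(5)[of \<zeta> y'] y'(2) \<zeta> by auto
      \<comment> \<open>Shift and approximation error together lose at most
        \<open>9 * \<epsilon> n\<close> against \<open>g n\<close>.\<close>
      have "eventually (\<lambda>n. \<epsilon> n < (y' - y) / 9) sequentially"
        using y'(1) by (intro order_tendstoD(2)[OF lim\<epsilon>]) simp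
      then show "eventually (\<lambda>n. a < ereal (Re (poly (q n) \<zeta>))) sequentially"
        using eventually_ge_at_top[of n0]
      proof eventually_elim
        case (elim n)
        have "y' \<le> g n \<zeta>" using n0 elim(2) by blast
        then have "y < Re (poly (q n) \<zeta>)" using q[OF \<zeta>, of n] elim(1) by (simp add: abs_less_iff)
        then show ?case using y(1) by (simp add: less_trans)
      qed
    next
      fix a assume a: "\<beta> \<zeta> < a"
      have le: "ereal (Re (poly (q n) \<zeta>)) < a" for n
      proof -
        have "Re (poly (q n) \<zeta>) \<le> g n \<zeta>" using q[OF \<zeta>, of n] \<epsilon>(1)[of n] by linarith
        then have "ereal (Re (poly (q n) \<zeta>)) \<le> ereal (g n \<zeta>)" by simp
        also have "\<dots> \<le> \<beta> \<zeta>" using g(3)[of \<zeta> n] \<zeta> by simp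
        finally show ?thesis using a by (rule le_less_trans)
      qed
      show "eventually (\<lambda>n. ereal (Re (poly (q n) \<zeta>)) < a) sequentially"
        by (intro always_eventually allI le)
    qed
    then have "(\<lambda>n. e2ennreal (ereal (Re (poly (q n) \<zeta>)))) \<longlonglongrightarrow> e2ennreal (\<beta> \<zeta>)"
      by (rule tendsto_e2ennrealI)
    then have "(\<lambda>n. \<Sum>i<Suc n. ennreal (Re (poly (P i) \<zeta>))) \<longlonglongrightarrow> e2ennreal (\<beta> \<zeta>)"
      using pos[OF \<zeta>] unfolding part[symmetric] by (simp add: e2ennreal_ereal less_imp_le del: sum.lessThan_Suc)
    then show ?thesis unfolding sums_def by (rule LIMSEQ_imp_Suc)
  qed
  show thesis by (rule that[OF pos sums])
qed

section \<open>Construction of the exhaustion function\<close>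

text \<open>Finiteness of the integral makes the sum finite almost everywhere, and its real version
  F is an integrable majorant of the partial sums. The lemma serves both the Laplacians of the
  blocks in the plane and the polynomials on the circle.\<close>

lemma ennreal_series_integral:
  fixes f :: "nat \<Rightarrow> 'a \<Rightarrow> real"
  assumes f: "\<And>n. f n \<in> borel_measurable M" "\<And>n x. x \<in> space M \<Longrightarrow> 0 \<le> f n x"
    and fin: "(\<integral>\<^sup>+x. (\<Sum>n. ennreal (f n x)) \<partial>M) < \<infinity>"
  defines "F \<equiv> \<lambda>x. enn2real (\<Sum>n. ennreal (f n x))"
  shows "integrable M F" "AE x in M. (\<Sum>n. ennreal (f n x)) = ennreal (F x)"
    "AE x in M. (\<lambda>k. \<Sum>n<k. f n x) \<longlonglongrightarrow> F x" "AE x in M. \<forall>k. \<bar>\<Sum>n<k. f n x\<bar> \<le> F x"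
    and "\<And>g C. g \<in> borel_measurable M \<Longrightarrow> (\<And>x. x \<in> space M \<Longrightarrow> \<bar>g x\<bar> \<le> C) \<Longrightarrow>
      (\<lambda>k. \<Sum>n<k. LINT x|M. f n x * g x) \<longlonglongrightarrow> (LINT x|M. F x * g x :: real)"
proof -
  have fm: "(\<lambda>x. ennreal (f n x)) \<in> borel_measurable M" for n using f(1) by measurable
  have Sm: "(\<lambda>x. \<Sum>n. ennreal (f n x)) \<in> borel_measurable M" using fm by (rule borel_measurable_suminf_order)
  have Fm: "F \<in> borel_measurable M" unfolding F_def using Sm by measurable
  have ae: "AE x in M. (\<Sum>n. ennreal (f n x)) \<noteq> \<infinity>"
    using nn_integral_noteq_infinite[OF Sm] fin by auto
  then show eq: "AE x in M. (\<Sum>n. ennreal (f n x)) = ennreal (F x)"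
    by eventually_elim (simp add: F_def less_top)
  have F0: "0 \<le> F x" for x by (simp add: F_def)
  have "(\<integral>\<^sup>+x. ennreal (F x) \<partial>M) = (\<integral>\<^sup>+x. (\<Sum>n. ennreal (f n x)) \<partial>M)"
    using eq by (intro nn_integral_cong_AE, eventually_elim) simp
  then show int: "integrable M F"
    using fin F0 Fm by (intro integrableI_nonneg) auto
  have lim: "AE x in M. (\<lambda>k. \<Sum>n<k. f n x) \<longlonglongrightarrow> F x \<and> (\<forall>k. \<bar>\<Sum>n<k. f n x\<bar> \<le> F x)"
    using ae AE_space
  proof eventually_elim
    case (elim x)
    have s: "summable (\<lambda>n. f n x)"
      by (rule summable_suminf_not_top[OF f(2)[OF elim(2)]]) (use elim(1) in simp)
    have "(\<Sum>n. ennreal (f n x)) = ennreal (\<Sum>n. f n x)"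
      by (rule suminf_ennreal2[OF f(2)[OF elim(2)] s])
    then have F: "F x = (\<Sum>n. f n x)"
      unfolding F_def using suminf_nonneg[OF s f(2)[OF elim(2)]] by simp
    have le: "(\<Sum>n<k. f n x) \<le> (\<Sum>n. f n x)" for k
      by (rule sum_le_suminf[OF s]) (simp_all add: f(2)[OF elim(2)])
    have "0 \<le> (\<Sum>n<k. f n x)" for k by (intro sum_nonneg f(2)[OF elim(2)])
    then show ?case
      unfolding F using summable_LIMSEQ[OF s] le by simp
  qed
  then show l1: "AE x in M. (\<lambda>k. \<Sum>n<k. f n x) \<longlonglongrightarrow> F x" and l2: "AE x in M. \<forall>k. \<bar>\<Sum>n<k. f n x\<bar> \<le> F x"
    by auto
  fix g and C :: real assume g: "g \<in> borel_measurable M" "\<And>x. x \<in> space M \<Longrightarrow> \<bar>g x\<bar> \<le> C"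
  have fi: "integrable M (\<lambda>x. f n x * g x)" for n
  proof (rule Bochner_Integration.integrable_bound[OF integrable_mult_left[OF int, of C]])
    show "(\<lambda>x. f n x * g x) \<in> borel_measurable M" using f(1) g(1) by measurable
    show "AE x in M. norm (f n x * g x) \<le> norm (F x * C)"
      using l2 AE_space
    proof eventually_elim
      case (elim x)
      have "f n x \<le> (\<Sum>i<Suc n. f i x)" using f(2)[OF elim(2)] by (simp add: sum_nonneg)
      also have "\<dots> \<le> F x" using elim(1) abs_le_D1 by blast
      finally have "\<bar>f n x\<bar> \<le> F x" using f(2)[OF elim(2)] by simp
      then have "\<bar>f n x\<bar> * \<bar>g x\<bar> \<le> F x * C" using g(2)[OF elim(2)] F0 by (intro mult_mono) auto
      also have "\<dots> \<le> \<bar>F x * C\<bar>" by simp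
      finally show ?case by (simp only: real_norm_def abs_mult)
    qed
  qed
  have "(\<lambda>k. LINT x|M. (\<Sum>n<k. f n x) * g x) \<longlonglongrightarrow> (LINT x|M. F x * g x)"
  proof (rule integral_dominated_convergence[where w="\<lambda>x. F x * C"])
    show "integrable M (\<lambda>x. F x * C)" using int by simp
    show "(\<lambda>x. F x * g x) \<in> borel_measurable M" using Fm g(1) by measurable
    show "(\<lambda>x. (\<Sum>n<k. f n x) * g x) \<in> borel_measurable M" for k using f(1) g(1) by measurable
    show "AE x in M. (\<lambda>k. (\<Sum>n<k. f n x) * g x) \<longlonglongrightarrow> F x * g x"
      using l1 by eventually_elim (intro tendsto_mult_right)
    show "AE x in M. norm ((\<Sum>n<k. f n x) * g x) \<le> F x * C" for k
      using l2 AE_space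
    proof eventually_elim
      case (elim x)
      then show ?case using g(2)[OF elim(2)] F0 unfolding real_norm_def abs_mult by (intro mult_mono) auto
    qed
  qed
  moreover have "(LINT x|M. (\<Sum>n<k. f n x) * g x) = (\<Sum>n<k. LINT x|M. f n x * g x)" for k
    unfolding sum_distrib_right by (rule Bochner_Integration.integral_sum) (rule fi)
  ultimately show "(\<lambda>k. \<Sum>n<k. LINT x|M. f n x * g x) \<longlonglongrightarrow> (LINT x|M. F x * g x)" by simp
qed

text \<open>Minimum principle, obtained from the maximum principle for -P. A bound on the whole
  closed disk is needed because Re P is a factor of the block and of the leading part of its
  Laplacian.\<close>

lemma Re_poly_positive:
  assumes "\<And>\<zeta>. norm \<zeta> = 1 \<Longrightarrow> 0 < Re (poly P \<zeta>)"
  obtains \<delta> where "0 < \<delta>" "\<And>z. norm z \<le> 1 \<Longrightarrow> \<delta> \<le> Re (poly P z)"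
proof -
  have c: "continuous_on S (\<lambda>z. Re (poly P z))" for S by (intro continuous_intros)
  obtain x where x: "x \<in> sphere 0 1" "\<And>y. y \<in> sphere 0 1 \<Longrightarrow> Re (poly P x) \<le> Re (poly P y)"
    using continuous_attains_inf[of "sphere 0 1" "\<lambda>z. Re (poly P z)"] c by auto
  have "Re (poly P x) \<le> Re (poly P z)" if z: "norm z \<le> 1" for z
  proof -
    have "Re (poly (- P) z) \<le> - Re (poly P x)"
    proof (rule maximum_real_frontier[of "poly (- P)" "cball 0 1"])
      show "poly (- P) holomorphic_on interior (cball 0 1)" by (intro holomorphic_intros)
      show "continuous_on (closure (cball 0 1)) (poly (- P))" by (intro continuous_intros)
      show "Re (poly (- P) w) \<le> - Re (poly P x)" if "w \<in> frontier (cball 0 1)" for w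
        using x(2)[of w] that by (simp add: frontier_cball)
    qed (use z in auto)
    then show ?thesis by simp
  qed
  then show thesis using assms[of x] x(1) by (intro that[of "Re (poly P x)"]) auto
qed

lemma block_choice:
  assumes P: "\<And>\<zeta>. norm \<zeta> = 1 \<Longrightarrow> 0 < Re (poly P \<zeta>)" and e: "0 < e"
  shows "\<exists>m. \<forall>z. norm z \<le> 1 \<longrightarrow> 0 \<le> block_laplacian P m z \<and> \<bar>block P m z\<bar> \<le> e"
proof -
  obtain \<delta> where \<delta>: "0 < \<delta>" "\<And>z. norm z \<le> 1 \<Longrightarrow> \<delta> \<le> Re (poly P z)"
    by (rule Re_poly_positive[OF P], assumption) (rule that; assumption)
  have bdd: "\<exists>C. \<forall>z. norm z \<le> 1 \<longrightarrow> \<bar>f z\<bar> \<le> C" if "continuous_on (cball 0 1) f" for f :: "complex \<Rightarrow> real"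
  proof -
    have "bounded (f ` cball 0 1)" by (intro compact_imp_bounded compact_continuous_image that) auto
    then obtain C where "\<forall>z\<in>cball 0 1. \<bar>f z\<bar> \<le> C" unfolding bounded_iff by auto
    then show ?thesis by (intro exI[of _ C]) auto
  qed
  have "continuous_on (cball 0 1) (\<lambda>z. Re (poly P z))" "continuous_on (cball 0 1) (\<lambda>z. Re (z * poly (pderiv P) z))"
    by (intro continuous_intros)+
  from bdd[OF this(1)] bdd[OF this(2)] obtain C C' where
    C: "\<And>z. norm z \<le> 1 \<Longrightarrow> \<bar>Re (poly P z)\<bar> \<le> C" and C': "\<And>z. norm z \<le> 1 \<Longrightarrow> \<bar>Re (z * poly (pderiv P) z)\<bar> \<le> C'"
    by blast
  \<comment> \<open>The first bound lets the term of order m in the block Laplacian outweigh the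
    Euler term, whose size is at most C'. The second makes the factor 1 / (4 \<pi> (m + 2)) push the
    block below e.\<close>
  obtain m :: nat where m: "max (C' / \<delta>) (C / e) < real m" using reals_Archimedean2 by blast
  show ?thesis
  proof (intro exI[of _ m] allI impI conjI)
    fix z :: complex assume z: "norm z \<le> 1"
    have "C' < real m * \<delta>" using m \<delta>(1) by (simp add: pos_divide_less_eq)
    also have "\<dots> \<le> real (Suc (Suc m)) * Re (poly P z)" using \<delta>(1) \<delta>(2)[OF z] by (intro mult_mono) auto
    finally have "0 \<le> real (Suc (Suc m)) * Re (poly P z) + Re (z * poly (pderiv P) z)"
      using C'[OF z] by linarith
    then show "0 \<le> block_laplacian P m z"
      unfolding block_laplacian_def by (intro mult_nonneg_nonneg) auto
    have p1: "\<bar>norm z ^ (2 * Suc (Suc m)) - 1\<bar> \<le> 1"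
      using power_le_one[OF norm_ge_zero z, of "2 * Suc (Suc m)"] zero_le_power[OF norm_ge_zero, of z "2 * Suc (Suc m)"]
      by linarith
    have C0: "0 \<le> C" using C[OF z] by linarith
    have "\<bar>block P m z\<bar> = 1 / (4 * pi * real (Suc (Suc m))) * (\<bar>Re (poly P z)\<bar> * \<bar>norm z ^ (2 * Suc (Suc m)) - 1\<bar>)"
      unfolding block_def by (simp only: abs_mult abs_divide) (simp add: abs_of_nonneg)
    also have "\<dots> \<le> 1 / (4 * pi * real (Suc (Suc m))) * (C * 1)"
      using C[OF z] C0 p1 by (intro mult_left_mono mult_mono) auto
    also have "\<dots> \<le> e"
    proof -
      have "C < real m * e" using m e by (simp add: pos_divide_less_eq)
      also have "\<dots> \<le> (4 * pi * real (Suc (Suc m))) * e"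
      proof (intro mult_right_mono)
        have "1 * real m \<le> (4 * pi) * real (Suc (Suc m))" using pi_gt3 by (intro mult_mono) auto
        then show "real m \<le> 4 * pi * real (Suc (Suc m))" by simp
      qed (use e in simp)
      finally have "C \<le> e * (4 * pi * real (Suc (Suc m)))" by (simp add: mult.commute)
      moreover have "0 < 4 * pi * real (Suc (Suc m))" by simp
      ultimately have "C / (4 * pi * real (Suc (Suc m))) \<le> e" by (simp only: pos_divide_le_eq)
      then show ?thesis by simp
    qed
    finally show "\<bar>block P m z\<bar> \<le> e" .
  qed
qed

text \<open>The partial sums of the blocks decrease and converge uniformly on the closed disk, so
  they fit \<open>smooth_approximation\<close>; the moments of each block then add up to those of
  \<open>b\<close>.\<close>

lemma exhaustion_of_decomposition:
  fixes P :: "nat \<Rightarrow> complex poly"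
  defines "b \<equiv> \<lambda>\<zeta>. \<Sum>n. ennreal (Re (poly (P n) \<zeta>))"
  assumes P: "\<And>n \<zeta>. norm \<zeta> = 1 \<Longrightarrow> 0 < Re (poly (P n) \<zeta>)"
    and one: "(\<integral>\<^sup>+\<zeta>. b \<zeta> \<partial>arc_measure) = 1"
  shows "\<exists>u\<in>exhaustion_functions_1. boundary_measure u
    (distr (density arc_measure b) (restrict_space borel (cball 0 1)) (\<lambda>z. z))"
proof -
  \<comment> \<open>Geometric bounds on the closed disk give uniform convergence up to the circle,
    so the sum is continuous there and inherits the boundary value 0.\<close>
  have "\<forall>n. \<exists>m. \<forall>z. norm z \<le> 1 \<longrightarrow> 0 \<le> block_laplacian (P n) m z \<and> \<bar>block (P n) m z\<bar> \<le> (1 / 2) ^ n"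
    using block_choice[OF P] by simp
  then obtain m where m: "\<And>n z. norm z \<le> 1 \<Longrightarrow> 0 \<le> block_laplacian (P n) (m n) z"
    "\<And>n z. norm z \<le> 1 \<Longrightarrow> \<bar>block (P n) (m n) z\<bar> \<le> (1 / 2) ^ n" by metis
  define v where "v n = block (P n) (m n)" for n
  define d where "d n = block_laplacian (P n) (m n)" for n
  have sv: "smooth (v n)" for n unfolding v_def by (rule smooth_block)
  have lv: "laplacian (v n) z = d n z" for n z unfolding v_def d_def by (rule laplacian_block)
  have vb: "\<bar>v n z\<bar> \<le> (1 / 2) ^ n" if "norm z \<le> 1" for n z unfolding v_def by (rule m(2)[OF that])
  have d0: "0 \<le> d n z" if "norm z \<le> 1" for n z unfolding d_def by (rule m(1)[OF that])
  have v_neg: "v n z < 0" if z: "norm z < 1" for n z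
  proof -
    obtain \<delta> where "0 < \<delta>" "\<And>z. norm z \<le> 1 \<Longrightarrow> \<delta> \<le> Re (poly (P n) z)"
      by (rule Re_poly_positive[OF P], assumption) (rule that; assumption)
    from this(1) this(2)[of z] have "0 < Re (poly (P n) z)" using z by simp
    moreover have pk: "norm z ^ k < 1" if "0 < k" for k
      using power_strict_mono[of "norm z" 1 k] z that by simp
    have "norm z ^ (2 * Suc (Suc (m n))) < 1" by (rule pk) simp
    ultimately show ?thesis
      unfolding v_def block_def by (intro mult_pos_neg) (simp_all only: diff_less_0_iff_less, simp)
  qed
  have v_sphere: "v n z = 0" if "norm z = 1" for n z using that by (simp add: v_def block_def)
  have v_le: "v n z \<le> 0" if "norm z \<le> 1" for n z
    using v_neg[of z n] v_sphere[of z n] that by (cases "norm z = 1") auto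
  have geo: "summable (\<lambda>n. (1 / 2) ^ n :: real)" "(\<Sum>n. (1 / 2) ^ n) = (2::real)"
    using geometric_sums[of "1 / 2 :: real"] by (auto simp: sums_iff)
  have sm: "summable (\<lambda>n. v n z)" if "norm z \<le> 1" for z
    by (rule summable_comparison_test_ev[OF _ geo(1)]) (use vb[OF that] in auto)
  define U where "U k z = (\<Sum>n<k. v n z)" for k z
  define w where "w z = (\<Sum>n. v n z)" for z
  define u where "u z = (if z \<in> disk then w z else 0)" for z
  have sU: "smooth (U k)" for k
  proof (induction k)
    case (Suc k)
    have "U (Suc k) = (\<lambda>z. U k z + v k z)" by (auto simp: U_def)
    then show ?case using smooth_add[OF Suc sv] by simp
  next
    case 0
    have "U 0 = (\<lambda>z. 0)" by (auto simp: U_def)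
    then show ?case using smooth_const[of 0] by simp
  qed
  have lU: "laplacian (U k) z = (\<Sum>n<k. d n z)" for k z
  proof (induction k)
    case (Suc k)
    have "U (Suc k) = (\<lambda>z. U k z + v k z)" by (auto simp: U_def)
    moreover have "laplacian (\<lambda>z. U k z + v k z) z = laplacian (U k) z + laplacian (v k) z"
      unfolding laplacian_def partial_deriv_add[OF sU sv]
      by (simp add: partial_deriv_add[OF smooth_partial_deriv[OF sU] smooth_partial_deriv[OF sv]])
    ultimately show ?case using Suc lv by simp
  next
    case 0
    have "U 0 = (\<lambda>z. Re (poly 0 z))" by (auto simp: U_def)
    then show ?case using laplacian_Re_poly[of 0 z] by simp
  qed
  have U_lim: "(\<lambda>k. U k z) \<longlonglongrightarrow> w z" if "norm z \<le> 1" for z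
    unfolding U_def w_def by (rule summable_LIMSEQ[OF sm[OF that]])
  \<comment> \<open>The blocks are nonpositive on the closed disk, so the partial sums approach the
    limit from above, as the smoothing of the maximum requires.\<close>
  have w_le_U: "w z \<le> U k z" if "norm z \<le> 1" for k z
  proof (rule decseq_ge[OF _ U_lim[OF that]])
    show "decseq (\<lambda>k. U k z)" unfolding decseq_Suc_iff U_def using v_le[OF that] by simp
  qed
  have U_bd: "\<bar>U k z\<bar> \<le> 2" if "norm z \<le> 1" for k z
  proof -
    have "\<bar>U k z\<bar> \<le> (\<Sum>n<k. (1 / 2) ^ n)"
      unfolding U_def by (rule order_trans[OF sum_abs sum_mono]) (rule vb[OF that])
    also have "\<dots> \<le> (\<Sum>n. (1 / 2) ^ n)" by (rule sum_le_suminf[OF geo(1)]) auto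
    finally show ?thesis using geo(2) by simp
  qed
  have wc: "continuous_on (cball 0 1) w"
  proof -
    have "uniform_limit (cball 0 1) U w sequentially"
      unfolding U_def w_def by (rule Weierstrass_m_test[OF _ geo(1)]) (use vb in auto)
    then show ?thesis
      by (rule uniform_limit_theorem[rotated]) (auto intro!: always_eventually smooth_continuous_on sU)
  qed
  have w_sphere: "w z = 0" if "norm z = 1" for z using v_sphere[OF that] by (simp add: w_def)
  have uc: "continuous_on UNIV u"
  proof -
    have "continuous_on (cball 0 1 \<union> - disk) u"
      unfolding u_def[abs_def]
      by (rule continuous_on_cases) (use wc w_sphere in \<open>auto simp: not_less order_antisym\<close>)
    also have "cball 0 1 \<union> - disk = (UNIV :: complex set)" by auto
    finally show ?thesis .
  qed
  define f where "f n z = indicator disk z * d n z" for n z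
  have dm: "d n \<in> borel_measurable borel" for n
    unfolding d_def block_laplacian_def[abs_def]
    by (intro borel_measurable_continuous_onI continuous_intros)
  have fm: "f n \<in> borel_measurable lborel" for n
    unfolding f_def[abs_def] using dm by (intro borel_measurable_times borel_measurable_indicator) auto
  have f0: "0 \<le> f n z" for n z unfolding f_def using d0[of z n] by (auto simp: indicator_def)
  have Pm: "(\<lambda>\<zeta>. Re (poly (P n) \<zeta>)) \<in> borel_measurable arc_measure" for n
    by (intro borel_measurable_arcI borel_measurable_continuous_onI continuous_intros)
  have P0: "0 \<le> Re (poly (P n) \<zeta>)" if "\<zeta> \<in> space arc_measure" for n \<zeta>
    using P[of \<zeta> n] that by (simp add: space_arc_measure less_imp_le)
  have bm: "b \<in> borel_measurable arc_measure" unfolding b_def using Pm by measurable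
  have moment: "(LINT z|lborel. f n z * Re (poly q z)) = (LINT \<zeta>|arc_measure. Re (poly (P n) \<zeta>) * Re (poly q \<zeta>))" for n q
    using block_moment[of q "P n" "m n"]
    unfolding f_def d_def set_lebesgue_integral_def by (simp only: real_scaleR_def mult_ac)
  have fint: "(\<integral>\<^sup>+z. ennreal (f n z) \<partial>lborel) = (\<integral>\<^sup>+\<zeta>. ennreal (Re (poly (P n) \<zeta>)) \<partial>arc_measure)" for n
  proof -
    have c: "continuous_on S (d n)" for S
      unfolding d_def block_laplacian_def[abs_def] by (intro continuous_intros)
    have "set_integrable lborel (cball 0 1) (d n)"
      unfolding set_integrable_def by (rule borel_integrable_compact[OF compact_cball c])
    then have "set_integrable lborel disk (d n)" by (rule set_integrable_subset) auto
    then have "integrable lborel (f n)" unfolding set_integrable_def f_def[abs_def] by simp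
    then have "(\<integral>\<^sup>+z. ennreal (f n z) \<partial>lborel) = ennreal (LINT z|lborel. f n z)"
      by (rule nn_integral_eq_integral) (simp add: f0)
    also have "(LINT z|lborel. f n z) = (LINT \<zeta>|arc_measure. Re (poly (P n) \<zeta>))"
      using moment[of n 1] by simp
    also have "ennreal \<dots> = (\<integral>\<^sup>+\<zeta>. ennreal (Re (poly (P n) \<zeta>)) \<partial>arc_measure)"
      using P0 by (intro nn_integral_eq_integral[symmetric] integrable_arc_continuous AE_I2) (auto intro!: continuous_intros)
    finally show ?thesis .
  qed
  \<comment> \<open>The moment identity with q = 1 equates the mass of each block Laplacian with the
    integral of its polynomial over the circle, so the normalization of \<open>b\<close> gives
    \<Delta>u total mass 1.\<close>
  have S1: "(\<integral>\<^sup>+z. (\<Sum>n. ennreal (f n z)) \<partial>lborel) = 1"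
  proof -
    have "(\<integral>\<^sup>+z. (\<Sum>n. ennreal (f n z)) \<partial>lborel) = (\<Sum>n. \<integral>\<^sup>+z. ennreal (f n z) \<partial>lborel)"
      by (rule nn_integral_suminf[OF measurable_compose[OF fm measurable_ennreal]])
    also have "\<dots> = (\<Sum>n. \<integral>\<^sup>+\<zeta>. ennreal (Re (poly (P n) \<zeta>)) \<partial>arc_measure)" by (simp only: fint)
    also have "\<dots> = (\<integral>\<^sup>+\<zeta>. b \<zeta> \<partial>arc_measure)"
      unfolding b_def by (rule nn_integral_suminf[OF measurable_compose[OF Pm measurable_ennreal], symmetric])
    finally show ?thesis using one by simp
  qed
  define D where "D z = enn2real (\<Sum>n. ennreal (f n z))" for z
  have finS: "(\<integral>\<^sup>+z. (\<Sum>n. ennreal (f n z)) \<partial>lborel) < \<infinity>" using S1 by simp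
  note Dser = ennreal_series_integral[where f=f and M=lborel, OF fm f0 finS, folded D_def]
  have finb: "(\<integral>\<^sup>+\<zeta>. (\<Sum>n. ennreal (Re (poly (P n) \<zeta>))) \<partial>arc_measure) < \<infinity>" using one unfolding b_def by simp
  define Bf where "Bf \<zeta> = enn2real (\<Sum>n. ennreal (Re (poly (P n) \<zeta>)))" for \<zeta>
  have Bint: "integrable arc_measure Bf"
    unfolding Bf_def[abs_def] by (rule ennreal_series_integral(1)[OF Pm P0 finb])
  have Bae: "AE \<zeta> in arc_measure. b \<zeta> = ennreal (Bf \<zeta>)"
    unfolding Bf_def b_def by (rule ennreal_series_integral(2)[OF Pm P0 finb])
  interpret A: smooth_approximation U "\<lambda>k. partial_deriv 1 (U k)" "\<lambda>k. partial_deriv 1 (partial_deriv 1 (U k))"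
    "\<lambda>k. partial_deriv \<i> (U k)" "\<lambda>k. partial_deriv \<i> (partial_deriv \<i> (U k))" u D 2
  proof
    show "dir_C2 1 (U k) (partial_deriv 1 (U k)) (partial_deriv 1 (partial_deriv 1 (U k)))"
      "dir_C2 \<i> (U k) (partial_deriv \<i> (U k)) (partial_deriv \<i> (partial_deriv \<i> (U k)))" for k
      by (rule dir_C2_smooth[OF sU]; simp)+
    show "(\<lambda>k. U k z) \<longlonglongrightarrow> u z" if "z \<in> disk" for z using U_lim[of z] that by (simp add: u_def)
    show "u z \<le> U k z" if "z \<in> disk" for z k using w_le_U[of z k] that by (simp add: u_def)
    show "\<bar>U k z\<bar> \<le> 2" if "z \<in> disk" for z k using U_bd[of z k] that by simp
    show "continuous_on UNIV u" by (rule uc)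
    \<comment> \<open>Already the first partial sum \<open>U 1 = v 0\<close> is negative, and it
      dominates u.\<close>
    show "u z < 0" if "z \<in> disk" for z
      using w_le_U[of z 1] v_neg[of z 0] that by (simp add: u_def U_def)
    show "u z = 0" if "z \<notin> disk" for z using that by (simp add: u_def)
    show "integrable lborel D" by (rule Dser(1))
    show "0 \<le> D z" for z by (simp add: D_def)
    show "D z = 0" if "z \<notin> disk" for z using that by (simp add: D_def f_def)
    have lap: "partial_deriv 1 (partial_deriv 1 (U k)) z + partial_deriv \<i> (partial_deriv \<i> (U k)) z = (\<Sum>n<k. f n z)"
      if "z \<in> disk" for k z
      using lU[of k z] that by (simp add: laplacian_def f_def)
    show "AE z in lborel. z \<in> disk \<longrightarrow> (\<lambda>k. partial_deriv 1 (partial_deriv 1 (U k)) z + partial_deriv \<i> (partial_deriv \<i> (U k)) z) \<longlonglongrightarrow> D z"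
      using Dser(3)
    proof eventually_elim
      case (elim z)
      show ?case by (rule impI, unfold lap, rule elim)
    qed
    show "AE z in lborel. z \<in> disk \<longrightarrow> (\<forall>k. \<bar>partial_deriv 1 (partial_deriv 1 (U k)) z + partial_deriv \<i> (partial_deriv \<i> (U k)) z\<bar> \<le> D z)"
      using Dser(4)
    proof eventually_elim
      case (elim z)
      show ?case by (rule impI, unfold lap, rule elim)
    qed
  qed
  have mass: "emeasure A.riesz disk = 1"
  proof -
    have "emeasure A.riesz disk = (\<integral>\<^sup>+z. ennreal (D z) * indicator disk z \<partial>lborel)"
      by (rule A.emeasure_riesz) auto
    also have "\<dots> = (\<integral>\<^sup>+z. (\<Sum>n. ennreal (f n z)) \<partial>lborel)"
      using Dser(2) by (intro nn_integral_cong_AE, eventually_elim) (auto simp: indicator_def f_def D_def)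
    finally show ?thesis using S1 by simp
  qed
  have sub: "subharmonic_on disk (\<lambda>z. ereal (u z))"
    unfolding subharmonic_on_def
  proof (intro conjI allI impI ballI)
    show "usc_on disk (\<lambda>z. ereal (u z))"
      unfolding usc_on_def
    proof
      fix x :: complex assume x: "x \<in> disk"
      have "(u \<longlongrightarrow> u x) (at x within disk)"
        using continuous_on_subset[OF uc, of disk] x unfolding continuous_on_def by auto
      then have tl: "((\<lambda>z. ereal (u z)) \<longlongrightarrow> ereal (u x)) (at x within disk)" by (rule tendsto_ereal)
      have nb: "\<not> trivial_limit (at x within disk)" using x at_within_open[OF x open_ball] by simp
      show "Limsup (at x within disk) (\<lambda>z. ereal (u z)) \<le> ereal (u x)"
        by (rule eq_refl[OF lim_imp_Limsup[OF nb tl]])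
    qed
    fix a :: complex and r :: real assume r: "0 < r" and ar: "cball a r \<subseteq> disk"
    have in_disk: "a + of_real r * \<zeta> \<in> disk" if "norm \<zeta> = 1" for \<zeta>
    proof -
      have "a + of_real r * \<zeta> \<in> cball a r" using that r by (simp add: dist_norm norm_mult)
      then show ?thesis using ar by blast
    qed
    have a: "a \<in> disk" by (rule subsetD[OF ar]) (use r in simp)
    have Uk: "U k a \<le> (LINT \<zeta>|arc_measure. U k (a + of_real r * \<zeta>))" for k
    proof (rule smooth_sub_mean_value[OF sU _ r])
      fix z assume "z \<in> cball a r"
      then have "z \<in> disk" using ar by blast
      then have "norm z \<le> 1" by simp
      then show "0 \<le> laplacian (U k) z" unfolding lU using d0 by (intro sum_nonneg) auto
    qed
    have ucomp: "continuous_on (sphere 0 1) (\<lambda>\<zeta>. g (a + of_real r * \<zeta>))" if "continuous_on UNIV g" for g :: "complex \<Rightarrow> real"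
      by (rule continuous_on_compose2[OF that]) (auto intro!: continuous_intros)
    have ui: "integrable arc_measure (\<lambda>\<zeta>. u (a + of_real r * \<zeta>))" by (rule integrable_arc_continuous[OF ucomp[OF uc]])
    have "(\<lambda>k. LINT \<zeta>|arc_measure. U k (a + of_real r * \<zeta>)) \<longlonglongrightarrow> (LINT \<zeta>|arc_measure. u (a + of_real r * \<zeta>))"
    proof (rule integral_dominated_convergence[where w="\<lambda>_. 2"])
      show "(\<lambda>\<zeta>. U k (a + of_real r * \<zeta>)) \<in> borel_measurable arc_measure" for k
        by (rule borel_measurable_integrable[OF integrable_arc_continuous[OF ucomp[OF smooth_continuous_on[OF sU]]]])
      show "AE \<zeta> in arc_measure. (\<lambda>k. U k (a + of_real r * \<zeta>)) \<longlonglongrightarrow> u (a + of_real r * \<zeta>)"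
        by (rule AE_I2) (use A.U_tendsto in_disk in \<open>simp add: space_arc_measure\<close>)
      show "AE \<zeta> in arc_measure. norm (U k (a + of_real r * \<zeta>)) \<le> 2" for k
        by (rule AE_I2) (use A.U_bound in_disk in \<open>simp add: space_arc_measure\<close>)
    qed (use borel_measurable_integrable[OF ui] in auto)
    moreover have "u a \<le> (LINT \<zeta>|arc_measure. U k (a + of_real r * \<zeta>))" for k
      using A.U_ge[OF a, of k] Uk[of k] by linarith
    ultimately have mean: "u a \<le> (LINT \<zeta>|arc_measure. u (a + of_real r * \<zeta>))"
      by (intro LIMSEQ_le_const) auto
    \<comment> \<open>As u is negative on this circle, its extended integral consists of the
      negative part alone, and this part is finite.\<close>
    have nn: "(\<integral>\<^sup>+\<zeta>. ennreal (- u (a + of_real r * \<zeta>)) \<partial>arc_measure) = ennreal (LINT \<zeta>|arc_measure. - u (a + of_real r * \<zeta>))"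
      using ui A.u_neg in_disk
      by (intro nn_integral_eq_integral AE_I2) (auto simp: space_arc_measure less_imp_le)
    have "(LINT \<zeta>|arc_measure. - u (a + of_real r * \<zeta>)) \<ge> 0"
      using A.u_neg in_disk by (intro integral_nonneg_AE AE_I2) (auto simp: space_arc_measure less_imp_le)
    moreover have "(\<integral>\<^sup>+\<zeta>. e2ennreal (ereal (u (a + of_real r * \<zeta>))) \<partial>arc_measure) = (\<integral>\<^sup>+\<zeta>. 0 \<partial>arc_measure)"
      using A.u_neg in_disk
      by (intro nn_integral_cong) (simp add: space_arc_measure ennreal_neg less_imp_le)
    ultimately have "ereal_integral circle_measure (\<lambda>\<zeta>. ereal (u (a + of_real r * \<zeta>))) = ereal (LINT \<zeta>|arc_measure. u (a + of_real r * \<zeta>))"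
      unfolding ereal_integral_def circle_measure_eq nn_integral_completion
      using nn by (simp add: zero_ennreal.rep_eq zero_ereal_def)
    then show "ereal (u a) \<le> ereal_integral circle_measure (\<lambda>\<zeta>. ereal (u (a + of_real r * \<zeta>)))"
      using mean by simp
  qed simp
  have "(\<lambda>z. ereal (u z)) \<in> exhaustion_functions"
    unfolding exhaustion_functions_def
    using sub A.u_tendsto_0 A.u_neg continuous_on_subset[OF uc, of disk]
    by (auto intro!: continuous_on_ereal)
  then have E1: "(\<lambda>z. ereal (u z)) \<in> exhaustion_functions_1"
    unfolding exhaustion_functions_1_def using A.has_laplacian_riesz mass by blast
  have mom: "(LINT z|A.riesz. Re (poly q z)) = (LINT \<zeta>|density arc_measure b. Re (poly q \<zeta>))" for q
  proof -
    define g where "g = (\<lambda>z. Re (poly q z))"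
    have gc: "continuous_on UNIV g" unfolding g_def by (intro continuous_intros)
    then have gm: "g \<in> borel_measurable borel" by (rule borel_measurable_continuous_onI)
    have "bounded (g ` cball 0 1)" by (intro compact_imp_bounded compact_continuous_image continuous_on_subset[OF gc]) auto
    then obtain C where C: "\<forall>z\<in>cball 0 1. \<bar>g z\<bar> \<le> C" unfolding bounded_iff by auto
    \<comment> \<open>The polynomial is unbounded in the plane. Cutting it off outside the closed
      disk supplies the bound \<open>C\<close> and leaves the integrals alone, since all densities
      vanish outside the open disk.\<close>
    have g'm: "(\<lambda>z. indicator (cball 0 1) z * g z) \<in> borel_measurable lborel"
      using gm by (intro borel_measurable_times borel_measurable_indicator) auto
    have C0: "0 \<le> C" using C[rule_format, of 0] by simp
    have e1: "(LINT z|A.riesz. g z) = (LINT z|lborel. D z * (indicator (cball 0 1) z * g z))"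
      unfolding A.integral_riesz[OF gm]
      by (intro Bochner_Integration.integral_cong refl) (use A.D_0 in \<open>auto simp: indicator_def\<close>)
    have l1: "(\<lambda>k. \<Sum>n<k. LINT z|lborel. f n z * (indicator (cball 0 1) z * g z)) \<longlonglongrightarrow> (LINT z|lborel. D z * (indicator (cball 0 1) z * g z))"
      by (rule Dser(5)[OF g'm, of C]) (use C C0 in \<open>auto simp: indicator_def\<close>)
    have e2: "(LINT z|lborel. f n z * (indicator (cball 0 1) z * g z)) = (LINT \<zeta>|arc_measure. Re (poly (P n) \<zeta>) * g \<zeta>)" for n
    proof -
      have "(LINT z|lborel. f n z * (indicator (cball 0 1) z * g z)) = (LINT z|lborel. f n z * g z)"
        by (intro Bochner_Integration.integral_cong refl) (auto simp: f_def indicator_def)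
      then show ?thesis using moment[of n q] by (simp only: g_def)
    qed
    have l2: "(\<lambda>k. \<Sum>n<k. LINT \<zeta>|arc_measure. Re (poly (P n) \<zeta>) * g \<zeta>) \<longlonglongrightarrow> (LINT \<zeta>|arc_measure. Bf \<zeta> * g \<zeta>)"
      unfolding Bf_def
    proof (rule ennreal_series_integral(5)[OF Pm P0 finb])
      show "g \<in> borel_measurable arc_measure" by (rule borel_measurable_arcI[OF gm])
      show "\<bar>g \<zeta>\<bar> \<le> C" if "\<zeta> \<in> space arc_measure" for \<zeta>
        using C that by (simp add: space_arc_measure)
    qed
    have 1: "(LINT z|A.riesz. g z) = (LINT \<zeta>|arc_measure. Bf \<zeta> * g \<zeta>)"
      unfolding e1 by (rule LIMSEQ_unique[OF l1[unfolded e2] l2])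
    have Bm: "Bf \<in> borel_measurable arc_measure" by (rule borel_measurable_integrable[OF Bint])
    have "density arc_measure b = density arc_measure (\<lambda>\<zeta>. ennreal (Bf \<zeta>))"
      using Bm by (intro density_cong bm Bae) auto
    then have "(LINT \<zeta>|density arc_measure b. g \<zeta>) = (LINT \<zeta>|arc_measure. Bf \<zeta> *\<^sub>R g \<zeta>)"
      using integral_density[OF borel_measurable_arcI[OF gm] Bm] by (simp add: Bf_def)
    then show ?thesis using 1 unfolding g_def by simp
  qed
  have "boundary_measure (\<lambda>z. ereal (u z)) (distr (density arc_measure b) (restrict_space borel (cball 0 1)) (\<lambda>z. z))"
    by (rule A.boundary_measure_exists[OF bm _ mom]) (simp add: one)
  with E1 show ?thesis by blast
qed

lemma exhaustion_of_circle_density: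
  fixes \<alpha> \<beta> :: "complex \<Rightarrow> ereal" and c :: real
  assumes ae: "AE \<zeta> in circle_measure. \<alpha> \<zeta> = \<beta> \<zeta>" and lsc: "lsc_on (sphere 0 1) \<beta>"
    and c: "0 < c" "\<And>\<theta>::real. ereal c \<le> \<beta> (cis \<theta>)" and one: "ereal_integral circle_measure \<beta> = 1"
  shows "\<exists>u\<in>exhaustion_functions_1. \<exists>\<mu>. boundary_measure u \<mu> \<and> is_circle_density \<alpha> \<mu>"
proof -
  have c': "ereal c \<le> \<beta> \<zeta>" if "norm \<zeta> = 1" for \<zeta>
    using c(2)[of "Arg \<zeta>"] cis_Arg_unique[of \<zeta> "Arg \<zeta>"] that rcis_cmod_Arg[of \<zeta>] by (simp add: rcis_def)
  obtain P :: "nat \<Rightarrow> complex poly" where P: "\<And>n \<zeta>. norm \<zeta> = 1 \<Longrightarrow> 0 < Re (poly (P n) \<zeta>)"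
    "\<And>\<zeta>. norm \<zeta> = 1 \<Longrightarrow> (\<lambda>n. ennreal (Re (poly (P n) \<zeta>))) sums e2ennreal (\<beta> \<zeta>)"
    by ((rule lsc_harmonic_decomposition[OF lsc c(1) c'], assumption), (rule that; assumption))
  define b where "b = (\<lambda>\<zeta>. \<Sum>n. ennreal (Re (poly (P n) \<zeta>)))"
  have b: "e2ennreal (\<beta> \<zeta>) = b \<zeta>" if "norm \<zeta> = 1" for \<zeta>
    unfolding b_def using sums_unique[OF P(2)[OF that]] .
  have neg: "e2ennreal (- \<beta> \<zeta>) = 0" if "norm \<zeta> = 1" for \<zeta>
  proof (rule e2ennreal_neg)
    have "0 \<le> \<beta> \<zeta>" using c'[OF that] c(1) by (meson ereal_less_eq(5) less_imp_le order_trans)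
    then show "- \<beta> \<zeta> \<le> 0" by simp
  qed
  have Pm: "(\<lambda>\<zeta>. Re (poly (P n) \<zeta>)) \<in> borel_measurable arc_measure" for n
    by (intro borel_measurable_arcI borel_measurable_continuous_onI continuous_intros)
  have bm: "b \<in> borel_measurable arc_measure" unfolding b_def using Pm by measurable
  have int: "ereal_integral circle_measure (\<lambda>\<zeta>. indicator A \<zeta> * \<alpha> \<zeta>) = enn2ereal (\<integral>\<^sup>+\<zeta>. b \<zeta> * indicator A \<zeta> \<partial>arc_measure)" for A
  proof -
    have sp: "space circle_measure = sphere 0 1" by (simp add: circle_measure_eq space_arc_measure)
    have "(\<integral>\<^sup>+\<zeta>. e2ennreal (indicator A \<zeta> * \<alpha> \<zeta>) \<partial>circle_measure) = (\<integral>\<^sup>+\<zeta>. b \<zeta> * indicator A \<zeta> \<partial>circle_measure)"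
      using ae AE_space
      by (intro nn_integral_cong_AE, eventually_elim) (auto simp: sp b e2ennreal_neg split: split_indicator)
    moreover have "(\<integral>\<^sup>+\<zeta>. e2ennreal (- (indicator A \<zeta> * \<alpha> \<zeta>)) \<partial>circle_measure) = (\<integral>\<^sup>+\<zeta>. 0 \<partial>circle_measure)"
      using ae AE_space
      by (intro nn_integral_cong_AE, eventually_elim) (auto simp: sp neg e2ennreal_neg split: split_indicator)
    ultimately show ?thesis
      unfolding ereal_integral_def by (simp add: circle_measure_eq nn_integral_completion zero_ennreal.rep_eq)
  qed
  have "(\<integral>\<^sup>+\<zeta>. b \<zeta> \<partial>arc_measure) = 1"
  proof -
    have "(\<integral>\<^sup>+\<zeta>. e2ennreal (\<beta> \<zeta>) \<partial>arc_measure) = (\<integral>\<^sup>+\<zeta>. b \<zeta> \<partial>arc_measure)"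
      by (intro nn_integral_cong) (simp add: space_arc_measure b)
    moreover have "(\<integral>\<^sup>+\<zeta>. e2ennreal (- \<beta> \<zeta>) \<partial>arc_measure) = (\<integral>\<^sup>+\<zeta>. 0 \<partial>arc_measure)"
      by (intro nn_integral_cong) (simp add: space_arc_measure neg)
    ultimately have "enn2ereal (\<integral>\<^sup>+\<zeta>. b \<zeta> \<partial>arc_measure) = 1"
      using one unfolding ereal_integral_def circle_measure_eq nn_integral_completion
      by (simp add: zero_ennreal.rep_eq)
    then show ?thesis by (metis enn2ereal_inject one_ennreal.rep_eq)
  qed
  then have "\<exists>u\<in>exhaustion_functions_1. boundary_measure u
      (distr (density arc_measure b) (restrict_space borel (cball 0 1)) (\<lambda>z. z))"
    unfolding b_def by (intro exhaustion_of_decomposition P(1))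
  then obtain u where u: "u \<in> exhaustion_functions_1"
    "boundary_measure u (distr (density arc_measure b) (restrict_space borel (cball 0 1)) (\<lambda>z. z))" by blast
  define \<mu> where "\<mu> = distr (density arc_measure b) (restrict_space borel (cball 0 1)) (\<lambda>z::complex. z)"
  have id: "(\<lambda>z. z) \<in> density arc_measure b \<rightarrow>\<^sub>M restrict_space borel (cball 0 1)"
    using borel_measurable_arcI[of "\<lambda>z. z"]
    by (intro measurable_restrict_space2) (auto simp: space_arc_measure)
  have "is_circle_density \<alpha> \<mu>"
    unfolding is_circle_density_def
  proof
    fix A assume A: "A \<in> sets \<mu>"
    then have A': "A \<in> sets borel" unfolding \<mu>_def by (auto simp: sets_restrict_space_iff)
    have As: "A \<inter> sphere 0 1 \<in> sets arc_measure"
      unfolding sets_arc_measure using A' by (simp add: sets_restrict_space_iff)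
    have "emeasure \<mu> A = emeasure (density arc_measure b) (A \<inter> sphere 0 1)"
      unfolding \<mu>_def using A[unfolded \<mu>_def] by (simp add: emeasure_distr[OF id] space_arc_measure)
    also have "\<dots> = (\<integral>\<^sup>+\<zeta>. b \<zeta> * indicator (A \<inter> sphere 0 1) \<zeta> \<partial>arc_measure)"
      by (rule emeasure_density[OF bm As])
    also have "\<dots> = (\<integral>\<^sup>+\<zeta>. b \<zeta> * indicator A \<zeta> \<partial>arc_measure)"
      by (intro nn_integral_cong) (simp add: space_arc_measure indicator_def)
    finally show "ereal_integral circle_measure (\<lambda>\<zeta>. indicator A \<zeta> * \<alpha> \<zeta>) = enn2ereal (emeasure \<mu> A)"
      by (simp only: int)
  qed
  with u show ?thesis unfolding \<mu>_def by blast
qed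

text \<open>A density determines \<alpha> only up to a null set, so semicontinuity and the lower
  bound are imposed on a representative \<beta>. Its values are extended reals because a balayage
  may be infinite at some points of the circle.\<close>

theorem theorem3p3:
  fixes \<alpha> :: "complex \<Rightarrow> ereal"
  assumes "\<alpha> \<in> borel_measurable circle_measure"
  shows "(\<exists>u\<in>exhaustion_functions_1. \<exists>\<mu>. boundary_measure u \<mu> \<and> is_circle_density \<alpha> \<mu>) \<longleftrightarrow>
    (\<exists>\<beta>. (AE \<zeta> in circle_measure. \<alpha> \<zeta> = \<beta> \<zeta>) \<and>
       lsc_on (sphere 0 1) \<beta> \<and>
       (\<exists>c::real. 0 < c \<and> (\<forall>\<theta>::real. ereal c \<le> \<beta> (cis \<theta>))) \<and>
       ereal_integral circle_measure \<beta> = 1)"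
proof (rule iffI; elim bexE exE conjE)
  fix u \<mu>
  assume "u \<in> exhaustion_functions_1" "boundary_measure u \<mu>" "is_circle_density \<alpha> \<mu>"
  then show "\<exists>\<beta>. (AE \<zeta> in circle_measure. \<alpha> \<zeta> = \<beta> \<zeta>) \<and>
       lsc_on (sphere 0 1) \<beta> \<and>
       (\<exists>c::real. 0 < c \<and> (\<forall>\<theta>::real. ereal c \<le> \<beta> (cis \<theta>))) \<and>
       ereal_integral circle_measure \<beta> = 1"
    by (rule circle_density_of_exhaustion[OF assms])
next
  fix \<beta> :: "complex \<Rightarrow> ereal" and c :: real
  assume "AE \<zeta> in circle_measure. \<alpha> \<zeta> = \<beta> \<zeta>" "lsc_on (sphere 0 1) \<beta>" "0 < c"
    "\<forall>\<theta>::real. ereal c \<le> \<beta> (cis \<theta>)" "ereal_integral circle_measure \<beta> = 1"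
  then show "\<exists>u\<in>exhaustion_functions_1. \<exists>\<mu>. boundary_measure u \<mu> \<and> is_circle_density \<alpha> \<mu>"
    by (intro exhaustion_of_circle_density) auto
qed

end
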